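(* Let $k$ be the perfect closure of the rational function field $\mathbb{F}_2(t)$. Then there exists an ordinary elliptic curve $X$ over $k$ for which there exists no finite separable tame morphism $X\to\mathbb{P}^1_k$ of $k$-schemes.
   Context: Let $\overline{k}$ be an algebraic closure of $k$. For a finite separable morphism $f\colon X\to\mathbb{P}^1_k$ and $x\in X(\overline{k})$, the ramification index $e_x$ of $f$ at $x$ is the positive integer with $f^{-1}\mathfrak{m}_{\mathbb{P}^1_{\overline{k}},f(x)}\cdot\mathcal{O}_{X_{\overline{k}}}=\mathfrak{m}_{X_{\overline{k}},x}^{e_x}$. The morphism $f$ is tame if $e_x$ is not divisible by the characteristic (here $2$), i.e. is odd, for every $x\in X(\overline{k})$. *)

theory Defs
  imports
    "HOL-Library.Poly_Mapping"
    "HOL-Library.Numeral_Type"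
    "HOL-Library.Z2"
    "HOL-Computational_Algebra.Fraction_Field"
    "HOL-Computational_Algebra.Polynomial"
    "HOL-Algebra.Algebra"
    "HOL-Algebra.Algebraic_Closure_Type"
begin

text \<open>
  Conventions. Throughout, \<open>'K\<close> is an algebraically closed field and \<open>k \<subseteq> 'K\<close> a perfect
  subfield over which \<open>'K\<close> is algebraic, so that \<open>'K\<close> is an algebraic closure of \<open>k\<close>. A
  geometrically integral hypersurface in projective space over \<open>k\<close> is handled in the language
  of varieties: through its \<open>'K\<close>-points and through homogeneous polynomials with coefficients
  in \<open>k\<close>. Taking \<open>k = UNIV\<close> in any of the definitions gives the corresponding notion for the
  base change to \<open>'K\<close>.
\<close>

section \<open>Homogeneous polynomials\<close>

type_synonym ('v, 'K) mpoly = "('v \<Rightarrow>\<^sub>0 nat) \<Rightarrow>\<^sub>0 'K"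

definition mconst :: "'K \<Rightarrow> ('v, 'K::zero) mpoly" where
  "mconst c = Poly_Mapping.single 0 c"

definition mvar :: "'v \<Rightarrow> ('v, 'K::zero_neq_one) mpoly" where
  "mvar i = Poly_Mapping.single (Poly_Mapping.single i 1) 1"

definition meval :: "('v::finite, 'K::comm_ring_1) mpoly \<Rightarrow> ('v \<Rightarrow> 'K) \<Rightarrow> 'K" where
  "meval p x = (\<Sum>m\<in>Poly_Mapping.keys p.
     Poly_Mapping.lookup p m * (\<Prod>i\<in>UNIV. x i ^ Poly_Mapping.lookup m i))"

definition msubst ::
  "('w::finite, 'K::comm_ring_1) mpoly \<Rightarrow> ('w \<Rightarrow> ('v, 'K) mpoly) \<Rightarrow> ('v, 'K) mpoly" where
  "msubst p G = (\<Sum>m\<in>Poly_Mapping.keys p.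
     mconst (Poly_Mapping.lookup p m) * (\<Prod>i\<in>UNIV. G i ^ Poly_Mapping.lookup m i))"

definition mderiv :: "'v \<Rightarrow> ('v, 'K::comm_ring_1) mpoly \<Rightarrow> ('v, 'K) mpoly" where
  "mderiv i p = (\<Sum>m\<in>Poly_Mapping.keys p.
     Poly_Mapping.single (m - Poly_Mapping.single i 1)
       (of_nat (Poly_Mapping.lookup m i) * Poly_Mapping.lookup p m))"

definition form :: "'K set \<Rightarrow> nat \<Rightarrow> ('v::finite, 'K::zero) mpoly \<Rightarrow> bool" where
  "form k d p \<longleftrightarrow>
     (\<forall>m\<in>Poly_Mapping.keys p.
        Poly_Mapping.lookup p m \<in> k \<and> (\<Sum>i\<in>UNIV. Poly_Mapping.lookup m i) = d)"


section \<open>Projective hypersurfaces\<close>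

text \<open>
  A form \<open>F\<close> that is irreducible over \<open>'K\<close> stands for the hypersurface \<open>F = 0\<close>; the zero form
  stands for the whole projective space. In both cases the homogeneous ideal is \<open>{G. F dvd G}\<close>.
\<close>

type_synonym ('v, 'K) ppoint = "('v \<Rightarrow> 'K) set"

definition proj_point :: "('v \<Rightarrow> 'K::field) \<Rightarrow> ('v, 'K) ppoint" where
  "proj_point x = {(\<lambda>i. c * x i) | c. c \<noteq> 0}"

definition points :: "('v::finite, 'K::field) mpoly \<Rightarrow> ('v, 'K) ppoint set" where
  "points F = {proj_point x | x. x \<noteq> (\<lambda>_. 0) \<and> meval F x = 0}"

definition vanishes_at :: "('v::finite, 'K::field) mpoly \<Rightarrow> ('v, 'K) ppoint \<Rightarrow> bool" where
  "vanishes_at A P \<longleftrightarrow> (\<forall>x\<in>P. meval A x = 0)"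

definition smooth :: "('v::finite, 'K::field) mpoly \<Rightarrow> bool" where
  "smooth F \<longleftrightarrow> (\<forall>P\<in>points F. \<exists>i. \<not> vanishes_at (mderiv i F) P)"

text \<open>
  The function field: fractions \<open>A / B\<close> of forms of equal degree with \<open>B\<close> not in the ideal of the
  hypersurface, modulo those with \<open>A\<close> in that ideal.
\<close>

definition fraction_ring ::
  "'K set \<Rightarrow> ('v::{finite,linorder}, 'K::field) mpoly \<Rightarrow> ('v, 'K) mpoly fract ring" where
  "fraction_ring k F =
     \<lparr>carrier = {Fract A B | A B. \<exists>d. form k d A \<and> form k d B \<and> \<not> F dvd B},
      monoid.mult = (*), one = 1, ring.zero = 0, add = (+)\<rparr>"

definition fraction_ideal ::
  "'K set \<Rightarrow> ('v::{finite,linorder}, 'K::field) mpoly \<Rightarrow> ('v, 'K) mpoly fract set" where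
  "fraction_ideal k F =
     {Fract A B | A B. \<exists>d. form k d A \<and> form k d B \<and> \<not> F dvd B \<and> F dvd A}"

definition function_field ::
  "'K set \<Rightarrow> ('v::{finite,linorder}, 'K::field) mpoly \<Rightarrow> ('v, 'K) mpoly fract set ring" where
  "function_field k F = fraction_ring k F Quot fraction_ideal k F"

definition rat ::
  "'K set \<Rightarrow> ('v::{finite,linorder}, 'K::field) mpoly \<Rightarrow> ('v, 'K) mpoly \<Rightarrow> ('v, 'K) mpoly
     \<Rightarrow> ('v, 'K) mpoly fract set" where
  "rat k F A B = fraction_ideal k F +>\<^bsub>fraction_ring k F\<^esub> Fract A B"

text \<open>
  A \<open>'K\<close>-point \<open>P\<close> lies over a closed point of the scheme over \<open>k\<close>; the following are the local
  ring of that closed point and its maximal ideal, inside the function field.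
\<close>

definition local_ring ::
  "'K set \<Rightarrow> ('v::{finite,linorder}, 'K::field) mpoly \<Rightarrow> ('v, 'K) ppoint
     \<Rightarrow> ('v, 'K) mpoly fract set set" where
  "local_ring k F P =
     {rat k F A B | A B. \<exists>d. form k d A \<and> form k d B \<and> \<not> vanishes_at B P}"

definition max_ideal ::
  "'K set \<Rightarrow> ('v::{finite,linorder}, 'K::field) mpoly \<Rightarrow> ('v, 'K) ppoint
     \<Rightarrow> ('v, 'K) mpoly fract set set" where
  "max_ideal k F P =
     {rat k F A B | A B. \<exists>d. form k d A \<and> form k d B \<and> \<not> vanishes_at B P \<and> vanishes_at A P}"

text \<open>Sections of the structure sheaf over a nonempty open \<open>U\<close>, given by its \<open>'K\<close>-points.\<close>

definition regular_on ::
  "'K set \<Rightarrow> ('v::{finite,linorder}, 'K::field) mpoly \<Rightarrow> ('v, 'K) ppoint set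
     \<Rightarrow> ('v, 'K) mpoly fract set set" where
  "regular_on k F U = {h \<in> carrier (function_field k F). \<forall>P\<in>U. h \<in> local_ring k F P}"

text \<open>
  A nonempty open \<open>U\<close> is affine iff it is the spectrum of its finitely generated ring of
  functions \<open>A\<close>, that is, iff the local rings of its closed points are precisely the
  localizations of \<open>A\<close> at its maximal ideals.
\<close>

definition localization_at :: "('a, 'b) ring_scheme \<Rightarrow> 'a set \<Rightarrow> 'a set \<Rightarrow> 'a set" where
  "localization_at L A m = {h \<in> carrier L. \<exists>s\<in>A - m. s \<otimes>\<^bsub>L\<^esub> h \<in> A}"

definition affine_open ::
  "'K set \<Rightarrow> ('v::{finite,linorder}, 'K::field) mpoly \<Rightarrow> ('v, 'K) ppoint set \<Rightarrow> bool" where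
  "affine_open k F U \<longleftrightarrow>
     (let L = function_field k F; A = regular_on k F U in
        (\<exists>S. finite S \<and> S \<subseteq> A \<and> A = generate_ring L ({rat k F (mconst c) 1 | c. c \<in> k} \<union> S)) \<and>
        {local_ring k F P | P. P \<in> U} =
          {localization_at L A m | m. maximalideal m (L\<lparr>carrier := A\<rparr>)})"


section \<open>Morphisms\<close>

text \<open>
  Forms \<open>G\<close> of a common degree represent \<open>f\<close> on the open set where they do not all vanish.
  A morphism over \<open>k\<close> is a map on \<open>'K\<close>-points represented around every point by forms over \<open>k\<close>.
\<close>

definition represents ::
  "'K set \<Rightarrow> ('v::finite, 'K::field) mpoly \<Rightarrow> ('w \<Rightarrow> ('v, 'K) mpoly)
     \<Rightarrow> (('v, 'K) ppoint \<Rightarrow> ('w, 'K) ppoint) \<Rightarrow> bool" where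
  "represents k F G f \<longleftrightarrow>
     (\<exists>d. \<forall>i. form k d (G i)) \<and>
     (\<forall>x. x \<noteq> (\<lambda>_. 0) \<and> meval F x = 0 \<and> (\<exists>i. meval (G i) x \<noteq> 0) \<longrightarrow>
        f (proj_point x) = proj_point (\<lambda>i. meval (G i) x))"

definition morphism ::
  "'K set \<Rightarrow> ('v::finite, 'K::field) mpoly \<Rightarrow> ('w::finite, 'K) mpoly
     \<Rightarrow> (('v, 'K) ppoint \<Rightarrow> ('w, 'K) ppoint) \<Rightarrow> bool" where
  "morphism k F F' f \<longleftrightarrow>
     (\<forall>P\<in>points F. f P \<in> points F' \<and>
        (\<exists>G. represents k F G f \<and> (\<exists>i. \<not> vanishes_at (G i) P)))"

text \<open>
  The image of a set of rational functions under \<open>f\<^sup>*\<close>, computed as \<open>(a / b) \<circ> f = a(G) / b(G)\<close>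
  for any \<open>G\<close> representing \<open>f\<close> such that \<open>b(G)\<close> does not vanish identically.
\<close>

definition pullback ::
  "'K set \<Rightarrow> ('v::{finite,linorder}, 'K::field) mpoly \<Rightarrow> ('w::{finite,linorder}, 'K) mpoly
     \<Rightarrow> (('v, 'K) ppoint \<Rightarrow> ('w, 'K) ppoint)
     \<Rightarrow> ('w, 'K) mpoly fract set set \<Rightarrow> ('v, 'K) mpoly fract set set" where
  "pullback k F F' f H =
     {rat k F (msubst a G) (msubst b G) | a b G.
        (\<exists>d. form k d a \<and> form k d b) \<and> \<not> F' dvd b \<and> rat k F' a b \<in> H \<and>
        represents k F G f \<and> \<not> F dvd msubst b G}"

text \<open>Finiteness is tested on the standard affine cover of the projective target.\<close>

definition finite_morphism ::
  "'K set \<Rightarrow> ('v::{finite,linorder}, 'K::field) mpoly \<Rightarrow> ('w::{finite,linorder}, 'K) mpoly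
     \<Rightarrow> (('v, 'K) ppoint \<Rightarrow> ('w, 'K) ppoint) \<Rightarrow> bool" where
  "finite_morphism k F F' f \<longleftrightarrow> morphism k F F' f \<and>
     (\<forall>i. let V = {Q \<in> points F'. \<not> vanishes_at (mvar i) Q};
              U = {P \<in> points F. f P \<in> V};
              A = regular_on k F U;
              B = pullback k F F' f (regular_on k F' V);
              L = function_field k F
          in affine_open k F U \<and>
             (\<exists>S. finite S \<and> S \<subseteq> A \<and>
                (\<forall>a\<in>A. \<exists>c \<in> S \<rightarrow> B. a = (\<Oplus>\<^bsub>L\<^esub>s\<in>S. c s \<otimes>\<^bsub>L\<^esub> s))))"

text \<open>
  Formal derivative of a polynomial in the representation of \<open>HOL-Algebra.Polynomials\<close> (lists of
  coefficients, leading coefficient first).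
\<close>

definition list_pderiv :: "('a, 'b) ring_scheme \<Rightarrow> 'a list \<Rightarrow> 'a list" where
  "list_pderiv R p = ring.normalize R
     (map (\<lambda>i. add_pow R (length p - 1 - i) (p ! i)) [0..<length p - 1])"

definition separable_extension :: "('a, 'b) ring_scheme \<Rightarrow> 'a set \<Rightarrow> bool" where
  "separable_extension L E \<longleftrightarrow>
     (\<forall>h\<in>carrier L. (ring.algebraic L over E) h \<and>
        (let p = ring.Irr L E h in
           Idl\<^bsub>univ_poly L E\<^esub> {p, list_pderiv L p} = carrier (univ_poly L E)))"

definition separable_morphism ::
  "'K set \<Rightarrow> ('v::{finite,linorder}, 'K::field) mpoly \<Rightarrow> ('w::{finite,linorder}, 'K) mpoly
     \<Rightarrow> (('v, 'K) ppoint \<Rightarrow> ('w, 'K) ppoint) \<Rightarrow> bool" where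
  "separable_morphism k F F' f \<longleftrightarrow> morphism k F F' f \<and>
     separable_extension (function_field k F)
       (pullback k F F' f (carrier (function_field k F')))"

definition ramification_index ::
  "('v::{finite,linorder}, 'K::field) mpoly \<Rightarrow> ('w::{finite,linorder}, 'K) mpoly
     \<Rightarrow> (('v, 'K) ppoint \<Rightarrow> ('w, 'K) ppoint) \<Rightarrow> ('v, 'K) ppoint \<Rightarrow> nat" where
  "ramification_index F F' f P =
     (let O\<^sub>P = (function_field UNIV F)\<lparr>carrier := local_ring UNIV F P\<rparr> in
        THE e. 0 < e \<and>
          Idl\<^bsub>O\<^sub>P\<^esub> (pullback UNIV F F' f (max_ideal UNIV F' (f P))) =
            max_ideal UNIV F P [^]\<^bsub>ideals_set O\<^sub>P\<^esub> e)"

definition tame ::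
  "('v::{finite,linorder}, 'K::field) mpoly \<Rightarrow> ('w::{finite,linorder}, 'K) mpoly
     \<Rightarrow> (('v, 'K) ppoint \<Rightarrow> ('w, 'K) ppoint) \<Rightarrow> bool" where
  "tame F F' f \<longleftrightarrow> (\<forall>P\<in>points F. \<not> CHAR('K) dvd ramification_index F F' f P)"

definition P1 :: "(2, 'K::field) mpoly" where
  "P1 = 0"


section \<open>Elliptic curves\<close>

text \<open>The coordinates \<open>x, y, z\<close> on the projective plane have indices \<open>0, 1, 2\<close>.\<close>

definition weierstrass :: "'K \<Rightarrow> 'K \<Rightarrow> 'K \<Rightarrow> 'K \<Rightarrow> 'K \<Rightarrow> (3, 'K::field) mpoly" where
  "weierstrass a1 a2 a3 a4 a6 =
     (let x = mvar 0; y = mvar 1; z = mvar 2 in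
        y^2 * z + mconst a1 * x * y * z + mconst a3 * y * z^2
        - (x^3 + mconst a2 * x^2 * z + mconst a4 * x * z^2 + mconst a6 * z^3))"

definition elliptic_curve :: "'K::field set \<Rightarrow> 'K \<Rightarrow> 'K \<Rightarrow> 'K \<Rightarrow> 'K \<Rightarrow> 'K \<Rightarrow> bool" where
  "elliptic_curve k a1 a2 a3 a4 a6 \<longleftrightarrow>
     {a1, a2, a3, a4, a6} \<subseteq> k \<and> smooth (weierstrass a1 a2 a3 a4 a6)"

text \<open>
  The group of \<open>'K\<close>-points in affine coordinates: \<open>Some (x, y)\<close> is \<open>[x : y : 1]\<close> and \<open>None\<close> is the
  origin \<open>[0 : 1 : 0]\<close>. The addition is the chord and tangent law.
\<close>

definition ec_points :: "'K::field \<Rightarrow> 'K \<Rightarrow> 'K \<Rightarrow> 'K \<Rightarrow> 'K \<Rightarrow> ('K \<times> 'K) option set" where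
  "ec_points a1 a2 a3 a4 a6 =
     insert None {Some (x, y) | x y. y^2 + a1 * x * y + a3 * y = x^3 + a2 * x^2 + a4 * x + a6}"

fun ec_add :: "'K::field \<Rightarrow> 'K \<Rightarrow> 'K \<Rightarrow> 'K \<Rightarrow> 'K
    \<Rightarrow> ('K \<times> 'K) option \<Rightarrow> ('K \<times> 'K) option \<Rightarrow> ('K \<times> 'K) option" where
  "ec_add a1 a2 a3 a4 a6 None Q = Q"
| "ec_add a1 a2 a3 a4 a6 (Some P) None = Some P"
| "ec_add a1 a2 a3 a4 a6 (Some (x1, y1)) (Some (x2, y2)) =
     (if x1 = x2 \<and> y1 + y2 + a1 * x2 + a3 = 0 then None
      else let l = (if x1 = x2
                    then (3 * x1^2 + 2 * a2 * x1 + a4 - a1 * y1) / (2 * y1 + a1 * x1 + a3)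
                    else (y2 - y1) / (x2 - x1));
               n = y1 - l * x1;
               x3 = l^2 + a1 * l - a2 - x1 - x2
           in Some (x3, - (l + a1) * x3 - n - a3))"

text \<open>Ordinary: the characteristic \<open>p\<close> is positive and there are exactly \<open>p\<close> points of \<open>p\<close>-torsion.\<close>

definition ordinary :: "'K::field \<Rightarrow> 'K \<Rightarrow> 'K \<Rightarrow> 'K \<Rightarrow> 'K \<Rightarrow> bool" where
  "ordinary a1 a2 a3 a4 a6 \<longleftrightarrow> CHAR('K) > 0 \<and>
     card {P \<in> ec_points a1 a2 a3 a4 a6.
             (ec_add a1 a2 a3 a4 a6 P ^^ CHAR('K)) None = None} = CHAR('K)"


section \<open>The base field\<close>

text \<open>The perfect closure of the rational function field over the field with two elements,
  inside an algebraic closure of the latter.\<close>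

definition perfect_closure_F2t :: "bit poly fract alg_closure set" where
  "perfect_closure_F2t = {x. \<exists>n::nat. x ^ (2 ^ n) \<in> range to_ac}"

end

theory Submission
  imports Defs
begin

text \<open>
  The curve is \<open>y\<^sup>2 + x y = x\<^sup>3 + t x\<^sup>2 + 1\<close>. With respect to a local parameter \<open>s\<close>, every Laurent series
  is \<open>a\<^sup>4 + c\<^sup>4 s\<^sup>2 + q\<^sup>4 s + r\<^sup>4 s\<^sup>3\<close>, and if it has odd order after subtraction of a constant then
  \<open>(c\<^sup>2 + q r) / (q\<^sup>2 + r\<^sup>2 s)\<close> is regular. This invariant transforms in an affine way under a change of
  \<open>s\<close>. Hence, if \<open>f\<close> is tame and \<open>f = a\<^sup>4 + c\<^sup>4 x\<^sup>2 + q\<^sup>4 x + r\<^sup>4 x\<^sup>3\<close> in the function field, the function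
  \<open>(c\<^sup>2 + q r) / (q\<^sup>2 + r\<^sup>2 x) + 1 + 1 / x\<close> has at most a simple pole at the point \<open>(0, 1)\<close> of order two,
  no other pole, and a zero at infinity. By Riemann--Roch it vanishes, which can be rewritten as
  \<open>x (u\<^sup>2 + u v + v\<^sup>2) = w\<^sup>2\<close> with \<open>u = q\<close>, \<open>v = x r\<close>, \<open>w = x (c + q + r)\<close>.

  Over the perfect closure of \<open>F\<^sub>2(t)\<close> there is no nontrivial solution. Indeed \<open>u, v, w\<close> are defined over
  \<open>F\<^sub>2(\<tau>)\<close> with \<open>\<tau> = t\<close> raised to the power \<open>1 / 2\<^sup>n\<close>, and a substitution \<open>y \<mapsto> y + \<theta> x\<close> turns the curve into
  the one with parameter \<open>\<tau>\<close>. Its function field over \<open>F\<^sub>2\<close> is \<open>F\<^sub>2(x, \<zeta>)\<close> with \<open>\<zeta> = y / x\<close>. Comparing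
  leading coefficients in \<open>\<zeta>\<close> leads to the same equation in \<open>F\<^sub>2[x]\<close>, where \<open>u\<^sup>2 + u v + v\<^sup>2\<close> has even degree
  because this form is anisotropic over \<open>F\<^sub>2\<close>.
\<close>

section \<open>Rings of characteristic two\<close>

text \<open>Put W = a^2 + c^2 x and B = q^2 + r^2 x, so that f = W^2 + B^2 x and df = B^2 dx.
  Tameness says that f minus its value, or f itself at a pole, has odd order; this order is read off
  from B alone, and parity of exponents then bounds the part of W that carries c. Squares would only
  see B; the expansion in fourth powers turns this bound into a condition on c, q and r. The
  correction 1 + 1/x records where x fails to be a local parameter up to a constant: at (0, 1), the
  only affine ramification point of x since y^2 + x y has derivative x in y, and at infinity. The
  obstruction is arithmetic. Over a field with a primitive cube root of unity the form u^2 + u v +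
  v^2 has nontrivial zeros and the final equation is solvable. So the valuations are studied over
  the algebraic closure, but the expansion of f has to be made over k, where fourth roots exist
  because k is perfect. That t is transcendental makes the total space of the family of curves a
  rational surface, which is what allows a comparison of degrees in polynomial rings.\<close>

class char2 = comm_ring_1 +
  assumes one_plus_one: "1 + 1 = 0"
begin

lemma two_char2 [simp]: "2 = 0"
  using one_plus_one by simp

lemma add_self [simp]: "a + a = 0"
  using mult_2 [of a] by simp

lemma add_self_left [simp]: "a + (a + b) = b"
  by (simp add: add.assoc [symmetric])

text \<open>As simp rules this and the next lemma remove all signs; equations are then moved from
  side to side with \<open>add_eq_0_char2\<close>.\<close>

lemma uminus_char2 [simp]: "- a = a"
  by (rule minus_unique) simp

lemma diff_char2 [simp]: "a - b = a + b"
  by (simp add: diff_conv_add_uminus)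

lemma add_eq_0_char2: "a + b = 0 \<longleftrightarrow> a = b"
  using eq_neg_iff_add_eq_0 [of a b] by simp

lemma square_add: "(a + b)^2 = a^2 + b^2"
  by (simp add: power2_eq_square algebra_simps)

lemma fourth_add: "(a + b)^4 = a^4 + b^4"
proof -
  have "(a + b)^4 = ((a + b)^2)^2" "a^4 = (a^2)^2" "b^4 = (b^2)^2"
    by (simp_all flip: power_mult)
  then show ?thesis by (simp add: square_add)
qed

end

instance bit :: char2 by standard simp
instance poly :: (char2) char2
  by standard (simp add: one_pCons del: one_add_one)
instance fps :: (char2) char2
proof
  have "1 + 1 = (fps_const (1 + 1) :: 'a fps)" by (simp only: fps_const_1_eq_1 flip: fps_const_add)
  then show "1 + 1 = (0 :: 'a fps)" by (simp only: one_plus_one fps_const_0_eq_0)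
qed

instance fls :: (char2) char2
proof
  have "1 + 1 = (fls_const (1 + 1) :: 'a fls)" by (simp only: fls_const_1 flip: fls_plus_const)
  then show "1 + 1 = (0 :: 'a fls)" by (simp only: one_plus_one fls_const_0)
qed

lemma fract_char2: "1 + 1 = (0 :: 'a::{idom,char2} fract)"
  by (simp add: One_fract_def Zero_fract_def add_fract)

instance fract :: ("{idom,char2}") char2
  by standard (rule fract_char2)

instance alg_closure :: ("{field,char2}") char2
proof
  have "1 + 1 = (to_ac (1 + 1) :: 'a alg_closure)" by (simp only: to_ac_add to_ac_1)
  then show "1 + 1 = (0 :: 'a alg_closure)" by simp
qed

instance poly_mapping :: (comm_monoid_add, char2) char2
proof
  have "1 + 1 = (Poly_Mapping.single 0 (1 + 1) :: 'a \<Rightarrow>\<^sub>0 'b)"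
    by (simp only: single_one single_add)
  then show "1 + 1 = (0 :: 'a \<Rightarrow>\<^sub>0 'b)" by (simp only: one_plus_one single_zero)
qed

lemma CHAR_char2 [simp]: "CHAR('a::{field,char2}) = 2"
proof -
  have "CHAR('a) dvd 2"
    by (subst of_nat_eq_0_iff_char_dvd [symmetric]) simp
  moreover have "CHAR('a) \<noteq> 1"
    using of_nat_CHAR [where ?'a = 'a] by (metis of_nat_1 one_neq_zero)
  ultimately show ?thesis by (metis prime_nat_iff two_is_prime_nat)
qed

section \<open>Evaluation of polynomials\<close>

text \<open>A locale of maps between types rather than carrier sets: the same evaluation lemmas are
  instantiated for constants in polynomials, power series and Laurent series, and for composites of
  such maps.\<close>

locale rhom =
  fixes \<phi> :: "'a::comm_ring_1 \<Rightarrow> 'b::comm_ring_1"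
  assumes hom_add: "\<phi> (a + b) = \<phi> a + \<phi> b"
    and hom_mult: "\<phi> (a * b) = \<phi> a * \<phi> b"
    and hom_1: "\<phi> 1 = 1"
begin

lemma hom_0: "\<phi> 0 = 0"
  using hom_add [of 0 0] by simp

lemma hom_uminus: "\<phi> (- a) = - \<phi> a"
  using hom_add [of a "- a"] by (metis hom_0 minus_unique right_minus)

lemma hom_diff: "\<phi> (a - b) = \<phi> a - \<phi> b"
  using hom_add [of a "- b"] by (simp add: hom_uminus)

lemma hom_power: "\<phi> (a ^ n) = \<phi> a ^ n"
  by (induction n) (simp_all add: hom_1 hom_mult)

lemma hom_sum: "\<phi> (sum f A) = (\<Sum>i\<in>A. \<phi> (f i))"
  by (induction A rule: infinite_finite_induct) (simp_all add: hom_0 hom_add)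

lemma hom_prod: "\<phi> (prod f A) = (\<Prod>i\<in>A. \<phi> (f i))"
  by (induction A rule: infinite_finite_induct) (simp_all add: hom_1 hom_mult)

lemmas hom_simps = hom_0 hom_1 hom_add hom_mult hom_uminus hom_diff hom_power hom_sum hom_prod

end

text \<open>Evaluation along a map of coefficients unites three notions: the identity gives
  \<open>meval\<close>, \<open>mconst\<close> gives \<open>msubst\<close>, and
  \<open>fls_const\<close> gives the value at a point with Laurent series coordinates.\<close>

definition peval :: "('K \<Rightarrow> 'R::comm_ring_1) \<Rightarrow> ('v::finite \<Rightarrow> 'R) \<Rightarrow> ('v, 'K::comm_ring_1) mpoly \<Rightarrow> 'R" where
  "peval \<phi> x p = (\<Sum>m\<in>Poly_Mapping.keys p.
     \<phi> (Poly_Mapping.lookup p m) * (\<Prod>i\<in>UNIV. x i ^ Poly_Mapping.lookup m i))"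

lemma meval_eq_peval: "meval p x = peval (\<lambda>c. c) x p"
  by (simp add: meval_def peval_def)

lemma msubst_eq_peval: "msubst p G = peval mconst G p"
  by (simp add: msubst_def peval_def)

lemma mconst_0 [simp]: "mconst 0 = 0"
  by (simp add: mconst_def)

lemma mconst_1 [simp]: "mconst 1 = 1"
  by (simp add: mconst_def)

lemma rhom_mconst: "rhom mconst"
  by standard (simp_all add: mconst_def single_add mult_single)

lemma rhom_ident: "rhom (\<lambda>c::'a::comm_ring_1. c)"
  by standard simp_all

lemma rhom_fps_const: "rhom fps_const"
  by standard (simp_all flip: fps_const_add fps_const_mult)

lemma rhom_fls_const: "rhom fls_const"
  by standard (simp_all add: fls_plus_const fls_const_mult_const)

lemma rhom_fps_to_fls: "rhom fps_to_fls"
  by standard (simp_all add: fls_times_fps_to_fls)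

lemma sum_single_lookup:
  fixes p :: "'a \<Rightarrow>\<^sub>0 'b::comm_monoid_add"
  shows "(\<Sum>m\<in>Poly_Mapping.keys p. Poly_Mapping.single m (Poly_Mapping.lookup p m)) = p"
  by (rule poly_mapping_eqI) (simp add: lookup_sum lookup_single when_def in_keys_iff)

lemma poly_mapping_induct [case_names zero single sum]:
  fixes p :: "'a \<Rightarrow>\<^sub>0 'b::comm_monoid_add"
  assumes "P 0" and "\<And>m c. P (Poly_Mapping.single m c)" and "\<And>p q. P p \<Longrightarrow> P q \<Longrightarrow> P (p + q)"
  shows "P p"
proof -
  have "P (\<Sum>m\<in>S. Poly_Mapping.single m (Poly_Mapping.lookup p m))" for S
    by (induction S rule: infinite_finite_induct) (simp_all add: assms)
  from this [of "Poly_Mapping.keys p"] show ?thesis by (simp add: sum_single_lookup)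
qed

lemma single_conv_monomial:
  fixes c :: "'K::comm_ring_1" and m :: "'v::finite \<Rightarrow>\<^sub>0 nat"
  shows "Poly_Mapping.single m c = mconst c * (\<Prod>i\<in>UNIV. mvar i ^ Poly_Mapping.lookup m i)"
proof -
  have pow: "mvar i ^ n = Poly_Mapping.single (Poly_Mapping.single i n) (1::'K)" for i :: 'v and n
  proof (induction n)
    case (Suc n)
    have "mvar i ^ Suc n = Poly_Mapping.single (Poly_Mapping.single i 1 + Poly_Mapping.single i n) (1::'K)"
      unfolding power_Suc Suc by (simp add: mvar_def mult_single)
    then show ?case by (simp only: single_add [symmetric]) simp
  qed simp
  have "(\<Prod>i\<in>A. Poly_Mapping.single (Poly_Mapping.single i (Poly_Mapping.lookup m i)) (1::'K))
      = Poly_Mapping.single (\<Sum>i\<in>A. Poly_Mapping.single i (Poly_Mapping.lookup m i)) 1" for A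
    by (induction A rule: infinite_finite_induct) (simp_all add: mult_single)
  moreover have "(\<Sum>i\<in>UNIV. Poly_Mapping.single i (Poly_Mapping.lookup m i)) = m"
    by (rule poly_mapping_eqI) (simp add: lookup_sum lookup_single when_def)
  ultimately show ?thesis by (simp add: pow mconst_def mult_single)
qed

context rhom
begin

lemma peval_superset:
  assumes "finite S" "Poly_Mapping.keys p \<subseteq> S"
  shows "peval \<phi> x p = (\<Sum>m\<in>S. \<phi> (Poly_Mapping.lookup p m) * (\<Prod>i\<in>UNIV. x i ^ Poly_Mapping.lookup m i))"
  unfolding peval_def
  by (rule sum.mono_neutral_left) (use assms in \<open>auto simp: in_keys_iff hom_0\<close>)

lemma peval_0 [simp]: "peval \<phi> x 0 = 0"
  by (simp add: peval_def)

lemma peval_single: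
  "peval \<phi> x (Poly_Mapping.single m c) = \<phi> c * (\<Prod>i\<in>UNIV. x i ^ Poly_Mapping.lookup m i)"
  by (subst peval_superset [of "{m}"]) (simp_all add: lookup_single)

lemma peval_add: "peval \<phi> x (p + q) = peval \<phi> x p + peval \<phi> x q"
proof -
  let ?S = "Poly_Mapping.keys p \<union> Poly_Mapping.keys q"
  have "finite ?S" "Poly_Mapping.keys (p + q) \<subseteq> ?S" "Poly_Mapping.keys p \<subseteq> ?S" "Poly_Mapping.keys q \<subseteq> ?S"
    by (auto dest: subsetD [OF keys_add])
  then show ?thesis
    by (simp add: peval_superset [of ?S] lookup_add hom_add distrib_right sum.distrib)
qed

lemma peval_mconst [simp]: "peval \<phi> x (mconst c) = \<phi> c"
  by (simp add: mconst_def peval_single)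

lemma peval_mvar [simp]: "peval \<phi> x (mvar i) = x i"
proof -
  have "(\<Prod>j\<in>UNIV. x j ^ Poly_Mapping.lookup (Poly_Mapping.single i (1::nat)) j) = (\<Prod>j\<in>UNIV. if j = i then x i else 1)"
    by (rule prod.cong) (auto simp: lookup_single when_def)
  then show ?thesis
    by (simp add: mvar_def peval_single hom_1)
qed

lemma peval_mult: "peval \<phi> x (p * q) = peval \<phi> x p * peval \<phi> x q"
proof (induction p arbitrary: q rule: poly_mapping_induct)
  case (single m a)
  show ?case
  proof (induction q rule: poly_mapping_induct)
    case (single n b)
    then show ?case
      by (simp add: mult_single peval_single hom_mult lookup_add power_add prod.distrib algebra_simps)
  next
    case (sum f g)
    then show ?case by (simp add: distrib_left peval_add)
  qed simp
next
  case (sum f g)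
  then show ?case by (simp add: distrib_right peval_add)
qed simp

lemma rhom_peval: "rhom (peval \<phi> x)"
  by standard (simp_all add: peval_add peval_mult hom_1 flip: mconst_1)

text \<open>Applied to a form on the target and a representative \<open>G\<close> of a morphism,
  this computes the pulled back form on a branch.\<close>

lemma peval_peval:
  fixes p :: "('w::finite, 'a) mpoly" and G :: "'w \<Rightarrow> ('v::finite, 'a) mpoly"
  shows "peval \<phi> x (peval mconst G p) = peval \<phi> (\<lambda>i. peval \<phi> x (G i)) p"
proof -
  interpret P: rhom "peval \<phi> x :: ('v, 'a) mpoly \<Rightarrow> 'b" by (rule rhom_peval)
  show ?thesis
    by (simp add: peval_def [of mconst] P.hom_simps) (simp add: peval_def)
qed

lemma hom_peval:
  assumes "rhom \<psi>"
  shows "\<psi> (peval \<phi> x p) = peval (\<lambda>c. \<psi> (\<phi> c)) (\<lambda>i. \<psi> (x i)) p"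
proof -
  interpret \<psi>: rhom \<psi> by fact
  show ?thesis by (simp add: peval_def \<psi>.hom_simps)
qed

end

section \<open>Subfields of coefficients and homogeneous forms over them\<close>

locale subfield_set =
  fixes k :: "'K::field set"
  assumes zero_mem [simp]: "0 \<in> k" and one_mem [simp]: "1 \<in> k"
    and add_mem: "a \<in> k \<Longrightarrow> b \<in> k \<Longrightarrow> a + b \<in> k"
    and uminus_mem: "a \<in> k \<Longrightarrow> - a \<in> k"
    and mult_mem: "a \<in> k \<Longrightarrow> b \<in> k \<Longrightarrow> a * b \<in> k"
    and inverse_mem: "a \<in> k \<Longrightarrow> inverse a \<in> k"

lemma subfield_set_UNIV: "subfield_set UNIV"
  by standard simp_all

definition mdeg :: "('v::finite \<Rightarrow>\<^sub>0 nat) \<Rightarrow> nat" where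
  "mdeg m = (\<Sum>i\<in>UNIV. Poly_Mapping.lookup m i)"

lemma form_def': "form k d p \<longleftrightarrow>
  (\<forall>m\<in>Poly_Mapping.keys p. Poly_Mapping.lookup p m \<in> k \<and> mdeg m = d)"
  by (simp add: form_def mdeg_def)

lemma mdeg_add [simp]: "mdeg (m + n) = mdeg m + mdeg n"
  by (simp add: mdeg_def lookup_add sum.distrib)

lemma mdeg_0 [simp]: "mdeg 0 = 0"
  by (simp add: mdeg_def)

lemma mdeg_single [simp]: "mdeg (Poly_Mapping.single i n) = n"
  by (simp add: mdeg_def lookup_single when_def)

lemma mdeg_eq_0_iff: "mdeg m = 0 \<longleftrightarrow> m = 0"
  by (auto simp: mdeg_def intro: poly_mapping_eqI)

text \<open>Partial sums stay among the monomials of \<open>p\<close> itself, so the coefficient and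
  degree conditions are available in the \<open>single\<close> case.\<close>

lemma form_monomial_induct [consumes 1, case_names zero single add]:
  fixes p :: "('v::finite, 'K::comm_monoid_add) mpoly"
  assumes "form k d p"
    and "P 0"
    and "\<And>m c. c \<in> k \<Longrightarrow> mdeg m = d \<Longrightarrow> P (Poly_Mapping.single m c)"
    and "\<And>p q. P p \<Longrightarrow> P q \<Longrightarrow> P (p + q)"
  shows "P p"
proof -
  have "P (\<Sum>m\<in>S. Poly_Mapping.single m (Poly_Mapping.lookup p m))" if "S \<subseteq> Poly_Mapping.keys p" for S
  proof -
    have "finite S" using finite_subset [OF that] by simp
    from this that show ?thesis
    proof induction
      case empty
      show ?case using assms(2) by simp
    next
      case (insert m S)
      have "P (Poly_Mapping.single m (Poly_Mapping.lookup p m))"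
        using insert.prems assms(1) by (intro assms(3)) (auto simp: form_def')
      then show ?case using insert by (simp add: assms(4))
    qed
  qed
  from this [of "Poly_Mapping.keys p"] show ?thesis
    by (simp add: sum_single_lookup)
qed

lemma form_0 [simp]: "form k d 0"
  by (simp add: form_def)

lemma form_single: "c \<in> k \<Longrightarrow> mdeg m = d \<Longrightarrow> form k d (Poly_Mapping.single m c)"
  by (simp add: form_def')

lemma form_mono: "form k d p \<Longrightarrow> k \<subseteq> k' \<Longrightarrow> form k' d p"
  by (auto simp: form_def)

lemma form_UNIV: "form k d p \<Longrightarrow> form UNIV d p"
  by (erule form_mono) simp

context subfield_set
begin

lemma power_mem: "a \<in> k \<Longrightarrow> a ^ n \<in> k"
  by (induction n) (simp_all add: mult_mem)

lemma sum_mem: "(\<And>i. i \<in> A \<Longrightarrow> f i \<in> k) \<Longrightarrow> sum f A \<in> k"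
  by (induction A rule: infinite_finite_induct) (simp_all add: add_mem)

lemma form_add: "form k d p \<Longrightarrow> form k d q \<Longrightarrow> form k d (p + q)"
  unfolding form_def'
proof safe
  fix m assume pq: "\<forall>m\<in>Poly_Mapping.keys p. Poly_Mapping.lookup p m \<in> k \<and> mdeg m = d"
    "\<forall>m\<in>Poly_Mapping.keys q. Poly_Mapping.lookup q m \<in> k \<and> mdeg m = d"
    and m: "m \<in> Poly_Mapping.keys (p + q)"
  then show "mdeg m = d" using keys_add [of p q] by blast
  have "Poly_Mapping.lookup p m \<in> k" "Poly_Mapping.lookup q m \<in> k"
    using pq by (metis in_keys_iff zero_mem)+
  then show "Poly_Mapping.lookup (p + q) m \<in> k" by (simp add: lookup_add add_mem)
qed

lemma form_mconst: "c \<in> k \<Longrightarrow> form k 0 (mconst c)"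
  by (simp add: mconst_def form_single)

lemma form_1: "form k 0 1"
  using form_mconst [of 1] by simp

lemma form_mvar: "form k 1 (mvar i)"
  by (simp add: mvar_def form_single)

lemma form_mult:
  assumes "form k d p" "form k e q"
  shows "form k (d + e) (p * q)"
  using assms(1)
proof (induction rule: form_monomial_induct)
  case (single m c)
  from assms(2) show ?case
    by (induction rule: form_monomial_induct)
      (use single in \<open>simp_all add: mult_single form_single mult_mem distrib_left form_add\<close>)
qed (simp_all add: distrib_right form_add)

lemma form_power: "form k d p \<Longrightarrow> form k (d * n) (p ^ n)"
  by (induction n) (simp_all add: form_1 form_mult)

lemma form_smult: "c \<in> k \<Longrightarrow> form k d p \<Longrightarrow> form k d (mconst c * p)"
  using form_mult [OF form_mconst, of c d p] by simp

lemma form_uminus: "form k d p \<Longrightarrow> form k d (- p)"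
  by (auto simp: form_def uminus_mem)

lemma form_diff: "form k d p \<Longrightarrow> form k d q \<Longrightarrow> form k d (p - q)"
  using form_add [of d p "- q"] by (simp add: form_uminus)

lemma form_prod: "(\<And>i. i \<in> A \<Longrightarrow> form k (d i) (f i)) \<Longrightarrow> form k (sum d A) (prod f A)"
  by (induction A rule: infinite_finite_induct) (simp_all add: form_1 form_mult)

lemma form_peval_mconst:
  assumes "form k d p" and "\<And>i. form k e (G i)"
  shows "form k (e * d) (peval mconst G p)"
proof -
  interpret C: rhom mconst by (rule rhom_mconst)
  show ?thesis using assms(1)
  proof (induction rule: form_monomial_induct)
    case (single m c)
    have "form k (\<Sum>i\<in>UNIV. e * Poly_Mapping.lookup m i) (\<Prod>i\<in>UNIV. G i ^ Poly_Mapping.lookup m i)"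
      by (rule form_prod) (intro form_power assms)
    then show ?case using single
      by (simp add: C.peval_single form_smult mdeg_def flip: sum_distrib_left)
  qed (simp_all add: C.peval_add form_add)
qed

end

text \<open>The degree is an argument of the predicate because the \<open>var\<close> case raises
  it; this suits statements that track the power of a coordinate.\<close>

lemma form_induct [consumes 1, case_names zero const add var]:
  assumes "form k d p"
    and zero: "\<And>d. P d 0"
    and const: "\<And>c. c \<in> k \<Longrightarrow> P 0 (mconst c)"
    and add: "\<And>d p q. P d p \<Longrightarrow> P d q \<Longrightarrow> P d (p + q)"
    and var: "\<And>d i p. P d p \<Longrightarrow> P (Suc d) (mvar i * p)"
  shows "P d (p :: ('v::finite, 'K::comm_ring_1) mpoly)"
  using assms(1)
proof (induction rule: form_monomial_induct)
  case (single m c)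
  then show ?case
  proof (induction d arbitrary: m)
    case 0
    then show ?case using const [of c] by (simp add: mdeg_eq_0_iff mconst_def)
  next
    case (Suc d)
    then obtain i where i: "Poly_Mapping.lookup m i \<noteq> 0"
      unfolding mdeg_def by (metis (no_types, lifting) Zero_not_Suc sum.neutral)
    define m' where "m' = m - Poly_Mapping.single i 1"
    have m: "m = Poly_Mapping.single i 1 + m'"
      using i by (auto intro!: poly_mapping_eqI simp: m'_def lookup_add lookup_minus lookup_single when_def)
    then have "P d (Poly_Mapping.single m' c)" using Suc by simp
    from var [OF this, of i] show ?case
      by (simp add: m mvar_def mult_single)
  qed
qed (use zero add in auto)

lemma (in rhom) peval_scale:
  assumes "form k d p"
  shows "peval \<phi> (\<lambda>i. c * x i) p = c ^ d * peval \<phi> x p"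
  using assms
proof (induction rule: form_monomial_induct)
  case (single m a)
  have "(\<Prod>i\<in>UNIV. c ^ Poly_Mapping.lookup m i) = c ^ d"
    using single by (simp add: mdeg_def flip: power_sum)
  then show ?case
    by (simp add: peval_single power_mult_distrib prod.distrib algebra_simps)
qed (simp_all add: peval_add algebra_simps)

section \<open>Tame Laurent series in characteristic two\<close>

unbundle fps_syntax

text \<open>The involution \<open>i\<close> to \<open>n - i\<close> pairs equal terms, which cancel;
  only its fixed point survives.\<close>

lemma sum_involution_char2:
  fixes h :: "int \<Rightarrow> 'a::char2"
  assumes "\<And>i. h (n - i) = h i"
  shows "sum h {d..n - d} = (\<Sum>i | i \<in> {d..n - d} \<and> 2 * i = n. h i)"
proof -
  let ?L = "{i \<in> {d..n - d}. 2 * i < n}" and ?M = "{i \<in> {d..n - d}. 2 * i = n}" and ?R = "{i \<in> {d..n - d}. n < 2 * i}"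
  have "{d..n - d} = ?M \<union> (?L \<union> ?R)" by auto
  moreover have "?L \<inter> ?R = {}" "?M \<inter> (?L \<union> ?R) = {}" by auto
  ultimately have "sum h {d..n - d} = sum h ?M + (sum h ?L + sum h ?R)"
    by (metis (no_types, lifting) finite_Un finite_atLeastAtMost_int sum.union_disjoint)
  also have "sum h ?R = sum h ?L"
    by (rule sum.reindex_bij_witness [of _ "\<lambda>i. n - i" "\<lambda>i. n - i"]) (auto simp: assms)
  finally show ?thesis by simp
qed

lemma fls_square_nth:
  fixes f :: "'a::char2 fls"
  shows "(f^2) $$ n = (if even n then (f $$ (n div 2))^2 else 0)"
proof -
  define d where "d = fls_subdegree f"
  have "(f^2) $$ n = (\<Sum>i=d..n - d. f $$ i * f $$ (n - i))"
    by (simp add: power2_eq_square fls_times_nth(2) d_def)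
  also have "\<dots> = (\<Sum>i | i \<in> {d..n - d} \<and> 2 * i = n. f $$ i * f $$ (n - i))"
    by (rule sum_involution_char2) (simp add: mult.commute)
  also have "\<dots> = (if even n then (f $$ (n div 2))^2 else 0)"
  proof (cases "even n")
    case True
    then have n: "n = 2 * (n div 2)" by simp
    have "{i. i \<in> {d..n - d} \<and> 2 * i = n} = (if d \<le> n div 2 then {n div 2} else {})"
      using n by auto
    then show ?thesis using True n
      by (auto simp: power2_eq_square d_def)
  next
    case False
    then have "{i. i \<in> {d..n - d} \<and> 2 * i = n} = {}" by auto
    then show ?thesis using False by (simp only: sum.empty if_False)
  qed
  finally show ?thesis .
qed

lemma fls_X_times_nth: "(fls_X * f :: 'a::comm_ring_1 fls) $$ n = f $$ (n - 1)"
  by (simp add: fls_X_times_conv_shift)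

lemma fls_X_square_nth:
  fixes f :: "'a::char2 fls"
  shows "(fls_X * f^2) $$ n = (if odd n then (f $$ (n div 2))^2 else 0)"
proof -
  have "(n - 1) div 2 = n div 2" if "odd n" using that by presburger
  then show ?thesis by (simp add: fls_X_times_nth fls_square_nth)
qed

text \<open>A lower bound for the valuation. As a predicate it holds for zero at every
  \<open>n\<close>, whereas \<open>fls_subdegree 0\<close> is 0; so estimates of sums and products
  need no case distinction for zero series.\<close>

definition vge :: "'a::zero fls \<Rightarrow> int \<Rightarrow> bool" where
  "vge f n \<longleftrightarrow> (\<forall>i<n. f $$ i = 0)"

lemma vge_0 [simp]: "vge 0 n"
  by (simp add: vge_def)

lemma vge_iff: "vge f n \<longleftrightarrow> f = 0 \<or> n \<le> fls_subdegree f"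
  unfolding vge_def using fls_subdegree_geI by fastforce

lemma vge_subdegree: "vge f (fls_subdegree f)"
  by (simp add: vge_iff)

lemma vge_mono: "vge f n \<Longrightarrow> m \<le> n \<Longrightarrow> vge f m"
  by (auto simp: vge_def)

lemma vge_add: "vge f n \<Longrightarrow> vge g n \<Longrightarrow> vge (f + g) n" for f :: "'a::monoid_add fls"
  by (simp add: vge_def)

lemma vge_mult: "vge f m \<Longrightarrow> vge g n \<Longrightarrow> vge (f * g) (m + n)" for f :: "'a::idom fls"
  by (auto simp: vge_iff)

lemma vge_mult': "vge f m \<Longrightarrow> vge g n \<Longrightarrow> k \<le> m + n \<Longrightarrow> vge (f * g) k" for f :: "'a::idom fls"
  using vge_mult vge_mono by blast

lemma vge_square_iff: "vge (f^2) (2 * n) \<longleftrightarrow> vge f n" for f :: "'a::idom fls"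
  by (auto simp: vge_iff power2_eq_square)

lemma vge_square: "vge f n \<Longrightarrow> m \<le> 2 * n \<Longrightarrow> vge (f^2) m" for f :: "'a::idom fls"
  using vge_square_iff vge_mono by blast

lemma vge_X: "vge fls_X 1" and vge_const: "vge (fls_const c) 0" and vge_1: "vge (1 :: 'a::idom fls) 0"
  by (auto simp: vge_def)

lemma vge_X_mult_iff: "vge (fls_X * f) n \<longleftrightarrow> vge f (n - 1)" for f :: "'a::idom fls"
  by (auto simp: vge_iff)

text \<open>\<open>f^2\<close> lives in even and \<open>fls_X * g^2\<close> in odd exponents, so
  nothing cancels in the sum.\<close>

lemma vge_even_odd:
  fixes f g :: "'a::{char2,idom} fls"
  assumes "vge (f^2 + fls_X * g^2) n"
  shows "vge (f^2) n" "vge (fls_X * g^2) n"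
proof -
  have "(f^2 + fls_X * g^2) $$ i = (if even i then (f^2) $$ i else (fls_X * g^2) $$ i)" for i
    by (simp add: fls_square_nth fls_X_square_nth)
  then show "vge (f^2) n" "vge (fls_X * g^2) n"
    using assms unfolding vge_def by (metis fls_square_nth fls_X_square_nth)+
qed

text \<open>The strict inequalities express rounding: \<open>a\<close> may be as large as
  \<open>n / 2\<close> rounded up, and \<open>b\<close> as large as \<open>(n - 1) / 2\<close>
  rounded up.\<close>

lemma vge_even_odd':
  fixes f g :: "'a::{char2,idom} fls"
  assumes "vge (f^2 + fls_X * g^2) n"
  shows "2 * a < n + 2 \<Longrightarrow> vge f a" "2 * b < n + 1 \<Longrightarrow> vge g b"
  using vge_even_odd [OF assms]
  by (auto simp: vge_iff power2_eq_square)

section \<open>Expansions over squares and the local bound at a point of odd order\<close>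

lemma sqrt_exists: "\<exists>b::'a::alg_closed_field. b^2 = a"
  using nth_root_exists [of 2 a] by simp

text \<open>The even and the odd coefficients are separated and their square roots taken, which
  exist in an algebraically closed field.\<close>

lemma fls_square_decomp:
  fixes f :: "'a::{alg_closed_field,char2} fls"
  obtains g h where "f = g^2 + fls_X * h^2"
proof -
  define r where "r a = (SOME b::'a. b^2 = a)" for a
  have r: "r a ^ 2 = a" for a
    unfolding r_def by (rule someI_ex [OF sqrt_exists])
  have r0: "r 0 = 0" using r [of 0] by simp
  define g where "g = Abs_fls (\<lambda>n. r (f $$ (2 * n)))"
  define h where "h = Abs_fls (\<lambda>n. r (f $$ (2 * n + 1)))"
  \<comment> \<open>For negative \<open>n\<close> both \<open>2 * n\<close> and
    \<open>2 * n + 1\<close> are at most \<open>n\<close>, so \<open>min 0\<close> of the order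
    bounds both root series.\<close>
  have *: "\<forall>n<min 0 (fls_subdegree f). f $$ (2 * n) = 0 \<and> f $$ (2 * n + 1) = 0"
    by auto
  have g: "g $$ n = r (f $$ (2 * n))" and h: "h $$ n = r (f $$ (2 * n + 1))" for n
    unfolding g_def h_def
    by (rule nth_Abs_fls_lower_bound [of "min 0 (fls_subdegree f)"], use * r0 in simp)+
  have "f $$ n = (g^2 + fls_X * h^2) $$ n" for n
  proof (cases "even n")
    case False
    then have "2 * (n div 2) + 1 = n" by presburger
    then show ?thesis using False by (simp add: fls_square_nth fls_X_square_nth h r)
  qed (simp add: fls_square_nth fls_X_square_nth g r)
  then have "f = g^2 + fls_X * h^2" by (simp add: fls_eq_iff)
  then show ?thesis by (rule that)
qed

text \<open>The series is \<open>W^2 + fls_X * B^2\<close> up to the constant. An odd order comes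
  from the second summand, so it is \<open>2 * b + 1\<close> for the order \<open>b\<close> of
  \<open>B\<close>; then \<open>W\<close> has order above \<open>b\<close>, and so has its odd part
  \<open>fls_X * c^2\<close>. The factor \<open>w^4\<close> is there because denominators are
  cleared by fourth powers.\<close>

lemma tame_local:
  fixes a c q r w :: "'a::{alg_closed_field,char2} fls"
  assumes f: "f = a^4 + c^4 * fls_X^2 + q^4 * fls_X + r^4 * fls_X^3"
    and odd: "odd (fls_subdegree (f + fls_const c0 * w^4))"
  defines "B \<equiv> q^2 + r^2 * fls_X"
  shows "B \<noteq> 0" "vge (c^2 + q * r) (fls_subdegree B)"
proof -
  \<comment> \<open>A fourth root of \<open>c0\<close> allows the constant to be absorbed into
    \<open>a\<close>; \<open>c\<close>, \<open>q\<close> and \<open>r\<close> stay as they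
    are.\<close>
  obtain g where g: "g^2 = c0" using sqrt_exists by blast
  obtain g' where g': "g'^2 = g" using sqrt_exists by blast
  define a' where "a' = a + fls_const g' * w"
  have a'4: "a'^4 = a^4 + fls_const c0 * w^4"
  proof -
    have "g'^4 = c0" by (metis g g' numeral_Bit0 power2_eq_square power_add)
    then have "fls_const g' ^ 4 = fls_const c0"
      by (simp flip: rhom.hom_power [OF rhom_fls_const])
    then show ?thesis by (simp add: a'_def fourth_add power_mult_distrib)
  qed
  define W where "W = a'^2 + fls_X * c^2"
  have W2: "W^2 = a'^4 + c^4 * fls_X^2"
    by (simp add: W_def square_add power_mult_distrib mult.commute flip: power_mult)
  have B2: "fls_X * B^2 = q^4 * fls_X + r^4 * fls_X^3"
    by (simp add: B_def square_add power_mult_distrib algebra_simps power3_eq_cube power2_eq_square power4_eq_xxxx)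
  have f': "f + fls_const c0 * w^4 = W^2 + fls_X * B^2"
    unfolding W2 B2 a'4 f by (simp add: algebra_simps)
  define n where "n = fls_subdegree (f + fls_const c0 * w^4)"
  have nz: "f + fls_const c0 * w^4 \<noteq> 0" using odd by auto
  have n: "(f + fls_const c0 * w^4) $$ n \<noteq> 0" "vge (f + fls_const c0 * w^4) n"
    unfolding n_def using nz by (rule nth_fls_subdegree_nonzero) (rule vge_subdegree)
  have "odd n" using odd by (simp add: n_def)
  have "(fls_X * B^2) $$ n \<noteq> 0"
    using n(1) \<open>odd n\<close> unfolding f' by (simp add: fls_square_nth)
  then show B: "B \<noteq> 0" by auto
  define b where "b = fls_subdegree B"
  have "n = 2 * b + 1"
  proof -
    have "2 * b + 1 \<le> n"
      using fls_subdegree_leI [OF \<open>(fls_X * B^2) $$ n \<noteq> 0\<close>] B by (simp add: b_def power2_eq_square)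
    moreover have "n \<le> 2 * b + 1"
      using vge_even_odd(2) [OF n(2) [unfolded f']] B by (auto simp: vge_iff b_def power2_eq_square)
    ultimately show ?thesis by simp
  qed
  have "vge (W^2) (2 * (b + 1))"
    unfolding vge_def
  proof safe
    fix i assume "i < 2 * (b + 1)"
    then have "i < n \<or> i = n" using \<open>n = 2 * b + 1\<close> by auto
    then show "(W^2) $$ i = 0"
      using vge_even_odd(1) [OF n(2) [unfolded f']] \<open>odd n\<close> by (auto simp: vge_def fls_square_nth)
  qed
  then have "vge W (b + 1)" by (simp only: vge_square_iff)
  then have "vge (fls_X * c^2) (b + 1)" unfolding W_def by (rule vge_even_odd)
  then have c: "vge (c^2) b" by (simp add: vge_X_mult_iff)
  have "vge (q^2 + fls_X * r^2) b"
    using vge_subdegree [of B] by (simp add: b_def B_def mult.commute)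
  \<comment> \<open>The halved bounds for \<open>q\<close> and \<open>r\<close> only add up to
    \<open>b - 1/2\<close>; orders being integers gives \<open>b\<close>.\<close>
  from vge_even_odd [OF this] have "vge (q * r) b"
    by (auto simp: vge_iff power2_eq_square)
  with c show "vge (c^2 + q * r) (fls_subdegree B)"
    by (simp add: vge_add b_def)
qed

text \<open>
  The invariant \<open>(c\<^sup>2 + q r) / (q\<^sup>2 + r\<^sup>2 x)\<close> is multiplied by \<open>V\<close> and shifted by \<open>(N\<^sup>2 + G H) / V\<close> when \<open>x\<close> is
  replaced by \<open>s\<close>.
\<close>

lemma frob_basis_change:
  fixes a c q r M N G H s U V x :: "'a::char2"
  assumes x: "x = U^2 + V^2 * s" and U: "U = M^2 + N^2 * s" and V: "V = G^2 + H^2 * s"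
  defines "B \<equiv> q^2 + r^2 * x"
  shows "\<exists>a' c' q' r'. a^4 + c^4 * x^2 + q^4 * x + r^4 * x^3 = a'^4 + c'^4 * s^2 + q'^4 * s + r'^4 * s^3
    \<and> q'^2 + r'^2 * s = V * B
    \<and> c'^2 + q' * r' = V^2 * (c^2 + q * r) + B * (N^2 + G * H)"
proof -
  \<comment> \<open>With \<open>W = a^2 + c^2 * x\<close>, substituting for \<open>x\<close> turns
    \<open>W^2 + B^2 * x\<close> into \<open>(W + B * U)^2 + (V * B)^2 * s\<close>. The primed
    elements are the components of \<open>W + B * U\<close> and \<open>V * B\<close> over
    squares.\<close>
  define q' where "q' = G * q + G * r * U + H * r * V * s"
  define r' where "r' = G * r * V + H * q + H * r * U"
  define a' where "a' = a + c * U + q * M + r * U * M + r * V * N * s"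
  define c' where "c' = c * V + q * N + r * U * N + r * V * M"
  have decomp: "a^4 + c^4 * x^2 + q^4 * x + r^4 * x^3 = (a^2 + c^2 * x)^2 + (q^2 + r^2 * x)^2 * x"
    for a c q r x :: 'a
    by (simp add: square_add power_mult_distrib power3_eq_cube power2_eq_square power4_eq_xxxx algebra_simps)
  have 1: "q'^2 + r'^2 * s = V * B"
  proof -
    have "q'^2 + r'^2 * s = (G^2 + H^2 * s) * (q^2 + r^2 * U^2 + r^2 * V^2 * s)"
      by (simp add: q'_def r'_def square_add power_mult_distrib algebra_simps power2_eq_square)
    also have "\<dots> = V * (q^2 + r^2 * U^2 + r^2 * V^2 * s)" by (simp only: V [symmetric])
    finally show ?thesis by (simp add: B_def x algebra_simps)
  qed
  have 2: "a'^2 + c'^2 * s = a^2 + c^2 * x + B * U"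
  proof -
    have "a'^2 + c'^2 * s = a^2 + c^2 * x + (q^2 + r^2 * U^2) * (M^2 + N^2 * s) + r^2 * V^2 * s * (M^2 + N^2 * s)"
      by (simp add: a'_def c'_def x square_add power_mult_distrib algebra_simps) (simp add: power2_eq_square algebra_simps)
    also have "\<dots> = a^2 + c^2 * x + (q^2 + r^2 * U^2) * U + r^2 * V^2 * s * U"
      by (simp only: U [symmetric])
    finally show ?thesis by (simp add: B_def x algebra_simps)
  qed
  have 3: "a^4 + c^4 * x^2 + q^4 * x + r^4 * x^3 = a'^4 + c'^4 * s^2 + q'^4 * s + r'^4 * s^3"
    unfolding decomp 1 2 B_def [symmetric]
    by (simp add: square_add x power_mult_distrib algebra_simps)
  have "c'^2 + q' * r' = c^2 * V^2 + q^2 * N^2 + r^2 * U^2 * N^2 + r^2 * V^2 * M^2 + (G * q + G * r * U + H * r * V * s) * (G * r * V + H * q + H * r * U)"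
    by (simp add: c'_def q'_def r'_def square_add power_mult_distrib)
  also have "\<dots> = V^2 * c^2 + N^2 * B + r^2 * V^2 * (M^2 + N^2 * s) + (G * q + G * r * U + H * r * V * s) * (G * r * V + H * q + H * r * U)"
    by (simp add: B_def x algebra_simps)
  also have "(G * q + G * r * U + H * r * V * s) * (G * r * V + H * q + H * r * U)
    = (G^2 + H^2 * s) * (V * q * r + r^2 * U * V) + G * H * B"
    by (simp add: B_def x algebra_simps power2_eq_square)
  finally have "c'^2 + q' * r' = V^2 * c^2 + N^2 * B + r^2 * V^2 * U + (V * (V * q * r + r^2 * U * V) + G * H * B)"
    by (simp only: U [symmetric] V [symmetric])
  then have 4: "c'^2 + q' * r' = V^2 * (c^2 + q * r) + B * (N^2 + G * H)"
    by (simp add: algebra_simps power2_eq_square)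
  from 1 3 4 show ?thesis by blast
qed

context
  fixes x a c q r w0 :: "'a::{alg_closed_field,char2} fls" and c0 :: 'a
  assumes odd: "odd (fls_subdegree (a^4 + c^4 * x^2 + q^4 * x + r^4 * x^3 + fls_const c0 * w0^4))"
begin

text \<open>\<open>V^2\<close> is the derivative of \<open>x\<close> by the local parameter. The
  local bound is applied to the transformed coefficients and expressed in the old ones.\<close>

lemma tame_transform:
  assumes "x = U^2 + V^2 * fls_X" "U = M^2 + N^2 * fls_X" "V = G^2 + H^2 * fls_X"
  shows "q^2 + r^2 * x \<noteq> 0" "V \<noteq> 0"
    "vge (V^2 * (c^2 + q * r) + (q^2 + r^2 * x) * (N^2 + G * H)) (fls_subdegree V + fls_subdegree (q^2 + r^2 * x))"
proof -
  from frob_basis_change [OF assms, of a c q r] obtain a' c' q' r'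
    where bc: "a^4 + c^4 * x^2 + q^4 * x + r^4 * x^3 = a'^4 + c'^4 * fls_X^2 + q'^4 * fls_X + r'^4 * fls_X^3"
      "q'^2 + r'^2 * fls_X = V * (q^2 + r^2 * x)"
      "c'^2 + q' * r' = V^2 * (c^2 + q * r) + (q^2 + r^2 * x) * (N^2 + G * H)"
    by blast
  note tl = tame_local [OF bc(1) odd, unfolded bc(2) bc(3)]
  show *: "q^2 + r^2 * x \<noteq> 0" "V \<noteq> 0" using tl(1) by auto
  show "vge (V^2 * (c^2 + q * r) + (q^2 + r^2 * x) * (N^2 + G * H)) (fls_subdegree V + fls_subdegree (q^2 + r^2 * x))"
    using tl(2) * by simp
qed

text \<open>Here \<open>x\<close> is a local parameter up to a constant that is a fourth power:
  \<open>V = 1\<close>, while \<open>N\<close> and \<open>H\<close> vanish, so the invariant is not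
  shifted.\<close>

lemma tame_affine:
  assumes x: "x = fls_const x0 + fls_X"
  shows "q^2 + r^2 * x \<noteq> 0" "vge (c^2 + q * r) (fls_subdegree (q^2 + r^2 * x))"
proof -
  obtain u where u: "u^2 = x0" using sqrt_exists by blast
  obtain m where m: "m^2 = u" using sqrt_exists by blast
  have 1: "x = (fls_const u)^2 + 1^2 * fls_X" "fls_const u = (fls_const m)^2 + 0^2 * fls_X"
    "1 = 1^2 + 0^2 * (fls_X :: 'a fls)"
    using x by (simp_all add: u m flip: rhom.hom_power [OF rhom_fls_const])
  from tame_transform [OF 1] show "q^2 + r^2 * x \<noteq> 0" "vge (c^2 + q * r) (fls_subdegree (q^2 + r^2 * x))"
    by simp_all
qed

text \<open>Modulo \<open>s^4\<close> one has \<open>x = s^2 + s^3\<close>. So \<open>V\<close> is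
  \<open>s\<close> modulo \<open>s^2\<close>, \<open>N\<close> and \<open>H\<close> are 1 modulo
  \<open>s\<close>, \<open>G\<close> vanishes at the point, and the shift \<open>N^2 + G * H\<close>
  is 1 modulo \<open>s\<close>. As \<open>x\<close> and \<open>V^2\<close> agree modulo
  \<open>s^3\<close>, the bound can be stated with \<open>x\<close>.\<close>

lemma tame_two_torsion:
  assumes x: "fls_X^2 + x * (1 + fls_X) = x^3 + fls_const t * x^2" and x1: "vge x 1"
  shows "q^2 + r^2 * x \<noteq> 0"
    "vge (x * (c^2 + q * r) + (x + 1) * (q^2 + r^2 * x)) (fls_subdegree (q^2 + r^2 * x) + 1)"
proof -
  define s where "s = (fls_X :: 'a fls)"
  have s1: "vge s 1" by (simp add: s_def vge_X)
  \<comment> \<open>As a fixed point equation this gains precision whenever a bound for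
    \<open>x\<close> is inserted on the right.\<close>
  have x': "x = s^2 + s * x + fls_const t * x^2 + x^3"
  proof -
    have "x = x + (s^2 + x * (1 + s)) + (x^3 + fls_const t * x^2)"
      using x by (simp add: s_def)
    then show ?thesis by (simp add: algebra_simps)
  qed
  have x2: "vge x 2"
  proof -
    have sq: "vge (y^2) 2" if "vge y 1" for y :: "'a fls" using that by (rule vge_square) simp
    have "vge (s * x) 2" using s1 x1 by (rule vge_mult') simp
    moreover have "vge (fls_const t * x^2) 2" using vge_const sq [OF x1] by (rule vge_mult') simp
    moreover have "vge (x^3) 2"
      unfolding power3_eq_cube power2_eq_square [symmetric] using sq [OF x1] x1 by (rule vge_mult') simp
    ultimately show ?thesis using sq [OF s1] by (subst x') (intro vge_add)
  qed
  have x22: "vge (x^2) 4" using x2 by (rule vge_square) simp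
  have x23: "vge (x^3) 4" unfolding power3_eq_cube power2_eq_square [symmetric]
    using x22 x2 by (rule vge_mult' [OF _ _]) simp
  have tX: "vge (fls_const t * x^2) 4" using vge_const x22 by (rule vge_mult') simp
  have x3: "vge (x + s^2) 3"
  proof -
    have "x + s^2 = s * x + fls_const t * x^2 + x^3" by (subst x') (simp add: algebra_simps)
    moreover have "vge (s * x) 3" using s1 x2 by (rule vge_mult') simp
    ultimately show ?thesis using tX x23 by (auto intro!: vge_add elim: vge_mono)
  qed
  have x4: "vge (x + s^2 + s^3) 4"
  proof -
    have "x + s^2 + s^3 = s * (x + s^2) + fls_const t * x^2 + x^3"
      by (subst x') (simp add: algebra_simps power3_eq_cube power2_eq_square)
    moreover have "vge (s * (x + s^2)) 4" using s1 x3 by (rule vge_mult') simp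
    ultimately show ?thesis using tX x23 by (auto intro!: vge_add)
  qed
  obtain U V where UV: "x = U^2 + s * V^2" unfolding s_def by (rule fls_square_decomp)
  obtain M N where MN: "U = M^2 + s * N^2" unfolding s_def by (rule fls_square_decomp)
  obtain G H where GH: "V = G^2 + s * H^2" unfolding s_def by (rule fls_square_decomp)
  \<comment> \<open>\<open>s^2\<close> is a square and \<open>s^3\<close> is \<open>s\<close> times
    a square, so they join the two parts of \<open>x\<close> separately.\<close>
  have "x + s^2 + s^3 = (U + s)^2 + s * (V + s)^2"
    by (simp add: UV square_add algebra_simps power3_eq_cube power2_eq_square)
  from vge_even_odd' [OF x4 [unfolded this, unfolded s_def]] have U: "vge (U + s) 2" and V: "vge (V + s) 2"
    by (simp_all add: s_def)
  have "U + s = M^2 + s * (N + 1)^2" "V + s = G^2 + s * (H + 1)^2"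
    by (simp_all add: MN GH square_add algebra_simps)
  with U V have "vge (M^2 + s * (N + 1)^2) 2" "vge (G^2 + s * (H + 1)^2) 2" by simp_all
  from vge_even_odd' [OF this(1) [unfolded s_def]] vge_even_odd' [OF this(2) [unfolded s_def]]
  have N: "vge (N + 1) 1" and G: "vge G 1" and H: "vge (H + 1) 1" by simp_all
  define B where "B = q^2 + r^2 * x"
  define b where "b = fls_subdegree B"
  define D where "D = c^2 + q * r"
  note tt = tame_transform [of U V M N G H, folded s_def, folded B_def D_def]
  have eqs: "x = U^2 + V^2 * s" "U = M^2 + N^2 * s" "V = G^2 + H^2 * s"
    by (simp_all add: UV MN GH mult.commute)
  show "q^2 + r^2 * x \<noteq> 0" using tt(1) [OF eqs] by (simp add: B_def)
  have Vge: "vge V 1"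
    using vge_add [OF vge_mono [OF V, of 1] s1] by (simp add: algebra_simps)
  have subV: "1 \<le> fls_subdegree V" using Vge tt(2) [OF eqs] by (simp add: vge_iff)
  have key: "vge (V^2 * D + B * (N^2 + G * H)) (b + 1)"
    using tt(3) [OF eqs] by (rule vge_mono) (use subV in \<open>simp add: b_def\<close>)
  have B: "vge B b" by (simp add: b_def vge_subdegree)
  have "vge H 0"
    using vge_add [OF vge_mono [OF H, of 0] vge_1] by (simp add: algebra_simps)
  then have GH1: "vge (G * H) 1" using vge_mult' [OF G] by simp
  have N2: "vge (N^2 + 1) 1"
    using vge_square [OF N, of 1] by (simp add: square_add)
  have BT: "vge (B * (N^2 + G * H) + B) (b + 1)"
  proof -
    have "B * (N^2 + G * H) + B = B * ((N^2 + 1) + G * H)" by (simp add: algebra_simps)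
    then show ?thesis using vge_mult [OF B vge_add [OF N2 GH1]] by simp
  qed
  have VD: "vge (V^2 * D + B) (b + 1)"
    using vge_add [OF key BT] by (simp add: algebra_simps)
  have V2s: "vge (V^2 + s^2) 4" using vge_square [OF V, of 4] by (simp add: square_add)
  have XV: "vge (x + V^2) 3"
    using vge_add [OF x3 vge_mono [OF V2s, of 3]] by (simp add: algebra_simps)
  have Vsub: "fls_subdegree V = 1"
  proof -
    have "V $$ 1 = 1" using V by (auto simp: vge_def s_def dest: spec [of _ 1] simp: add_eq_0_char2)
    then have "fls_subdegree V \<le> 1" by (intro fls_subdegree_leI) simp
    with subV show ?thesis by simp
  qed
  have D: "vge D (b - 2)"
  proof -
    have "vge (V^2 * D) b"
      using vge_add [OF vge_mono [OF VD, of b] B] by (simp add: algebra_simps)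
    then show ?thesis using Vsub tt(2) [OF eqs] by (auto simp: vge_iff power2_eq_square)
  qed
  \<comment> \<open>Replacing \<open>V^2\<close> by \<open>x\<close> leaves an error of order
    \<open>3 + (b - 2)\<close>, and \<open>x * B\<close> has order at least \<open>b + 2\<close>;
    both exceed \<open>b\<close>.\<close>
  have "x * D + (x + 1) * B = (x + V^2) * D + (V^2 * D + B) + x * B"
    by (simp add: algebra_simps)
  moreover have "vge ((x + V^2) * D) (b + 1)" using XV D by (rule vge_mult') simp
  moreover have "vge (x * B) (b + 1)" using x2 B by (rule vge_mult') simp
  ultimately show "vge (x * (c^2 + q * r) + (x + 1) * (q^2 + r^2 * x)) (fls_subdegree (q^2 + r^2 * x) + 1)"
    using VD by (simp add: vge_add flip: B_def D_def b_def)
qed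

text \<open>With \<open>w = 1 / s\<close> the equation determines \<open>x\<close> as
  \<open>w^2 + w + t\<close> modulo \<open>s^4\<close>, so \<open>V\<close>, \<open>N\<close> and
  \<open>H\<close> have leading term \<open>w\<close> and the shift is \<open>w^2\<close> up to a
  simple pole. Against the double pole of \<open>x\<close>, the bound means that the corrected
  invariant vanishes at infinity.\<close>

lemma tame_infinity:
  assumes x: "fls_X_inv^2 + fls_X_inv = x + fls_const t + inverse x^2" and x2: "vge (inverse x) 2" and "vge x (- 2)"
  shows "q^2 + r^2 * x \<noteq> 0"
    "vge (x * (c^2 + q * r) + (x + 1) * (q^2 + r^2 * x)) (fls_subdegree (q^2 + r^2 * x) - 1)"
proof -
  define s where "s = (fls_X :: 'a fls)"
  define w where "w = (fls_X_inv :: 'a fls)"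
  have ws: "s * w = 1" "w * s = 1" by (simp_all add: s_def w_def fls_X_times_conv_shift fls_X_inv_conv_shift_1 fls_eq_iff)
  have w1: "vge w (-1)" by (auto simp: w_def vge_def)
  obtain t' where t': "t'^2 = t" using sqrt_exists by blast
  obtain t'' where t'': "t''^2 = t'" using sqrt_exists by blast
  have tt': "(fls_const t')^2 = fls_const t" "(fls_const t'')^2 = fls_const t'"
    by (simp_all add: t' t'' flip: rhom.hom_power [OF rhom_fls_const])
  have "x + w^2 + w + fls_const t = inverse x^2"
  proof -
    have "x + (w^2 + w) + fls_const t = x + (x + fls_const t + inverse x^2) + fls_const t"
      by (simp only: w_def x)
    then show ?thesis by (simp add: algebra_simps)
  qed
  then have x4: "vge (x + w^2 + w + fls_const t) 4" using vge_square [OF x2, of 4] by simp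
  obtain U V where UV: "x = U^2 + s * V^2" unfolding s_def by (rule fls_square_decomp)
  obtain M N where MN: "U = M^2 + s * N^2" unfolding s_def by (rule fls_square_decomp)
  obtain G H where GH: "V = G^2 + s * H^2" unfolding s_def by (rule fls_square_decomp)
  \<comment> \<open>This makes \<open>w\<close> the odd part of \<open>w^2 + w + t\<close>, whose
    even part is the square of \<open>w + t'\<close>.\<close>
  have sw2: "s * w^2 = w" using ws by (simp add: power2_eq_square flip: mult.assoc)
  have "x + w^2 + w + fls_const t = (U + w + fls_const t')^2 + s * (V + w)^2"
    by (simp add: UV square_add distrib_left sw2 tt' algebra_simps)
  from vge_even_odd' [OF x4 [unfolded this, unfolded s_def]] have U: "vge (U + w + fls_const t') 2" and V: "vge (V + w) 2"
    by (simp_all add: s_def)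
  have "U + w + fls_const t' = (M + fls_const t'')^2 + s * (N + w)^2" "V + w = G^2 + s * (H + w)^2"
    by (simp_all add: MN GH square_add distrib_left sw2 tt' algebra_simps)
  with U V have "vge ((M + fls_const t'')^2 + s * (N + w)^2) 2" "vge (G^2 + s * (H + w)^2) 2" by simp_all
  from vge_even_odd' [OF this(1) [unfolded s_def]] vge_even_odd' [OF this(2) [unfolded s_def]]
  have N: "vge (N + w) 1" and G: "vge G 1" and H: "vge (H + w) 1" by simp_all
  define B where "B = q^2 + r^2 * x"
  define b where "b = fls_subdegree B"
  define D where "D = c^2 + q * r"
  note tt = tame_transform [of U V M N G H, folded s_def, folded B_def D_def]
  have eqs: "x = U^2 + V^2 * s" "U = M^2 + N^2 * s" "V = G^2 + H^2 * s"
    by (simp_all add: UV MN GH mult.commute)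
  show "q^2 + r^2 * x \<noteq> 0" using tt(1) [OF eqs] by (simp add: B_def)
  have Vge: "vge V (-1)"
    using vge_add [OF vge_mono [OF V, of "-1"] w1] by (simp add: algebra_simps)
  have subV: "-1 \<le> fls_subdegree V" using Vge tt(2) [OF eqs] by (simp add: vge_iff)
  have key: "vge (V^2 * D + B * (N^2 + G * H)) (b - 1)"
    using tt(3) [OF eqs] by (rule vge_mono) (use subV in \<open>simp add: b_def\<close>)
  have B: "vge B b" by (simp add: b_def vge_subdegree)
  have "vge H (-1)"
    using vge_add [OF vge_mono [OF H, of "-1"] w1] by (simp add: algebra_simps)
  then have GH1: "vge (G * H) (-1)" using vge_mult' [OF G] by simp
  have N2: "vge (N^2 + w^2) (-1)"
    using vge_square [OF N, of "-1"] by (simp add: square_add)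
  have BT: "vge (B * (N^2 + G * H) + w^2 * B) (b - 1)"
  proof -
    have "B * (N^2 + G * H) + w^2 * B = B * ((N^2 + w^2) + G * H)" by (simp add: algebra_simps)
    then show ?thesis using vge_mult [OF B vge_add [OF N2 GH1]] by simp
  qed
  have VD: "vge (V^2 * D + w^2 * B) (b - 1)"
    using vge_add [OF key BT] by (simp add: algebra_simps)
  have V2w: "vge (V^2 + w^2) 4" using vge_square [OF V, of 4] by (simp add: square_add)
  have w2: "vge (w^2) (-2)" using w1 by (rule vge_square) simp
  have Vsub: "fls_subdegree V = -1"
  proof -
    have "V $$ (-1) = 1" using V by (auto simp: vge_def w_def dest: spec [of _ "-1"] simp: add_eq_0_char2)
    then have "fls_subdegree V \<le> -1" by (intro fls_subdegree_leI) simp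
    with subV show ?thesis by simp
  qed
  have D: "vge D b"
  proof -
    have "vge (V^2 * D) (b - 2)"
      using vge_add [OF vge_mono [OF VD, of "b - 2"] vge_mult' [OF w2 B, of "b - 2"]]
      by (simp add: algebra_simps)
    then show ?thesis using Vsub tt(2) [OF eqs] by (auto simp: vge_iff power2_eq_square)
  qed
  \<comment> \<open>\<open>V^2\<close> and \<open>w^2\<close> agree up to order 4, so the bound
    passes to \<open>D + B\<close> and gains the order 2 that the pole of \<open>x\<close> will
    cost.\<close>
  have "w^2 * (D + B) = (V^2 + w^2) * D + (V^2 * D + w^2 * B)"
    by (simp add: algebra_simps)
  moreover have "vge ((V^2 + w^2) * D) (b - 1)" using V2w D by (rule vge_mult') simp
  ultimately have "vge (w^2 * (D + B)) (b - 1)" using VD by (simp add: vge_add)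
  then have DB: "vge (D + B) (b + 1)"
    by (auto simp: vge_iff power2_eq_square w_def)
  have "x * D + (x + 1) * B = x * (D + B) + B" by (simp add: algebra_simps)
  moreover have "vge (x * (D + B)) (b - 1)" using assms(3) DB by (rule vge_mult') simp
  ultimately show "vge (x * (c^2 + q * r) + (x + 1) * (q^2 + r^2 * x)) (fls_subdegree (q^2 + r^2 * x) - 1)"
    using vge_mono [OF B, of "b - 1"] by (simp add: vge_add flip: B_def D_def b_def)
qed

end

section \<open>Functions on the curve\<close>

abbreviation pdeg :: "'a::zero poly \<Rightarrow> nat" where "pdeg \<equiv> Polynomial.degree"
abbreviation pcoeff :: "'a::zero poly \<Rightarrow> nat \<Rightarrow> 'a" where "pcoeff \<equiv> Polynomial.coeff"

definition hpoly :: "('a::comm_ring_1 \<Rightarrow> 'b::comm_ring_1) \<Rightarrow> 'b \<Rightarrow> 'a poly \<Rightarrow> 'b" where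
  "hpoly \<phi> x p = poly (map_poly \<phi> p) x"

context rhom
begin

lemma hpoly_0 [simp]: "hpoly \<phi> x 0 = 0"
  by (simp add: hpoly_def)

lemma hpoly_pCons [simp]: "hpoly \<phi> x (pCons a p) = \<phi> a + x * hpoly \<phi> x p"
  by (simp add: hpoly_def map_poly_pCons hom_0)

lemma hpoly_1 [simp]: "hpoly \<phi> x 1 = 1"
  by (simp add: one_pCons hom_1)

lemma hpoly_add: "hpoly \<phi> x (p + q) = hpoly \<phi> x p + hpoly \<phi> x q"
proof (induction p arbitrary: q)
  case (pCons a p)
  obtain b r where q: "q = pCons b r" by (cases q)
  show ?case unfolding q by (simp add: pCons.IH hom_add algebra_simps)
qed simp

lemma hpoly_smult: "hpoly \<phi> x (Polynomial.smult a p) = \<phi> a * hpoly \<phi> x p"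
  by (induction p) (simp_all add: hom_mult algebra_simps)

lemma hpoly_mult: "hpoly \<phi> x (p * q) = hpoly \<phi> x p * hpoly \<phi> x q"
  by (induction p) (simp_all add: hpoly_add hpoly_smult hom_0 algebra_simps)

lemma rhom_hpoly: "rhom (hpoly \<phi> x)"
  by standard (simp_all add: hpoly_add hpoly_mult)

end

interpretation fls_hom: rhom fls_const by (rule rhom_fls_const)

lemma hpoly_nonneg_subdegree:
  fixes x :: "'a::field fls"
  assumes "vge x 0"
  shows "vge (hpoly fls_const x p) 0"
proof (induction p)
  case (pCons a p)
  have "vge (x * hpoly fls_const x p) 0" using assms pCons.IH by (rule vge_mult') simp
  then show ?case by (simp add: vge_add vge_const)
qed simp

text \<open>At a pole of \<open>x\<close> every further Horner step strictly lowers the order, so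
  the added constants never interfere.\<close>

lemma hpoly_pole_subdegree:
  fixes x :: "'a::field fls"
  assumes x: "fls_subdegree x = - d" and d: "d > 0" and "p \<noteq> 0"
  shows "hpoly fls_const x p \<noteq> 0 \<and> fls_subdegree (hpoly fls_const x p) = - d * int (pdeg p)"
  using \<open>p \<noteq> 0\<close>
proof (induction p)
  case (pCons a p)
  have x0: "x \<noteq> 0" using x d by auto
  show ?case
  proof (cases "p = 0")
    case True
    then show ?thesis using pCons by simp
  next
    case False
    let ?h = "hpoly fls_const x p"
    from pCons False have h: "?h \<noteq> 0" "fls_subdegree ?h = - d * int (pdeg p)" by auto
    then have sub: "fls_subdegree (x * ?h) = - d * int (Suc (pdeg p))"
      using x x0 by (simp add: algebra_simps)
    have neg: "fls_subdegree (x * ?h) < 0"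
      unfolding sub using d by (simp add: mult_less_0_iff)
    have "fls_subdegree (x * ?h + fls_const a) = fls_subdegree (x * ?h)"
    proof (cases "a = 0")
      case False
      show ?thesis by (rule fls_subdegree_add_eq1) (use neg x0 h in simp_all)
    qed simp
    moreover have "x * ?h + fls_const a \<noteq> 0"
      using calculation neg by auto
    ultimately show ?thesis using sub False by (simp add: add.commute)
  qed
qed simp

lemma vge_add_distinct:
  fixes f g :: "'a::field fls"
  assumes "vge (f + g) n" and "f = 0 \<or> g = 0 \<or> fls_subdegree f \<noteq> fls_subdegree g"
  shows "vge f n" "vge g n"
proof -
  consider "f = 0 \<or> g = 0" | "f \<noteq> 0" "g \<noteq> 0" "fls_subdegree f < fls_subdegree g"
    | "f \<noteq> 0" "g \<noteq> 0" "fls_subdegree g < fls_subdegree f"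
    using assms(2) by linarith
  then have "vge f n \<and> vge g n"
  proof cases
    case 1
    then show ?thesis using assms(1) by auto
  next
    case 2
    then have "fls_subdegree (f + g) = fls_subdegree f" "f + g \<noteq> 0"
      by (auto simp: fls_subdegree_add_eq1 add_eq_0_iff)
    then show ?thesis using 2 assms(1) by (auto simp: vge_iff)
  next
    case 3
    then have "fls_subdegree (f + g) = fls_subdegree g" "f + g \<noteq> 0"
      by (auto simp: fls_subdegree_add_eq2 add_eq_0_iff2)
    then show ?thesis using 3 assms(1) by (auto simp: vge_iff)
  qed
  then show "vge f n" "vge g n" by auto
qed

text \<open>
  A pair \<open>(P, Q)\<close> stands for the function \<open>P + Q y\<close> on the affine curve.
\<close>

definition pmul :: "'a::comm_ring_1 \<Rightarrow> 'a poly \<times> 'a poly \<Rightarrow> 'a poly \<times> 'a poly \<Rightarrow> 'a poly \<times> 'a poly" where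
  "pmul t p q = (fst p * fst q + snd p * snd q * [:1, 0, t, 1:],
     fst p * snd q + snd p * fst q + snd p * snd q * [:0, 1:])"

definition pev :: "'a::comm_ring_1 fls \<Rightarrow> 'a fls \<Rightarrow> 'a poly \<times> 'a poly \<Rightarrow> 'a fls" where
  "pev x y p = hpoly fls_const x (fst p) + hpoly fls_const x (snd p) * y"

definition on_curve :: "'a::comm_ring_1 \<Rightarrow> 'a fls \<Rightarrow> 'a fls \<Rightarrow> bool" where
  "on_curve t x y \<longleftrightarrow> y^2 + x * y = x^3 + fls_const t * x^2 + 1"

lemma on_curve_square:
  fixes t :: "'a::char2"
  shows "on_curve t x y \<Longrightarrow> y * y = x * y + x * x * x + fls_const t * x * x + 1"
proof -
  assume "on_curve t x y"
  then have "y^2 + x * y + x * y = x^3 + fls_const t * x^2 + 1 + x * y" unfolding on_curve_def by simp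
  then show ?thesis by (simp add: algebra_simps power2_eq_square power3_eq_cube)
qed

text \<open>This is negation in the group law; it exchanges the two points over a given
  \<open>x\<close>.\<close>

lemma on_curve_conj:
  fixes t :: "'a::char2"
  shows "on_curve t x y \<Longrightarrow> on_curve t x (y + x)"
  by (simp add: on_curve_def square_add algebra_simps) (simp add: power2_eq_square)

definition padd :: "'a::comm_ring_1 poly \<times> 'a poly \<Rightarrow> 'a poly \<times> 'a poly \<Rightarrow> 'a poly \<times> 'a poly" where
  "padd p q = (fst p + fst q, snd p + snd q)"

lemma pev_padd: "pev x y (padd p q) = pev x y p + pev x y q"
  by (simp add: pev_def padd_def fls_hom.hpoly_add algebra_simps)

lemma pev_pmul:
  fixes t :: "'a::char2"
  assumes "on_curve t x y"
  shows "pev x y (pmul t p q) = pev x y p * pev x y q"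
proof -
  have eq: "y * (y * z) = (x * y + x * x * x + fls_const t * x * x + 1) * z" for z
    using on_curve_square [OF assms] by (simp flip: mult.assoc)
  show ?thesis
    by (simp add: pev_def pmul_def fls_hom.hpoly_add fls_hom.hpoly_mult fls_hom.hpoly_smult algebra_simps eq)
qed

text \<open>The norm to polynomials in \<open>x\<close>, that is the product with the conjugate
  under \<open>y\<close> to \<open>y + x\<close>.\<close>

definition pnorm :: "'a::comm_ring_1 \<Rightarrow> 'a poly \<times> 'a poly \<Rightarrow> 'a poly" where
  "pnorm t p = fst p ^ 2 + fst p * snd p * [:0, 1:] + snd p ^ 2 * [:1, 0, t, 1:]"

definition pconj :: "'a::comm_ring_1 poly \<times> 'a poly \<Rightarrow> 'a poly \<times> 'a poly" where
  "pconj p = (fst p + snd p * [:0, 1:], snd p)"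

lemma pmul_pconj: "pmul t p (pconj p) = (pnorm t p, 0)" for t :: "'a::char2"
  by (simp add: pmul_def pconj_def pnorm_def power2_eq_square algebra_simps)

lemma pev_pnorm:
  fixes t :: "'a::char2"
  assumes "on_curve t x y"
  shows "pev x y p * pev x y (pconj p) = hpoly fls_const x (pnorm t p)"
  by (simp flip: pev_pmul [OF assms] add: pmul_pconj) (simp add: pev_def)

text \<open>Degrees decide. With \<open>a^2\<close> isolated, the other side has odd degree
  \<open>2 * pdeg b + 3\<close> if \<open>pdeg a\<close> is at most \<open>pdeg b + 1\<close>, and
  degree below \<open>2 * pdeg a\<close> otherwise.\<close>

lemma pnorm_eq_0:
  fixes t :: "'a::{char2,field}"
  assumes "pnorm t p = 0"
  shows "p = (0, 0)"
proof (rule ccontr)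
  assume "p \<noteq> (0, 0)"
  obtain a b where p: "p = (a, b)" by (cases p)
  let ?g = "[:1, 0, t, 1:] :: 'a poly"
  have eq: "a^2 = b * (a * [:0, 1:] + b * ?g)"
  proof -
    have "a^2 + b * (a * [:0, 1:] + b * ?g) = 0"
      using assms by (simp add: pnorm_def p algebra_simps power2_eq_square)
    then show ?thesis by (simp only: add_eq_0_char2)
  qed
  have "b \<noteq> 0" using eq \<open>p \<noteq> (0, 0)\<close> p by auto
  have dbg: "pdeg (b * ?g) = pdeg b + 3" 
  proof -
    have g: "?g \<noteq> 0" "pdeg ?g = 3" by simp_all
    have "pdeg (b * ?g) = pdeg b + pdeg ?g" by (rule degree_mult_eq [OF \<open>b \<noteq> 0\<close> g(1)])
    then show ?thesis by (simp only: g(2))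
  qed
  have da: "pdeg (a * [:0, 1:]) \<le> pdeg a + 1"
    using degree_mult_le [of a "[:0, 1:]"] by simp
  have "a \<noteq> 0"
  proof
    assume "a = 0"
    then have "b * (b * ?g) = 0" using eq by simp
    then have "b = 0 \<or> b = 0 \<or> ?g = 0" by (simp only: mult_eq_0_iff)
    then show False using \<open>b \<noteq> 0\<close> by simp
  qed
  then have da2: "pdeg (a^2) = 2 * pdeg a" by (simp add: degree_power_eq)
  show False
  proof (cases "pdeg a \<le> pdeg b + 1")
    case True
    then have "pdeg (a * [:0, 1:] + b * ?g) = pdeg b + 3"
      using da dbg by (subst degree_add_eq_right) auto
    moreover from this have "a * [:0, 1:] + b * ?g \<noteq> 0" by auto
    then have "pdeg (b * (a * [:0, 1:] + b * ?g)) = pdeg b + pdeg (a * [:0, 1:] + b * ?g)"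
      by (rule degree_mult_eq [OF \<open>b \<noteq> 0\<close>])
    ultimately have "pdeg (b * (a * [:0, 1:] + b * ?g)) = pdeg b + (pdeg b + 3)" by (simp only:)
    then show False using eq da2 by presburger
  next
    case False
    have "pdeg (a * [:0, 1:] + b * ?g) \<le> pdeg a + 1"
      using False da dbg by (intro degree_add_le) auto
    then have "pdeg (b * (a * [:0, 1:] + b * ?g)) \<le> pdeg b + (pdeg a + 1)"
      using degree_mult_le [of b "a * [:0, 1:] + b * ?g"] by linarith
    then show False using eq da2 False by simp
  qed
qed

text \<open>An identity checked on a single branch with transcendental \<open>x\<close> is thereby
  an identity of functions on the curve.\<close>

lemma pev_eq_0:
  fixes t :: "'a::{char2,field}"
  assumes "on_curve t x y" and "\<And>p. p \<noteq> 0 \<Longrightarrow> hpoly fls_const x p \<noteq> 0" and "pev x y p = 0"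
  shows "p = (0, 0)"
proof (rule pnorm_eq_0 [of t])
  show "pnorm t p = 0"
    using pev_pnorm [OF assms(1), of p] assms(2) [of "pnorm t p"] assms(3) by auto
qed

lemma hpoly_root_factor:
  fixes x :: "'a::field fls"
  shows "hpoly fls_const x ([:- x0, 1:] * p) = (x - fls_const x0) * hpoly fls_const x p"
  by (simp only: fls_hom.hpoly_mult) (simp add: algebra_simps)

lemma hpoly_const_term:
  fixes x :: "'a::{char2,field} fls"
  assumes "vge (x + fls_const x0) n" and "n \<ge> 0"
  shows "vge (hpoly fls_const x p + fls_const (poly p x0)) n"
proof (induction p)
  case (pCons a p)
  let ?h = "hpoly fls_const x p" and ?c = "fls_const (poly p x0)"
  have x: "vge x 0"
    using vge_add [OF vge_mono [OF assms] vge_const [of x0]] by (simp add: algebra_simps)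
  have "hpoly fls_const x (pCons a p) + fls_const (poly (pCons a p) x0)
      = (x + fls_const x0) * ?h + fls_const x0 * (?h + ?c)"
    by (simp add: algebra_simps flip: fls_const_mult_const fls_plus_const)
  moreover have "vge ((x + fls_const x0) * ?h) n"
    using assms(1) hpoly_nonneg_subdegree [OF x] by (rule vge_mult') simp
  moreover have "vge (fls_const x0 * (?h + ?c)) n"
    using vge_const pCons.IH by (rule vge_mult') simp
  ultimately show ?case by (simp add: vge_add)
qed simp

lemma vge_const_iff: "vge (fls_const c) n \<longleftrightarrow> c = 0 \<or> n \<le> 0"
  by (auto simp: vge_iff)

text \<open>Each root \<open>x0\<close> of \<open>p\<close> contributes the nonzero series
  \<open>x - x0\<close>, and what remains has a nonzero constant term.\<close>

lemma hpoly_neq_0: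
  fixes x :: "'a::{char2,field} fls"
  assumes x: "vge (x + fls_const x0) 1" "x \<noteq> fls_const x0" and "p \<noteq> 0"
  shows "hpoly fls_const x p \<noteq> 0"
  using \<open>p \<noteq> 0\<close>
proof (induction "pdeg p" arbitrary: p rule: less_induct)
  case less
  show ?case
  proof (cases "poly p x0 = 0")
    case True
    then obtain q where q: "p = [:- x0, 1:] * q" unfolding poly_eq_0_iff_dvd by (elim dvdE)
    then have "q \<noteq> 0" using less.prems by auto
    moreover have "pdeg q < pdeg p" unfolding q using \<open>q \<noteq> 0\<close> by (subst degree_mult_eq) auto
    ultimately have "hpoly fls_const x q \<noteq> 0" by (intro less.hyps)
    then show ?thesis unfolding q hpoly_root_factor using x(2) by (simp add: add_eq_0_char2)
  next
    case False
    have "vge (hpoly fls_const x p + fls_const (poly p x0)) 1"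
      using x(1) by (rule hpoly_const_term) simp
    then show ?thesis using False by (auto simp: vge_const_iff)
  qed
qed

text \<open>
  Expansions of \<open>(x, y)\<close> in the local parameters \<open>x - x\<^sub>0\<close> at a point with \<open>x\<^sub>0 \<noteq> 0\<close>, \<open>y - 1\<close> at the point
  \<open>(0, 1)\<close>, and \<open>x / y\<close> at infinity.
\<close>

definition affine_at :: "'a::comm_ring_1 \<Rightarrow> 'a \<Rightarrow> 'a fls \<Rightarrow> 'a fls \<Rightarrow> bool" where
  "affine_at t x0 x y \<longleftrightarrow> x0 \<noteq> 0 \<and> x = fls_const x0 + fls_X \<and> vge y 0 \<and> on_curve t x y"

definition torsion_at :: "'a::comm_ring_1 \<Rightarrow> 'a fls \<Rightarrow> 'a fls \<Rightarrow> bool" where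
  "torsion_at t x y \<longleftrightarrow> y = 1 + fls_X \<and> fls_subdegree x = 2 \<and> on_curve t x y"

definition infinity_at :: "'a::comm_ring_1 \<Rightarrow> 'a fls \<Rightarrow> 'a fls \<Rightarrow> bool" where
  "infinity_at t x y \<longleftrightarrow> y = x * fls_X_inv \<and> fls_subdegree x = - 2 \<and> on_curve t x y"

lemma affine_at_neq_0: "affine_at t x0 x y \<Longrightarrow> p \<noteq> 0 \<Longrightarrow> hpoly fls_const x p \<noteq> 0"
  for t :: "'a::{char2,field}"
  by (rule hpoly_neq_0 [of _ x0]) (auto simp: affine_at_def algebra_simps vge_X)

lemma torsion_at_neq_0: "torsion_at t x y \<Longrightarrow> p \<noteq> 0 \<Longrightarrow> hpoly fls_const x p \<noteq> 0"
  for t :: "'a::{char2,field}"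
  by (rule hpoly_neq_0 [of _ 0]) (auto simp: torsion_at_def vge_iff)

lemma infinity_at_subdegree:
  "infinity_at t x y \<Longrightarrow> p \<noteq> 0 \<Longrightarrow> hpoly fls_const x p \<noteq> 0 \<and> fls_subdegree (hpoly fls_const x p) = - 2 * int (pdeg p)"
  for t :: "'a::{char2,field}"
  by (rule hpoly_pole_subdegree) (auto simp: infinity_at_def)

text \<open>The existence of branches is assumed at this point; Hensel's lemma supplies it
  afterwards.\<close>

context
  fixes t :: "'a::{char2,alg_closed_field}"
  assumes ex_affine: "\<And>x0. x0 \<noteq> 0 \<Longrightarrow> \<exists>x y. affine_at t x0 x y"
    and ex_torsion: "\<exists>x y. torsion_at t x y"
    and ex_infinity: "\<exists>x y. infinity_at t x y"
begin

text \<open>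
  The function \<open>(P + Q y) / R\<close> is a section of the line bundle of the divisor \<open>(0, 1) - \<infinity>\<close>, which has degree
  zero and is not trivial. The induction cancels roots of \<open>R\<close>.
\<close>

lemma riemann_roch_zero:
  assumes "R \<noteq> 0"
    and "\<And>x0 x y. affine_at t x0 x y \<Longrightarrow> vge (pev x y (P, Q)) (fls_subdegree (hpoly fls_const x R))"
    and "\<And>x y. torsion_at t x y \<Longrightarrow> vge (pev x y (P, Q)) (fls_subdegree (hpoly fls_const x R) - 1)"
    and "\<And>x y. infinity_at t x y \<Longrightarrow> vge (pev x y (P, Q)) (fls_subdegree (hpoly fls_const x R) + 1)"
  shows "P = 0 \<and> Q = 0"
  using assms
proof (induction "pdeg R" arbitrary: P Q R rule: less_induct)
  case less
  note R0 = less.prems(1) and aff = less.prems(2) and tor = less.prems(3) and inf = less.prems(4)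
  have divide: "P = 0 \<and> Q = 0" if roots: "poly P z = 0" "poly Q z = 0" "poly R z = 0" for z
  proof -
    obtain P' where P': "P = [:- z, 1:] * P'" using roots(1) unfolding poly_eq_0_iff_dvd by (elim dvdE)
    obtain Q' where Q': "Q = [:- z, 1:] * Q'" using roots(2) unfolding poly_eq_0_iff_dvd by (elim dvdE)
    obtain R' where R': "R = [:- z, 1:] * R'" using roots(3) unfolding poly_eq_0_iff_dvd by (elim dvdE)
    have R'0: "R' \<noteq> 0" using R0 R' by auto
    have deg: "pdeg R' < pdeg R" unfolding R' using R'0 by (subst degree_mult_eq) auto
    have pev: "pev x y (P, Q) = (x - fls_const z) * pev x y (P', Q')" for x y
      unfolding pev_def P' Q' fst_conv snd_conv hpoly_root_factor by (simp add: algebra_simps)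
    have shift: "vge (pev x y (P', Q')) (fls_subdegree (hpoly fls_const x R') + n)"
      if "vge (pev x y (P, Q)) (fls_subdegree (hpoly fls_const x R) + n)" "hpoly fls_const x R \<noteq> 0" for x y n
    proof -
      have "x - fls_const z \<noteq> 0" "hpoly fls_const x R' \<noteq> 0"
        using that(2) unfolding R' hpoly_root_factor by (auto simp del: diff_char2)
      then show ?thesis using that(1) unfolding pev R' hpoly_root_factor
        by (auto simp: vge_iff simp del: diff_char2)
    qed
    have "P' = 0 \<and> Q' = 0"
    proof (rule less.hyps [OF deg R'0])
      show "vge (pev x y (P', Q')) (fls_subdegree (hpoly fls_const x R'))" if "affine_at t x0 x y" for x0 x y
        using shift [of x y 0] aff [OF that] affine_at_neq_0 [OF that R0] by simp
      show "vge (pev x y (P', Q')) (fls_subdegree (hpoly fls_const x R') - 1)" if "torsion_at t x y" for x y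
        using shift [of x y "-1"] tor [OF that] torsion_at_neq_0 [OF that R0] by simp
      show "vge (pev x y (P', Q')) (fls_subdegree (hpoly fls_const x R') + 1)" if "infinity_at t x y" for x y
        using shift [of x y 1] inf [OF that] infinity_at_subdegree [OF that R0] by simp
    qed
    then show ?thesis using P' Q' by simp
  qed
  \<comment> \<open>The values on the two branches over \<open>x0\<close> add up to
    \<open>Q x\<close>, and \<open>x\<close> is a unit there; so \<open>Q\<close> and then
    \<open>P\<close> vanish at \<open>x0\<close>.\<close>
  have affine_root: "poly P x0 = 0 \<and> poly Q x0 = 0" if x0: "poly R x0 = 0" "x0 \<noteq> 0" for x0
  proof -
    obtain x y where xy: "affine_at t x0 x y" using ex_affine x0 by blast
    have x: "x = fls_const x0 + fls_X" and y: "vge y 0" using xy by (auto simp: affine_at_def)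
    have xx0: "vge (x + fls_const x0) 1" by (simp add: x algebra_simps vge_X)
    have xy': "affine_at t x0 x (y + x)"
      using xy by (auto simp: affine_at_def on_curve_conj intro!: vge_add vge_const vge_mono [OF vge_X])
    have x_ord: "x \<noteq> 0" "fls_subdegree x = 0"
    proof -
      have "x $$ 0 = x0" "vge x 0" by (auto simp: x vge_def)
      then show "x \<noteq> 0" "fls_subdegree x = 0"
        using x0(2) fls_subdegree_leI [of x 0] by (auto simp: vge_iff)
    qed
    note ct = hpoly_const_term [OF xx0, simplified]
    have "vge (hpoly fls_const x R) 1" using ct [of R] x0 by simp
    then have sub: "1 \<le> fls_subdegree (hpoly fls_const x R)"
      using affine_at_neq_0 [OF xy R0] by (simp add: vge_iff)
    have 1: "vge (pev x y (P, Q)) 1" "vge (pev x (y + x) (P, Q)) 1"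
      using aff [OF xy] aff [OF xy'] sub by (auto elim: vge_mono)
    from vge_add [OF this] have "vge (hpoly fls_const x Q * x) 1"
      by (simp add: pev_def algebra_simps)
    then have Q: "vge (hpoly fls_const x Q) 1" using x_ord by (auto simp: vge_iff)
    then have "vge (hpoly fls_const x Q * y) 1" using y by (rule vge_mult') simp
    from vge_add [OF 1(1) this] have P: "vge (hpoly fls_const x P) 1"
      by (simp add: pev_def algebra_simps)
    from vge_add [OF P ct [of P]] vge_add [OF Q ct [of Q]] show ?thesis
      by (simp add: vge_const_iff)
  qed
  \<comment> \<open>\<open>x\<close> has a pole of order 2 and \<open>y\<close> one of order 3, so
    \<open>P\<close> and \<open>Q y\<close> have orders of different parity and cannot
    cancel.\<close>
  have at_infinity: "Q = 0 \<and> (P = 0 \<or> pdeg P = 0 \<and> pdeg R = 1)" if R: "pdeg R \<le> 1"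
  proof -
    obtain x y where xy: "infinity_at t x y" using ex_infinity by blast
    note sub = infinity_at_subdegree [OF xy]
    have "x \<noteq> 0" using xy by (auto simp: infinity_at_def)
    then have y: "y \<noteq> 0" "fls_subdegree y = - 3" using xy by (auto simp: infinity_at_def)
    have "vge (hpoly fls_const x P + hpoly fls_const x Q * y) (1 - 2 * int (pdeg R))"
      using inf [OF xy] sub [OF R0] by (simp add: pev_def)
    moreover have "hpoly fls_const x P = 0 \<or> hpoly fls_const x Q * y = 0
        \<or> fls_subdegree (hpoly fls_const x P) \<noteq> fls_subdegree (hpoly fls_const x Q * y)"
    proof (cases "P = 0 \<or> Q = 0")
      case False
      have "- 2 * int m \<noteq> - 2 * int n - 3" for m n by presburger
      then show ?thesis using False sub [of P] sub [of Q] y by simp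
    qed auto
    ultimately have "vge (hpoly fls_const x P) (1 - 2 * int (pdeg R))"
      "vge (hpoly fls_const x Q * y) (1 - 2 * int (pdeg R))"
      by (rule vge_add_distinct)+
    then show ?thesis using sub [of P] sub [of Q] y R by (cases "P = 0"; cases "Q = 0") (auto simp: vge_iff)
  qed
  \<comment> \<open>Without roots other than 0, \<open>R\<close> is a constant times a power of
    \<open>x\<close>; from \<open>x^2\<close> on, a factor can be cancelled.\<close>
  consider (affine) x0 where "x0 \<noteq> 0" "poly R x0 = 0"
    | (double) R2 where "R = [:0, 1:] * ([:0, 1:] * R2)"
    | (const) "pdeg R = 0" | (simple) c where "c \<noteq> 0" "R = [:0, c:]"
  proof (cases "\<exists>x0. x0 \<noteq> 0 \<and> poly R x0 = 0")
    case False
    show ?thesis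
    proof (cases "poly R 0 = 0")
      case True
      then obtain R1 where R1: "R = [:0, 1:] * R1" unfolding poly_eq_0_iff_dvd by (auto elim: dvdE)
      show ?thesis
      proof (cases "poly R1 0 = 0")
        case True
        then obtain R2 where "R1 = [:0, 1:] * R2" unfolding poly_eq_0_iff_dvd by (auto elim: dvdE)
        with R1 that(2) show ?thesis by blast
      next
        case R1_0: False
        have "pdeg R1 = 0"
        proof (rule ccontr)
          assume "pdeg R1 \<noteq> 0"
          then obtain z where "poly R1 z = 0" using alg_closed_imp_poly_has_root by blast
          then have "poly R z = 0" "z \<noteq> 0" using R1_0 by (auto simp: R1)
          with False show False by blast
        qed
        then obtain c where "R1 = [:c:]" using degree_eq_zeroE by blast
        moreover from this have "c \<noteq> 0" "R = [:0, c:]" using R1 R0 by simp_all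
        ultimately show ?thesis using that(4) by blast
      qed
    next
      case R_0: False
      have "pdeg R = 0"
      proof (rule ccontr)
        assume "pdeg R \<noteq> 0"
        then obtain z where "poly R z = 0" using alg_closed_imp_poly_has_root by blast
        with False R_0 show False by metis
      qed
      then show ?thesis by (rule that(3))
    qed
  qed (use that(1) in blast)
  then show ?case
  proof cases
    case affine
    then show ?thesis using divide affine_root by blast
  next
    case double
    obtain x y where xy: "torsion_at t x y" using ex_torsion by blast
    then have x: "fls_subdegree x = 2" "x \<noteq> 0" and y: "y = 1 + fls_X" by (auto simp: torsion_at_def)
    have R2: "hpoly fls_const x R2 \<noteq> 0" using double R0 torsion_at_neq_0 [OF xy] by auto
    have x_ge: "vge x 0" using x by (simp add: vge_iff)
    \<comment> \<open>\<open>x\<close> has order 2 here, so \<open>P + Q y\<close> has order at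
      least 3 in spite of the simple pole allowed. Modulo order 2 it equals
      \<open>P(0) + Q(0) (1 + s)\<close>, and both coefficients have to vanish.\<close>
    have "4 \<le> fls_subdegree (hpoly fls_const x R)"
      using hpoly_nonneg_subdegree [OF x_ge, of R2] R2 x
      unfolding double fls_hom.hpoly_mult by (simp add: vge_iff)
    then have 3: "vge (pev x y (P, Q)) 2" using tor [OF xy] by (auto elim: vge_mono)
    have ct: "vge (hpoly fls_const x p + fls_const (poly p 0)) 2" for p
      by (rule hpoly_const_term) (use x in \<open>simp_all add: vge_iff\<close>)
    have y0: "vge y 0" unfolding y by (intro vge_add vge_1 vge_mono [OF vge_X]) simp
    have "vge ((hpoly fls_const x Q + fls_const (poly Q 0)) * y) 2" using ct y0 by (rule vge_mult') simp
    from vge_add [OF vge_add [OF ct [of P] this] 3]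
    have 4: "vge (fls_const (poly P 0) + fls_const (poly Q 0) * (1 + fls_X)) 2"
      by (simp add: pev_def y algebra_simps)
    from spec [OF this [unfolded vge_def], of 0] spec [OF this [unfolded vge_def], of 1]
    have "poly Q 0 = 0" "poly P 0 = 0" by simp_all
    then show ?thesis using divide double by auto
  next
    case const
    then show ?thesis using at_infinity by simp
  next
    case simple
    then have "pdeg R = 1" by simp
    then have PQ: "Q = 0" "P = 0 \<or> pdeg P = 0" using at_infinity by auto
    then obtain p where p: "P = [:p:]" using degree_eq_zeroE [of P] by (metis degree_0)
    obtain x y where xy: "torsion_at t x y" using ex_torsion by blast
    then have "fls_subdegree x = 2" "x \<noteq> 0" by (auto simp: torsion_at_def)
    \<comment> \<open>The remaining candidate is a constant over \<open>x\<close>: it has a double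
      pole where only a simple one is allowed.\<close>
    then have "fls_subdegree (hpoly fls_const x R) = 2" using simple by simp
    with tor [OF xy] have "vge (fls_const p) 1" by (simp add: pev_def p PQ)
    then show ?thesis using p PQ by (simp add: vge_const_iff)
  qed
qed

section \<open>The global relation satisfied by a tame function\<close>

context
  fixes a c q r :: "'a poly \<times> 'a poly"
  assumes affine_odd: "\<And>x0 x y. affine_at t x0 x y \<Longrightarrow> \<exists>c0 w. odd (fls_subdegree
      (pev x y a ^ 4 + pev x y c ^ 4 * x^2 + pev x y q ^ 4 * x + pev x y r ^ 4 * x^3 + fls_const c0 * w^4))"
    and torsion_odd: "\<And>x y. torsion_at t x y \<Longrightarrow> \<exists>c0 w. odd (fls_subdegree
      (pev x y a ^ 4 + pev x y c ^ 4 * x^2 + pev x y q ^ 4 * x + pev x y r ^ 4 * x^3 + fls_const c0 * w^4))"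
    and infinity_odd: "\<And>x y. infinity_at t x y \<Longrightarrow> \<exists>c0 w. odd (fls_subdegree
      (pev x y a ^ 4 + pev x y c ^ 4 * x^2 + pev x y q ^ 4 * x + pev x y r ^ 4 * x^3 + fls_const c0 * w^4))"
begin

text \<open>\<open>h\<close> over \<open>x B\<close> is the corrected invariant. Multiplication of
  both by the conjugate of \<open>B\<close> makes the denominator the polynomial \<open>R\<close>,
  and the local bounds become the hypotheses of \<open>riemann_roch_zero\<close>.\<close>

lemma tame_global:
  assumes xy: "on_curve t x y"
  shows "x * (pev x y c ^ 2 + pev x y q * pev x y r) = (x + 1) * (pev x y q ^ 2 + pev x y r ^ 2 * x)"
proof -
  define D where "D = padd (pmul t c c) (pmul t q r)"
  define B where "B = padd (pmul t q q) (pmul t (pmul t r r) ([:0, 1:], 0))"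
  define h where "h = padd (pmul t ([:0, 1:], 0) D) (pmul t ([:1, 1:], 0) B)"
  define R where "R = [:0, 1:] * pnorm t B"
  have pev_B: "pev x y B = pev x y q ^ 2 + pev x y r ^ 2 * x" if "on_curve t x y" for x y
    by (simp add: B_def pev_padd pev_pmul [OF that] power2_eq_square) (simp add: pev_def)
  have pev_h: "pev x y h = x * (pev x y c ^ 2 + pev x y q * pev x y r) + (x + 1) * (pev x y q ^ 2 + pev x y r ^ 2 * x)"
    if "on_curve t x y" for x y
    by (simp add: h_def D_def pev_padd pev_pmul [OF that] power2_eq_square pev_B [OF that, unfolded power2_eq_square])
      (simp add: pev_def add.commute)
  have pev_hB: "pev x y (pmul t h (pconj B)) * pev x y B = pev x y h * hpoly fls_const x (pnorm t B)"
    if "on_curve t x y" for x y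
    unfolding pev_pnorm [OF that, symmetric] pev_pmul [OF that] by (simp add: algebra_simps)
  have pnorm_B: "pnorm t B \<noteq> 0"
  proof
    assume 0: "pnorm t B = 0"
    obtain x y where xy: "torsion_at t x y" using ex_torsion by blast
    then have oc: "on_curve t x y" and x2: "fls_subdegree x = 2" and y: "y = 1 + fls_X"
      by (auto simp: torsion_at_def)
    obtain c0 w where "odd (fls_subdegree (pev x y a ^ 4 + pev x y c ^ 4 * x^2 + pev x y q ^ 4 * x + pev x y r ^ 4 * x^3 + fls_const c0 * w^4))"
      using torsion_odd [OF xy] by blast
    moreover have "fls_X^2 + x * (1 + fls_X) = x^3 + fls_const t * x^2"
      using oc by (simp add: on_curve_def y square_add algebra_simps)
    moreover have "vge x 1" using x2 by (simp add: vge_iff)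
    ultimately have "pev x y B \<noteq> 0" using tame_two_torsion(1) pev_B [OF oc] by metis
    moreover have "B = (0, 0)" using 0 by (rule pnorm_eq_0)
    ultimately show False by (simp add: pev_def)
  qed
  then have R0: "R \<noteq> 0" by (simp add: R_def)
  \<comment> \<open>Turns a bound on \<open>h\<close> relative to \<open>B\<close> into one relative
    to \<open>R\<close>; the additional factor \<open>x\<close> of \<open>R\<close> causes the shift
    by the order of \<open>x\<close>.\<close>
  have sub: "vge (pev x y (pmul t h (pconj B))) (fls_subdegree (hpoly fls_const x R) + n - fls_subdegree x)"
    if oc: "on_curve t x y" and B: "pev x y B \<noteq> 0" and h: "vge (pev x y h) (fls_subdegree (pev x y B) + n)"
      and R: "hpoly fls_const x R \<noteq> 0" for x y n
  proof -
    have x: "x \<noteq> 0" and N: "hpoly fls_const x (pnorm t B) \<noteq> 0"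
      using R by (auto simp: R_def fls_hom.hpoly_mult)
    have eq: "fls_subdegree (hpoly fls_const x R) = fls_subdegree x + fls_subdegree (hpoly fls_const x (pnorm t B))"
      unfolding R_def fls_hom.hpoly_mult using x N by simp
    have "vge (pev x y (pmul t h (pconj B)) * pev x y B)
        (fls_subdegree (pev x y B) + n + fls_subdegree (hpoly fls_const x (pnorm t B)))"
      unfolding pev_hB [OF oc] by (rule vge_mult [OF h vge_subdegree])
    then show ?thesis using B unfolding eq by (auto simp: vge_iff)
  qed
  have "fst (pmul t h (pconj B)) = 0 \<and> snd (pmul t h (pconj B)) = 0"
  proof (rule riemann_roch_zero [OF R0], unfold prod.collapse)
    fix x0 x y assume xy: "affine_at t x0 x y"
    then have oc: "on_curve t x y" and x: "x = fls_const x0 + fls_X" by (auto simp: affine_at_def)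
    obtain c0 w where "odd (fls_subdegree (pev x y a ^ 4 + pev x y c ^ 4 * x^2 + pev x y q ^ 4 * x + pev x y r ^ 4 * x^3 + fls_const c0 * w^4))"
      using affine_odd [OF xy] by blast
    from tame_affine [OF this x, folded pev_B [OF oc]]
    have B: "pev x y B \<noteq> 0" and D: "vge (pev x y c ^ 2 + pev x y q * pev x y r) (fls_subdegree (pev x y B))" by auto
    have x_ge: "vge x 0" and x_ge': "vge (x + 1) 0"
      unfolding x by (intro vge_add vge_const vge_1 vge_mono [OF vge_X], simp)+
    have "vge (pev x y h) (fls_subdegree (pev x y B))"
      unfolding pev_h [OF oc] pev_B [OF oc, symmetric]
      by (intro vge_add vge_mult' [OF x_ge D] vge_mult' [OF x_ge' vge_subdegree]) simp_all
    moreover have "fls_subdegree x = 0"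
    proof -
      have "x $$ 0 \<noteq> 0" using xy by (simp add: x affine_at_def)
      then show ?thesis using x_ge fls_subdegree_leI [of x 0] by (auto simp: vge_iff)
    qed
    ultimately show "vge (pev x y (pmul t h (pconj B))) (fls_subdegree (hpoly fls_const x R))"
      using sub [OF oc B, of 0] affine_at_neq_0 [OF xy R0] by simp
  next
    fix x y assume xy: "torsion_at t x y"
    then have oc: "on_curve t x y" and x2: "fls_subdegree x = 2" and y: "y = 1 + fls_X"
      by (auto simp: torsion_at_def)
    obtain c0 w where odd: "odd (fls_subdegree (pev x y a ^ 4 + pev x y c ^ 4 * x^2 + pev x y q ^ 4 * x + pev x y r ^ 4 * x^3 + fls_const c0 * w^4))"
      using torsion_odd [OF xy] by blast
    have "fls_X^2 + x * (1 + fls_X) = x^3 + fls_const t * x^2"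
      using oc by (simp add: on_curve_def y square_add algebra_simps)
    moreover have "vge x 1" using x2 by (simp add: vge_iff)
    ultimately have B: "pev x y B \<noteq> 0" and h: "vge (pev x y h) (fls_subdegree (pev x y B) + 1)"
      using tame_two_torsion [OF odd, of t] by (simp_all add: pev_B [OF oc] pev_h [OF oc])
    from sub [OF oc B h] torsion_at_neq_0 [OF xy R0] x2
    show "vge (pev x y (pmul t h (pconj B))) (fls_subdegree (hpoly fls_const x R) - 1)" by simp
  next
    fix x y assume xy: "infinity_at t x y"
    then have oc: "on_curve t x y" and x2: "fls_subdegree x = - 2" and y: "y = x * fls_X_inv"
      by (auto simp: infinity_at_def)
    obtain c0 w where odd: "odd (fls_subdegree (pev x y a ^ 4 + pev x y c ^ 4 * x^2 + pev x y q ^ 4 * x + pev x y r ^ 4 * x^3 + fls_const c0 * w^4))"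
      using infinity_odd [OF xy] by blast
    have x0: "x \<noteq> 0" using x2 by auto
    have "fls_X_inv^2 + fls_X_inv = x + fls_const t + inverse x^2"
    proof -
      have "x^2 * (fls_X_inv^2 + fls_X_inv) = x^2 * (x + fls_const t + inverse x^2)"
        using oc x0 by (simp add: on_curve_def y power_mult_distrib field_simps power2_eq_square power3_eq_cube)
      then show ?thesis using x0 by simp
    qed
    moreover have "vge (inverse x) 2" "vge x (- 2)" using x2 x0 by (simp_all add: vge_iff)
    ultimately have B: "pev x y B \<noteq> 0" and h: "vge (pev x y h) (fls_subdegree (pev x y B) - 1)"
      using tame_infinity [OF odd, of t] by (simp_all add: pev_B [OF oc] pev_h [OF oc])
    from sub [OF oc B, of "-1"] h infinity_at_subdegree [OF xy R0] x2
    show "vge (pev x y (pmul t h (pconj B))) (fls_subdegree (hpoly fls_const x R) + 1)" by simp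
  qed
  then have hB: "pmul t h (pconj B) = (0, 0)" by (simp add: prod_eq_iff)
  have "h = (0, 0)"
  proof -
    obtain x y where xy: "torsion_at t x y" using ex_torsion by blast
    then have oc: "on_curve t x y" by (auto simp: torsion_at_def)
    have "pev x y h * hpoly fls_const x (pnorm t B) = 0"
      using pev_hB [OF oc] by (simp add: hB) (simp add: pev_def)
    then have "pev x y h = 0" using torsion_at_neq_0 [OF xy pnorm_B] by simp
    then show ?thesis using pev_eq_0 [OF oc torsion_at_neq_0 [OF xy]] by blast
  qed
  then have "pev x y h = 0" by (simp add: pev_def)
  then show ?thesis by (simp add: pev_h [OF xy] add_eq_0_char2)
qed

text \<open>With \<open>q\<close> and \<open>r\<close> zero the function would be a square, even
  after the constant is added, and could not have odd order.\<close>

lemma tame_global_nontrivial: "q \<noteq> (0, 0) \<or> r \<noteq> (0, 0)"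
proof (rule ccontr)
  assume 0: "\<not> ?thesis"
  obtain x y where xy: "torsion_at t x y" using ex_torsion by blast
  then have oc: "on_curve t x y" and x2: "fls_subdegree x = 2" and y: "y = 1 + fls_X"
    by (auto simp: torsion_at_def)
  obtain c0 w where odd: "odd (fls_subdegree (pev x y a ^ 4 + pev x y c ^ 4 * x^2 + pev x y q ^ 4 * x + pev x y r ^ 4 * x^3 + fls_const c0 * w^4))"
    using torsion_odd [OF xy] by blast
  have "fls_X^2 + x * (1 + fls_X) = x^3 + fls_const t * x^2"
    using oc by (simp add: on_curve_def y square_add algebra_simps)
  moreover have "vge x 1" using x2 by (simp add: vge_iff)
  ultimately show False using tame_two_torsion(1) [OF odd, of t] 0 by (simp add: pev_def)
qed

end

end

section \<open>Branches of the curve\<close>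

unbundle fps_syntax
notation fps_nth (infixl "$" 75)

lemma fps_mult_nth_cong:
  assumes "\<forall>i\<le>n. a $ i = a' $ i" "\<forall>i\<le>n. b $ i = b' $ i"
  shows "\<forall>i\<le>n. (a * b) $ i = (a' * b') $ i"
  using assms by (auto simp: fps_mult_nth intro!: sum.cong)

lemma fps_poly_nth_cong:
  fixes p :: "'a::comm_ring_1 fps poly"
  assumes "\<forall>i\<le>n. a $ i = b $ i"
  shows "\<forall>i\<le>n. poly p a $ i = poly p b $ i"
proof (induction p)
  case (pCons c p)
  from fps_mult_nth_cong [OF assms pCons.IH] show ?case by simp
qed simp

lemma poly_taylor1:
  fixes p :: "'a::idom poly"
  shows "\<exists>q. poly p (r + h) = poly p r + h * poly (pderiv p) r + h^2 * q"
proof (induction p)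
  case (pCons a p)
  then obtain q where q: "poly p (r + h) = poly p r + h * poly (pderiv p) r + h^2 * q" by blast
  show ?case
    unfolding poly_pCons q pderiv_pCons
    by (rule exI [of _ "poly (pderiv p) r + (r + h) * q"]) (simp add: algebra_simps power2_eq_square)
qed simp

text \<open>The root is built coefficient by coefficient: adding \<open>c\<close> times the power
  \<open>n + 1\<close> of \<open>fps_X\<close> changes coefficient \<open>n + 1\<close> of the value
  by \<open>c d\<close>, with \<open>d\<close> the constant term of the derivative, and leaves the
  lower ones alone.\<close>

lemma fps_hensel:
  fixes p :: "'a::field fps poly"
  assumes root: "poly p (fps_const r0) $ 0 = 0" and simple: "poly (pderiv p) (fps_const r0) $ 0 \<noteq> 0"
  obtains r where "r $ 0 = r0" "poly p r = 0"
proof -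
  define d where "d = poly (pderiv p) (fps_const r0) $ 0"
  define step where "step n r = r + fps_X ^ Suc n * fps_const (- (poly p r $ Suc n) / d)" for n r
  define R where "R = rec_nat (fps_const r0) step"
  have R0: "R 0 = fps_const r0" and RS: "R (Suc n) = step n (R n)" for n
    by (simp_all add: R_def)
  have step_nth: "step n r $ i = r $ i" if "i \<le> n" for n r i
    using that unfolding step_def fps_add_nth fps_X_power_mult_nth by simp
  have R_nth: "R m $ i = R i $ i" if "i \<le> m" for m i
    using that by (induction m rule: dec_induct) (simp_all add: RS step_nth)
  have inv: "\<forall>i\<le>n. poly p (R n) $ i = 0" for n
  proof (induction n)
    case 0
    then show ?case using root by (simp add: R0)
  next
    case (Suc n)
    define c where "c = - (poly p (R n) $ Suc n) / d"
    define h where "h = fps_X ^ Suc n * fps_const c"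
    obtain q where q: "poly p (R n + h) = poly p (R n) + h * poly (pderiv p) (R n) + h^2 * q"
      using poly_taylor1 by blast
    have hh: "h * g = fps_X ^ Suc n * (fps_const c * g)" for g
      by (simp add: h_def algebra_simps)
    have h2: "h^2 * q = fps_X ^ Suc n * (fps_X ^ Suc n * (fps_const c * fps_const c * q))"
      by (simp add: h_def power2_eq_square algebra_simps)
    have "\<forall>i\<le>0. poly (pderiv p) (R n) $ i = poly (pderiv p) (fps_const r0) $ i"
      by (rule fps_poly_nth_cong) (simp add: R_nth [of 0 n] R0)
    then have d: "poly (pderiv p) (R n) $ 0 = d" by (simp add: d_def)
    have "poly p (R n + h) $ i = 0" if "i \<le> Suc n" for i
      unfolding q fps_add_nth hh h2 fps_X_power_mult_nth
      using Suc that d simple by (cases "i = Suc n") (auto simp: c_def d_def)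
    then show ?case by (simp add: RS step_def h_def c_def)
  qed
  \<comment> \<open>The diagonal agrees with \<open>R n\<close> up to degree
    \<open>n\<close>.\<close>
  define r where "r = Abs_fps (\<lambda>n. R n $ n)"
  have "poly p r $ n = poly p (R n) $ n" for n
  proof -
    have "\<forall>i\<le>n. r $ i = R n $ i" unfolding r_def fps_nth_Abs_fps using R_nth by metis
    then show ?thesis using fps_poly_nth_cong by blast
  qed
  then have "poly p r = 0" using inv by (simp add: fps_eq_iff)
  moreover have "r $ 0 = r0" by (simp add: r_def R0)
  ultimately show ?thesis by (rule that [rotated])
qed

context
  fixes t :: "'a::{char2,alg_closed_field}"
begin

text \<open>The derivative in \<open>y\<close> is \<open>x\<close>, which is a unit at
  \<open>x0\<close>, so the root \<open>y0\<close> is simple.\<close>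

lemma ex_affine_fps:
  assumes "x0 \<noteq> 0" "y0^2 + x0 * y0 = x0^3 + t * x0^2 + 1"
  defines "x \<equiv> fps_const x0 + fps_X"
  obtains y where "y $ 0 = y0" "y^2 + x * y = x^3 + fps_const t * x^2 + 1"
proof -
  let ?p = "[:x^3 + fps_const t * x^2 + 1, x, 1:]"
  have x0: "x $ 0 = x0" by (simp add: x_def)
  have "poly ?p (fps_const y0) $ 0 = (x0^3 + t * x0^2 + 1) + (y0^2 + x0 * y0)"
    by (simp add: x0 fps_power_zeroth algebra_simps power2_eq_square)
  then have "poly ?p (fps_const y0) $ 0 = 0" using assms(2) by simp
  moreover have "poly (pderiv ?p) (fps_const y0) $ 0 \<noteq> 0"
    using assms(1) by (simp add: pderiv_pCons x0)
  ultimately obtain y where y: "y $ 0 = y0" "poly ?p y = 0" by (rule fps_hensel)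
  have "(y^2 + x * y) + (x^3 + fps_const t * x^2 + 1) = poly ?p y"
    by (simp add: algebra_simps power2_eq_square)
  then have "(y^2 + x * y) + (x^3 + fps_const t * x^2 + 1) = 0" by (simp only: y(2))
  then have "(y^2 + x * y) = (x^3 + fps_const t * x^2 + 1)" by (simp only: add_eq_0_char2)
  with y(1) show ?thesis by (rule that)
qed

text \<open>At \<open>(0, 1)\<close> the roles change: \<open>y = 1 + fps_X\<close> is prescribed
  and \<open>x\<close> is solved for, the derivative in \<open>x\<close> having value 1.\<close>

lemma ex_torsion_fps:
  obtains x where "x $ 0 = 0" "fps_X^2 + x * (1 + fps_X) = x^3 + fps_const t * x^2"
proof -
  let ?p = "[:fps_X^2, 1 + fps_X, fps_const t, 1:]"
  have "poly ?p (fps_const 0) $ 0 = 0" by simp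
  moreover have "poly (pderiv ?p) (fps_const 0) $ 0 \<noteq> 0"
    by (simp add: pderiv_pCons)
  ultimately obtain x where x: "x $ 0 = 0" "poly ?p x = 0" by (rule fps_hensel)
  have "fps_X^2 + x * (1 + fps_X) + (x^3 + fps_const t * x^2) = poly ?p x"
    by (simp add: algebra_simps power2_eq_square power3_eq_cube)
  then have "fps_X^2 + x * (1 + fps_X) + (x^3 + fps_const t * x^2) = 0" by (simp only: x(2))
  then have "fps_X^2 + x * (1 + fps_X) = (x^3 + fps_const t * x^2)" by (simp only: add_eq_0_char2)
  with x(1) show ?thesis by (rule that)
qed

text \<open>The curve in the coordinates \<open>x / y\<close> and \<open>z = 1 / y\<close>, with
  \<open>x / y\<close> as parameter.\<close>

lemma ex_infinity_fps:
  obtains z where "z $ 0 = 0" "z + fps_X * z + z^3 + fps_const t * fps_X^2 * z = fps_X^3"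
proof -
  let ?p = "[:fps_X^3, 1 + fps_X + fps_const t * fps_X^2, 0, 1:]"
  have "poly ?p (fps_const 0) $ 0 = 0" by simp
  moreover have "poly (pderiv ?p) (fps_const 0) $ 0 \<noteq> 0"
    by (simp add: pderiv_pCons)
  ultimately obtain z where z: "z $ 0 = 0" "poly ?p z = 0" by (rule fps_hensel)
  have "z + fps_X * z + z^3 + fps_const t * fps_X^2 * z + fps_X^3 = poly ?p z"
    by (simp add: algebra_simps power2_eq_square power3_eq_cube)
  then have "z + fps_X * z + z^3 + fps_const t * fps_X^2 * z + fps_X^3 = 0" by (simp only: z(2))
  then have "z + fps_X * z + z^3 + fps_const t * fps_X^2 * z = fps_X^3" by (simp only: add_eq_0_char2)
  with z(1) show ?thesis by (rule that)
qed

interpretation ftf: rhom "fps_to_fls :: 'a fps \<Rightarrow> 'a fls" by (rule rhom_fps_to_fls)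

lemma fps_to_fls_X' [simp]: "fps_to_fls fps_X = fls_X"
  by (simp add: fls_X_conv_shift_1)

lemma vge_fps_to_fls: "vge (fps_to_fls f) 0"
  by (simp add: vge_def)

lemma subdegree_fps_unit: "f $ 0 \<noteq> 0 \<Longrightarrow> fls_subdegree (fps_to_fls f) = 0"
  by (rule fls_subdegree_eqI) simp_all

lemma affine_at_fps:
  assumes "x0 \<noteq> 0" "y^2 + (fps_const x0 + fps_X) * y = (fps_const x0 + fps_X)^3 + fps_const t * (fps_const x0 + fps_X)^2 + 1"
  shows "affine_at t x0 (fls_const x0 + fls_X) (fps_to_fls y)"
proof -
  have "fps_to_fls (y^2 + (fps_const x0 + fps_X) * y) = fps_to_fls ((fps_const x0 + fps_X)^3 + fps_const t * (fps_const x0 + fps_X)^2 + 1)"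
    using assms(2) by (simp only:)
  then show ?thesis
    using assms(1) by (simp add: affine_at_def on_curve_def vge_fps_to_fls ftf.hom_simps)
qed

text \<open>The equation can be written \<open>x * u = fps_X^2\<close> with a unit \<open>u\<close>,
  whence the order of \<open>x\<close>.\<close>

lemma torsion_at_fps:
  assumes "x $ 0 = 0" "fps_X^2 + x * (1 + fps_X) = x^3 + fps_const t * x^2"
  shows "torsion_at t (fps_to_fls x) (1 + fls_X)"
proof -
  let ?x = "fps_to_fls x"
  have eq: "fls_X^2 + ?x * (1 + fls_X) = ?x^3 + fls_const t * ?x^2"
    using arg_cong [OF assms(2), of fps_to_fls] by (simp add: ftf.hom_simps)
  define u where "u = 1 + fps_X + x^2 + fps_const t * x"
  have "x * u + fps_X^2 = (fps_X^2 + x * (1 + fps_X)) + (x^3 + fps_const t * x^2)"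
    by (simp add: u_def algebra_simps power2_eq_square power3_eq_cube)
  then have "x * u + fps_X^2 = 0" unfolding assms(2) by (simp only: add_self)
  then have "x * u = fps_X^2" by (simp only: add_eq_0_char2)
  then have "fps_to_fls (x * u) = fps_to_fls (fps_X^2)" by (simp only:)
  then have xu: "?x * fps_to_fls u = fls_X^2"
    by (simp only: ftf.hom_mult ftf.hom_power fps_to_fls_X')
  then have x0: "?x \<noteq> 0" by auto
  have "u $ 0 \<noteq> 0" using assms(1) by (simp add: u_def fps_power_zeroth)
  then have u: "fps_to_fls u \<noteq> 0" "fls_subdegree (fps_to_fls u) = 0"
    by (auto intro: subdegree_fps_unit)
  have "fls_subdegree (?x * fps_to_fls u) = 2" unfolding xu by simp
  then have "fls_subdegree ?x = 2" using u x0 by simp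
  then show ?thesis using eq by (simp add: torsion_at_def on_curve_def square_add algebra_simps)
qed

text \<open>Again \<open>z * u = fps_X^3\<close> with a unit \<open>u\<close>, so
  \<open>x = fls_X / z\<close> has order \<open>-2\<close>.\<close>

lemma infinity_at_fps:
  assumes "z $ 0 = 0" "z + fps_X * z + z^3 + fps_const t * fps_X^2 * z = fps_X^3"
  shows "infinity_at t (fls_X / fps_to_fls z) (1 / fps_to_fls z)" "fps_to_fls z \<noteq> 0" "fls_subdegree (fps_to_fls z) = 3"
proof -
  let ?z = "fps_to_fls z"
  have eq: "?z + fls_X * ?z + ?z^3 + fls_const t * fls_X^2 * ?z = fls_X^3"
    using arg_cong [OF assms(2), of fps_to_fls] by (simp add: ftf.hom_simps)
  define u where "u = 1 + fps_X + z^2 + fps_const t * fps_X^2"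
  have "z * u = fps_X^3"
    unfolding u_def assms(2) [symmetric] by (simp add: algebra_simps power2_eq_square power3_eq_cube)
  then have "fps_to_fls (z * u) = fps_to_fls (fps_X^3)" by (simp only:)
  then have zu: "?z * fps_to_fls u = fls_X^3"
    by (simp only: ftf.hom_mult ftf.hom_power fps_to_fls_X')
  then show z0: "?z \<noteq> 0" by auto
  have "u $ 0 \<noteq> 0" using assms(1) by (simp add: u_def fps_power_zeroth)
  then have u: "fps_to_fls u \<noteq> 0" "fls_subdegree (fps_to_fls u) = 0"
    by (auto intro: subdegree_fps_unit)
  have "fls_subdegree (?z * fps_to_fls u) = 3" unfolding zu by simp
  then show sub: "fls_subdegree ?z = 3" using u z0 by simp
  have "fls_subdegree (fls_X / ?z) = - 2" using z0 sub by (simp add: fls_divide_subdegree)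
  moreover have "1 / ?z = fls_X / ?z * fls_X_inv"
    by (simp add: fls_inverse_X [symmetric] del: fls_inverse_X)
  moreover have "on_curve t (fls_X / ?z) (1 / ?z)"
  proof -
    have "(1 / ?z)^2 + fls_X / ?z * (1 / ?z) = (?z + fls_X * ?z) / ?z^3"
      using z0 by (simp add: field_simps power2_eq_square power3_eq_cube)
    moreover have "(fls_X / ?z)^3 + fls_const t * (fls_X / ?z)^2 + 1 = (fls_X^3 + fls_const t * fls_X^2 * ?z + ?z^3) / ?z^3"
      using z0 by (simp add: field_simps power2_eq_square power3_eq_cube)
    moreover have "?z + fls_X * ?z = fls_X^3 + fls_const t * fls_X^2 * ?z + ?z^3"
      unfolding eq [symmetric] by (simp add: algebra_simps)
    ultimately show ?thesis by (simp add: on_curve_def)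
  qed
  ultimately show "infinity_at t (fls_X / ?z) (1 / ?z)" unfolding infinity_at_def by blast
qed

lemma ex_affine: 
  assumes "x0 \<noteq> 0" shows "\<exists>x y. affine_at t x0 x y"
proof -
  obtain y0 where "poly [:x0^3 + t * x0^2 + 1, x0, 1:] y0 = 0"
    using alg_closed_imp_poly_has_root [of "[:x0^3 + t * x0^2 + 1, x0, 1:]"] by auto
  then have "(x0^3 + t * x0^2 + 1) + (y0^2 + x0 * y0) = 0"
    by (simp add: algebra_simps power2_eq_square)
  then have "y0^2 + x0 * y0 = x0^3 + t * x0^2 + 1" unfolding add_eq_0_char2 by simp
  from ex_affine_fps [OF assms this] affine_at_fps [OF assms] show ?thesis by metis
qed

lemma ex_torsion: "\<exists>x y. torsion_at t x y"
  using ex_torsion_fps torsion_at_fps by metis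

lemma ex_infinity: "\<exists>x y. infinity_at t x y"
  using ex_infinity_fps infinity_at_fps by metis

end

lemmas tame_global' = tame_global [OF ex_affine ex_torsion ex_infinity]
  and tame_global_nontrivial' = tame_global_nontrivial [OF ex_affine ex_torsion ex_infinity]

section \<open>The norm equation\<close>

definition kpoly :: "'a::zero set \<Rightarrow> 'a poly \<Rightarrow> bool" where
  "kpoly k p \<longleftrightarrow> (\<forall>i. pcoeff p i \<in> k)"

definition kpair :: "'a::zero set \<Rightarrow> 'a poly \<times> 'a poly \<Rightarrow> bool" where
  "kpair k p \<longleftrightarrow> kpoly k (fst p) \<and> kpoly k (snd p)"

context subfield_set
begin

lemma kpoly_0 [simp]: "kpoly k 0"
  by (simp add: kpoly_def)

lemma kpoly_pCons_iff: "kpoly k (pCons a p) \<longleftrightarrow> a \<in> k \<and> kpoly k p"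
proof
  assume *: "kpoly k (pCons a p)"
  show "a \<in> k \<and> kpoly k p"
    using *[unfolded kpoly_def, rule_format, of 0] *[unfolded kpoly_def, rule_format, of "Suc _"]
    by (simp add: kpoly_def)
qed (auto simp: kpoly_def coeff_pCons split: nat.split)

lemma kpoly_1 [simp]: "kpoly k 1"
  by (simp add: one_pCons kpoly_pCons_iff)

lemma kpoly_add: "kpoly k p \<Longrightarrow> kpoly k q \<Longrightarrow> kpoly k (p + q)"
  by (simp add: kpoly_def add_mem)

lemma kpoly_mult: "kpoly k p \<Longrightarrow> kpoly k q \<Longrightarrow> kpoly k (p * q)"
  by (simp add: kpoly_def coeff_mult sum_mem mult_mem)

lemma kpair_padd: "kpair k p \<Longrightarrow> kpair k q \<Longrightarrow> kpair k (padd p q)"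
  by (simp add: kpair_def padd_def kpoly_add)

lemma kpair_pmul: "t \<in> k \<Longrightarrow> kpair k p \<Longrightarrow> kpair k q \<Longrightarrow> kpair k (pmul t p q)"
  by (simp only: kpair_def pmul_def fst_conv snd_conv)
    (intro conjI kpoly_add kpoly_mult; simp add: kpoly_pCons_iff)

end

locale perfect_set = subfield_set k for k :: "'K::{field,char2} set" +
  assumes sqrt_mem: "a \<in> k \<Longrightarrow> \<exists>b\<in>k. b^2 = a"
begin

lemma fourth_root_mem: "a \<in> k \<Longrightarrow> \<exists>b\<in>k. b^4 = a"
proof -
  assume "a \<in> k"
  then obtain b c where "c \<in> k" "c^2 = b" "b^2 = a" by (metis sqrt_mem)
  then have "c^4 = a" using power_mult [of c 2 2] by simp
  with \<open>c \<in> k\<close> show ?thesis by blast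
qed

text \<open>Horner's scheme: multiplication by \<open>x\<close> rotates the four components,
  \<open>x^4\<close> being absorbed as a fourth power together with the fourth root of the new
  constant term.\<close>

lemma kpoly_fourth_powers:
  assumes "kpoly k p"
  shows "\<exists>p0 p1 p2 p3. kpoly k p0 \<and> kpoly k p1 \<and> kpoly k p2 \<and> kpoly k p3 \<and>
    p = p0^4 + p1^4 * [:0, 1:] + p2^4 * [:0, 1:]^2 + p3^4 * [:0, 1:]^3"
  using assms
proof (induction p)
  case 0
  show ?case by (rule exI [of _ 0])+ simp
next
  case (pCons a p)
  then obtain p0 p1 p2 p3 where p: "kpoly k p0" "kpoly k p1" "kpoly k p2" "kpoly k p3"
    "p = p0^4 + p1^4 * [:0, 1:] + p2^4 * [:0, 1:]^2 + p3^4 * [:0, 1:]^3"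
    by (auto simp: kpoly_pCons_iff)
  obtain b where b: "b \<in> k" "b^4 = a" using pCons.prems fourth_root_mem by (auto simp: kpoly_pCons_iff)
  have "[:b:]^4 = [:a:]" using b by (simp add: poly_const_pow)
  moreover have "pCons a p = [:a:] + [:0, 1:] * p" by simp
  ultimately have "pCons a p = ([:b:] + p3 * [:0, 1:])^4 + p0^4 * [:0, 1:] + p1^4 * [:0, 1:]^2 + p2^4 * [:0, 1:]^3"
    unfolding p(5) fourth_add power_mult_distrib
    by (simp only:) (simp only: algebra_simps power2_eq_square power3_eq_cube power4_eq_xxxx)
  moreover have "kpoly k ([:b:] + p3 * [:0, 1:])"
    by (intro kpoly_add kpoly_mult p) (simp_all add: kpoly_pCons_iff b)
  ultimately show ?case using p(1-3) by blast
qed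

text \<open>The point is to expand \<open>y\<close>. This is done by
  \<open>x^4 y = e^4 x + x^4 x^2 + (x + 1)^4 x^3\<close> with \<open>e = 1 + u x + y\<close>, which
  also explains the factor \<open>x^4\<close>. All coefficients remain in \<open>k\<close>.\<close>

lemma fourth_power_decomp:
  assumes t: "t \<in> k" and P: "kpoly k P" and Q: "kpoly k Q"
  obtains a c q r where "kpair k a" "kpair k c" "kpair k q" "kpair k r"
    "\<And>x y. on_curve t x y \<Longrightarrow> x^4 * pev x y (P, Q) = pev x y a ^ 4 + pev x y c ^ 4 * x^2 + pev x y q ^ 4 * x + pev x y r ^ 4 * x^3"
proof -
  obtain p0 p1 p2 p3 where p: "kpoly k p0" "kpoly k p1" "kpoly k p2" "kpoly k p3"
    "P = p0^4 + p1^4 * [:0, 1:] + p2^4 * [:0, 1:]^2 + p3^4 * [:0, 1:]^3"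
    using kpoly_fourth_powers [OF P] by blast
  obtain q0 q1 q2 q3 where q: "kpoly k q0" "kpoly k q1" "kpoly k q2" "kpoly k q3"
    "Q = q0^4 + q1^4 * [:0, 1:] + q2^4 * [:0, 1:]^2 + q3^4 * [:0, 1:]^3"
    using kpoly_fourth_powers [OF Q] by blast
  \<comment> \<open>This \<open>u\<close> makes \<open>e^4\<close> absorb the terms
    \<open>t x^4\<close> and \<open>t^2 x^4\<close> of \<open>y^4\<close>.\<close>
  obtain u where u: "u \<in> k" "u^4 = t + t^2"
    using fourth_root_mem [of "t + t^2"] t by (auto intro: add_mem power_mem)
  let ?x = "[:0, 1:] :: 'K poly" and ?e = "[:1, u:]"
  \<comment> \<open>The entries arise from the identity for \<open>y\<close>, multiplied by the
    fourth power of \<open>q0\<close>, ..., \<open>q3\<close> and the matching power of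
    \<open>x\<close>, by reducing exponents of \<open>x\<close> modulo 4.\<close>
  define a where "a = (p0 * ?x + q1 * (?x + 1) * ?x + q2 * ?x * ?x + q3 * ?e * ?x, q3 * ?x)"
  define q' where "q' = (p1 * ?x + q0 * ?e + q2 * (?x + 1) * ?x + q3 * ?x * ?x, q0)"
  define c where "c = (p2 * ?x + q0 * ?x + q1 * ?e + q3 * (?x + 1) * ?x, q1)"
  define r where "r = (p3 * ?x + q0 * (?x + 1) + q1 * ?x + q2 * ?e, q2)"
  have X: "kpoly k ?x" "kpoly k ?e" by (simp_all add: kpoly_pCons_iff u)
  have kp: "kpair k a" "kpair k c" "kpair k q'" "kpair k r"
    unfolding kpair_def a_def c_def q'_def r_def fst_conv snd_conv
    by (intro conjI kpoly_add kpoly_mult X p q kpoly_1)+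
  have "x^4 * pev x y (P, Q) = pev x y a ^ 4 + pev x y c ^ 4 * x^2 + pev x y q' ^ 4 * x + pev x y r ^ 4 * x^3"
    if oc: "on_curve t x y" for x y
  proof -
    interpret h: rhom "hpoly fls_const x" by (rule fls_hom.rhom_hpoly)
    define e where "e = 1 + x * fls_const u + y"
    have u4: "fls_const u ^ 4 = fls_const t + fls_const t ^ 2"
      by (simp add: u fls_plus_const flip: fls_hom.hom_power)
    have e4: "e^4 = y^4 + 1 + (fls_const t + fls_const t ^ 2) * x^4"
      by (simp add: e_def fourth_add power_mult_distrib u4 algebra_simps)
    have yy: "y^2 = x * y + x^3 + fls_const t * x^2 + 1"
      using on_curve_square [OF oc] by (simp add: power2_eq_square power3_eq_cube algebra_simps)
    have "y^4 = (y^2)^2" by (simp flip: power_mult)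
    also have "\<dots> = (x * y + x^3 + fls_const t * x^2 + 1)^2" by (simp only: yy)
    also have "\<dots> = x^2 * y^2 + x^6 + fls_const t ^ 2 * x^4 + 1"
      by (simp add: square_add power_mult_distrib flip: power_mult)
    also have "\<dots> = x^3 * y + x^5 + fls_const t * x^4 + x^2 + x^6 + fls_const t ^ 2 * x^4 + 1"
      unfolding yy by (simp add: algebra_simps power2_eq_square power3_eq_cube eval_nat_numeral)
    finally have y4: "x^4 * y = e^4 * x + x^4 * x^2 + (x + 1)^4 * x^3"
      unfolding e4 fourth_add by (simp add: algebra_simps eval_nat_numeral)
    let ?h = "hpoly fls_const x"
    have hx: "?h ?x = x" "?h ?e = 1 + x * fls_const u" by simp_all
    have pa: "pev x y a = ?h p0 * x + ?h q1 * (x + 1) * x + ?h q2 * x * x + ?h q3 * e * x"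
      "pev x y q' = ?h p1 * x + ?h q0 * e + ?h q2 * (x + 1) * x + ?h q3 * x * x"
      "pev x y c = ?h p2 * x + ?h q0 * x + ?h q1 * e + ?h q3 * (x + 1) * x"
      "pev x y r = ?h p3 * x + ?h q0 * (x + 1) + ?h q1 * x + ?h q2 * e"
      unfolding pev_def a_def q'_def c_def r_def fst_conv snd_conv h.hom_simps hx e_def
      by (simp_all only: algebra_simps)
    have "x^4 * pev x y (P, Q) = x^4 * (?h p0 ^ 4 + ?h p1 ^ 4 * x + ?h p2 ^ 4 * x^2 + ?h p3 ^ 4 * x^3)
      + (?h q0 ^ 4 + ?h q1 ^ 4 * x + ?h q2 ^ 4 * x^2 + ?h q3 ^ 4 * x^3) * (x^4 * y)"
      unfolding pev_def fst_conv snd_conv p(5) q(5) h.hom_simps hx by (simp only: algebra_simps)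
    also have "\<dots> = pev x y a ^ 4 + pev x y c ^ 4 * x^2 + pev x y q' ^ 4 * x + pev x y r ^ 4 * x^3"
      unfolding y4 pa fourth_add power_mult_distrib by (simp add: algebra_simps eval_nat_numeral)
    finally show ?thesis .
  qed
  with kp show ?thesis by (rule that)
qed

end

section \<open>Anisotropy of the norm form and descent through leading coefficients\<close>

lemma coeff_mult_top:
  fixes p q :: "'a::comm_ring_1 poly"
  assumes "pdeg p \<le> m" "pdeg q \<le> n"
  shows "pcoeff (p * q) (m + n) = pcoeff p m * pcoeff q n"
proof -
  have "pcoeff (p * q) (m + n) = (\<Sum>i\<le>m + n. if i = m then pcoeff p m * pcoeff q n else 0)"
    unfolding coeff_mult
  proof (rule sum.cong)
    fix i assume "i \<in> {..m + n}"
    show "pcoeff p i * pcoeff q (m + n - i) = (if i = m then pcoeff p m * pcoeff q n else 0)"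
    proof (cases "i = m")
      case False
      then have "m < i \<or> n < m + n - i" using \<open>i \<in> _\<close> by auto
      then show ?thesis using assms False by (auto simp: coeff_eq_0)
    qed simp
  qed simp
  then show ?thesis by simp
qed

text \<open>Anisotropy on coefficients prevents cancellation of the top terms of \<open>a\<close>
  and \<open>b\<close>. This gives an equation of degrees and an equation of the same shape for
  leading coefficients.\<close>

lemma norm_form_poly_degree:
  fixes a b c :: "'a::{idom,char2} poly"
  assumes x: "x * (a^2 + a * b + b^2) = c^2" and ab: "a \<noteq> 0 \<or> b \<noteq> 0"
    and anis: "\<And>u v. u \<noteq> (0::'a) \<or> v \<noteq> 0 \<Longrightarrow> u^2 + u * v + v^2 \<noteq> 0"
    and x0: "x \<noteq> 0"
  obtains u v where "u \<noteq> 0 \<or> v \<noteq> 0" "pdeg c * 2 = pdeg x + 2 * max (pdeg a) (pdeg b)"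
    "Polynomial.lead_coeff x * (u^2 + u * v + v^2) = Polynomial.lead_coeff c ^ 2"
proof -
  define n where "n = max (pdeg a) (pdeg b)"
  define u where "u = pcoeff a n"
  define v where "v = pcoeff b n"
  have uv: "u \<noteq> 0 \<or> v \<noteq> 0"
  proof (rule ccontr)
    assume 0: "\<not> (u \<noteq> 0 \<or> v \<noteq> 0)"
    have "a = 0 \<or> pdeg a < n" "b = 0 \<or> pdeg b < n"
      using 0 eq_zero_or_degree_less [of a n] eq_zero_or_degree_less [of b n]
      by (auto simp: u_def v_def n_def)
    then show False using ab by (auto simp: n_def max_def split: if_splits)
  qed
  let ?N = "a^2 + a * b + b^2"
  have deg: "pdeg a \<le> n" "pdeg b \<le> n" by (simp_all add: n_def)
  have top: "pcoeff ?N (n + n) = u^2 + u * v + v^2"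
    unfolding power2_eq_square coeff_add u_def v_def by (simp only: coeff_mult_top deg)
  then have top0: "pcoeff ?N (n + n) \<noteq> 0" using anis [OF uv] by simp
  have "pdeg ?N \<le> n + n"
    unfolding power2_eq_square by (intro degree_add_le order.trans [OF degree_mult_le] add_mono deg)
  then have N1: "pdeg ?N = n + n" using le_degree [OF top0] by (rule antisym)
  have "?N \<noteq> 0" using top0 by (metis coeff_0)
  note N = N1 top [folded N1] this
  have "pdeg (c^2) = pdeg x + (n + n)"
    unfolding x [symmetric] using degree_mult_eq [OF x0 N(3)] by (simp only: N(1))
  moreover have "Polynomial.lead_coeff (c^2) = Polynomial.lead_coeff x * (u^2 + u * v + v^2)"
    unfolding x [symmetric] lead_coeff_mult N1 top ..
  moreover have "pdeg (c^2) = pdeg c * 2" by (cases "c = 0") (simp_all add: power2_eq_square degree_mult_eq)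
  moreover have "Polynomial.lead_coeff (c^2) = Polynomial.lead_coeff c ^ 2" by (rule lead_coeff_power)
  ultimately have "pdeg c * 2 = pdeg x + 2 * max (pdeg a) (pdeg b)"
    "Polynomial.lead_coeff x * (u^2 + u * v + v^2) = Polynomial.lead_coeff c ^ 2"
    by (simp_all only: n_def mult_2)
  with uv show ?thesis by (rule that)
qed

text \<open>The degrees differ in parity: the factor \<open>x\<close> makes the left one odd, the
  right one is even.\<close>

lemma norm_form_bit_poly:
  fixes a b c :: "bit poly"
  assumes "[:0, 1:] * (a^2 + a * b + b^2) = c^2"
  shows "a = 0" "b = 0"
proof -
  have anis: "u^2 + u * v + v^2 \<noteq> 0" if "u \<noteq> 0 \<or> v \<noteq> 0" for u v :: bit
    using that by (cases u; cases v) auto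
  have "\<not> (a \<noteq> 0 \<or> b \<noteq> 0)"
  proof
    assume "a \<noteq> 0 \<or> b \<noteq> 0"
    from norm_form_poly_degree [OF assms this anis] have "pdeg c * 2 = pdeg [:0, 1::bit:] + 2 * max (pdeg a) (pdeg b)"
      by force
    then have "pdeg c * 2 = 1 + 2 * max (pdeg a) (pdeg b)" by simp
    then show False by presburger
  qed
  then show "a = 0" "b = 0" by auto
qed

abbreviation xF :: "bit poly fract" where "xF \<equiv> to_fract [:0, 1:]"

lemma xF_neq_0: "xF \<noteq> 0"
  by simp

lemma norm_form_fract:
  fixes a b c :: "bit poly fract"
  assumes "xF * (a^2 + a * b + b^2) = c^2"
  shows "a = 0" "b = 0"
proof -
  obtain a1 a2 where a: "a = Fract a1 a2" "a2 \<noteq> 0" by (cases a) auto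
  obtain b1 b2 where b: "b = Fract b1 b2" "b2 \<noteq> 0" by (cases b) auto
  obtain c1 c2 where c: "c = Fract c1 c2" "c2 \<noteq> 0" by (cases c) auto
  define d where "d = a2 * b2 * c2"
  have d: "d \<noteq> 0" using a b c by (simp add: d_def)
  define a' where "a' = a1 * b2 * c2"
  define b' where "b' = b1 * a2 * c2"
  define c' where "c' = c1 * a2 * b2"
  have abc: "a = to_fract a' / to_fract d" "b = to_fract b' / to_fract d" "c = to_fract c' / to_fract d"
    using a b c d by (simp_all add: a'_def b'_def c'_def d_def to_fract_def eq_fract)
  have d1: "to_fract d \<noteq> 0" using d by simp
  have "xF * ((to_fract a')^2 + to_fract a' * to_fract b' + (to_fract b')^2) = (to_fract c')^2"
    using assms d1 unfolding abc by (simp add: field_simps power2_eq_square)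
  then have "to_fract ([:0, 1:] * (a'^2 + a' * b' + b'^2)) = to_fract (c'^2)"
    by (simp only: to_fract_add to_fract_mult power2_eq_square)
  then have "[:0, 1:] * (a'^2 + a' * b' + b'^2) = c'^2" by (simp only: to_fract_eq_iff)
  from norm_form_bit_poly [OF this] have "a' = 0" "b' = 0" .
  then show "a = 0" "b = 0" by (simp_all add: abc)
qed

text \<open>Here \<open>xF\<close> is a constant and parity says nothing; instead the leading
  coefficients solve the equation over rational functions in \<open>x\<close>. Anisotropy there is
  the case of right-hand side 0.\<close>

lemma norm_form_fract_poly:
  fixes a b c :: "bit poly fract poly"
  assumes "[:xF:] * (a^2 + a * b + b^2) = c^2"
  shows "a = 0" "b = 0"
proof -
  have anis: "u^2 + u * v + v^2 \<noteq> 0" if "u \<noteq> 0 \<or> v \<noteq> 0" for u v :: "bit poly fract"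
    using that norm_form_fract [of u v 0] by auto
  have "\<not> (a \<noteq> 0 \<or> b \<noteq> 0)"
  proof
    assume "a \<noteq> 0 \<or> b \<noteq> 0"
    moreover have "[:xF:] \<noteq> 0" using xF_neq_0 by simp
    ultimately obtain u v where uv: "u \<noteq> 0 \<or> v \<noteq> 0"
      "Polynomial.lead_coeff [:xF:] * (u^2 + u * v + v^2) = Polynomial.lead_coeff c ^ 2"
      using norm_form_poly_degree [OF assms _ anis] by metis
    then have "xF * (u^2 + u * v + v^2) = Polynomial.lead_coeff c ^ 2" using xF_neq_0 by simp
    from norm_form_fract [OF this] uv(1) show False by simp
  qed
  then show "a = 0" "b = 0" by auto
qed

lemma rhom_to_fract: "rhom to_fract"
  by standard simp_all

lemma rhom_const_poly: "rhom (\<lambda>a::'a::comm_ring_1. [:a:])"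
  by standard (simp_all add: one_pCons)

lemma rhom_comp: "rhom f \<Longrightarrow> rhom g \<Longrightarrow> rhom (\<lambda>x. f (g x))"
  by (simp add: rhom_def)

lemma hpoly_degree:
  fixes z :: "'b::idom poly"
  assumes "rhom f" and f0: "\<And>a. f a = 0 \<Longrightarrow> a = 0" and z: "pdeg z > 0" and "p \<noteq> 0"
  shows "hpoly (\<lambda>a. [:f a:]) z p \<noteq> 0 \<and> pdeg (hpoly (\<lambda>a. [:f a:]) z p) = pdeg z * pdeg p"
proof -
  interpret h: rhom "\<lambda>a. [:f a:]" by (rule rhom_comp [OF rhom_const_poly assms(1)])
  show ?thesis using \<open>p \<noteq> 0\<close>
  proof (induction p)
    case (pCons a p)
    show ?case
    proof (cases "p = 0")
      case True
      then show ?thesis using pCons f0 by auto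
    next
      case False
      let ?h = "hpoly (\<lambda>a. [:f a:]) z p"
      have IH: "?h \<noteq> 0" "pdeg ?h = pdeg z * pdeg p" using pCons False by auto
      have z0: "z \<noteq> 0" using z by auto
      have "pdeg (z * ?h) = pdeg z + pdeg z * pdeg p" using IH z0 by (simp add: degree_mult_eq)
      moreover have "pdeg ([:f a:] + z * ?h) = pdeg (z * ?h)"
        by (rule degree_add_eq_right) (use calculation z in simp)
      moreover have "[:f a:] + z * ?h \<noteq> 0"
        using calculation z by (metis add_is_0 degree_0 less_not_refl)
      ultimately show ?thesis using False by simp
    qed
  qed simp
qed

text \<open>The surface \<open>y\<^sup>2 + x y = x\<^sup>3 + T x\<^sup>2 + 1\<close> is parametrized by \<open>x\<close> and \<open>\<zeta> = y / x\<close>.\<close>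

definition param :: "bit poly poly \<Rightarrow> bit poly fract poly" where
  "param = hpoly (\<lambda>p. [:to_fract p:]) [:xF + 1 / xF^2, 1, 1:]"

lemma rhom_param: "rhom param"
  unfolding param_def by (rule rhom.rhom_hpoly) (rule rhom_comp [OF rhom_const_poly rhom_to_fract])

lemma param_degree:
  assumes "A \<noteq> 0"
  shows "param A \<noteq> 0 \<and> pdeg (param A) = 2 * pdeg A"
proof -
  have "pdeg [:xF + 1 / xF^2, 1, 1:] = 2" by simp
  then show ?thesis unfolding param_def
    using hpoly_degree [OF rhom_to_fract _ _ assms, of "[:xF + 1 / xF^2, 1, 1:]"] by auto
qed

text \<open>In \<open>\<zeta>\<close> the image of \<open>T\<close> has degree 2 and
  \<open>y = x \<zeta>\<close> has degree 1, so the two summands have degrees of different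
  parity.\<close>

lemma param_eq_0:
  assumes "param A + param B * [:0, xF:] = 0"
  shows "A = 0" "B = 0"
proof -
  have B: "B = 0"
  proof (rule ccontr)
    assume "B \<noteq> 0"
    then have "pdeg (param B * [:0, xF:]) = 2 * pdeg B + 1"
      using param_degree [of B] xF_neq_0 by (subst degree_mult_eq) auto
    moreover have "param A = param B * [:0, xF:]"
      using assms by (simp only: add_eq_0_char2)
    moreover have "param B * [:0, xF:] \<noteq> 0" using \<open>B \<noteq> 0\<close> param_degree [of B] xF_neq_0
      by (metis mult_eq_0_iff pCons_eq_0_iff)
    ultimately have "A \<noteq> 0" "pdeg (param A) = 2 * pdeg B + 1"
      using rhom.hom_0 [OF rhom_param] by auto
    then have "2 * pdeg A = 2 * pdeg B + 1" using param_degree by metis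
    then show False by presburger
  qed
  then have "param A = 0" using assms by (simp add: rhom.hom_0 [OF rhom_param])
  then show "A = 0" "B = 0" using param_degree [of A] B by auto
qed

text \<open>The components of the norm equation with respect to \<open>1, y\<close>. The generality
  allows its use on the rational surface and on a branch of the curve.\<close>

lemma norm_form_expand:
  fixes x y g a b c d e f :: "'a::char2"
  assumes yy: "y^2 = x * y + g"
  shows "x * ((a + b * y)^2 + (a + b * y) * (c + d * y) + (c + d * y)^2) + (e + f * y)^2
    = (x * (a^2 + b^2 * g + (a * c + b * d * g) + (c^2 + d^2 * g)) + (e^2 + f^2 * g))
      + (x * (b^2 * x + (a * d + b * c + b * d * x) + d^2 * x) + f^2 * x) * y"
proof -
  have sq: "(u + v * y)^2 = u^2 + v^2 * g + v^2 * x * y" for u v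
    by (simp add: square_add power_mult_distrib yy algebra_simps)
  have "(a + b * y) * (c + d * y) = a * c + (a * d + b * c) * y + b * d * y^2"
    by (simp add: algebra_simps power2_eq_square)
  then have pr: "(a + b * y) * (c + d * y) = a * c + b * d * g + (a * d + b * c + b * d * x) * y"
    by (simp add: yy algebra_simps)
  show ?thesis unfolding sq pr by (simp add: algebra_simps)
qed

text \<open>In \<open>bit poly poly\<close> the inner variable is \<open>x\<close> and the outer one
  \<open>T\<close>. Recombined after \<open>param\<close>, the two components are the norm equation
  for polynomials in \<open>\<zeta>\<close>.\<close>

lemma generic_fibre:
  fixes q0 q1 r0 r1 s0 s1 :: "bit poly poly"
  defines "x \<equiv> [:[:0, 1:]:]" and "T \<equiv> [:0, 1:]"
  defines "g \<equiv> x^3 + T * x^2 + 1"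
  assumes I0: "x * (q0^2 + q1^2 * g + (q0 * r0 + q1 * r1 * g) + (r0^2 + r1^2 * g)) + (s0^2 + s1^2 * g) = 0"
    and I1: "x * (q1^2 * x + (q0 * r1 + q1 * r0 + q1 * r1 * x) + r1^2 * x) + s1^2 * x = 0"
  shows "q0 = 0 \<and> q1 = 0 \<and> r0 = 0 \<and> r1 = 0"
proof -
  interpret p: rhom param by (rule rhom_param)
  have px: "param x = [:xF:]"
    by (simp add: param_def x_def rhom.hpoly_pCons [OF rhom_comp [OF rhom_const_poly rhom_to_fract]]
      rhom.hpoly_0 [OF rhom_comp [OF rhom_const_poly rhom_to_fract]])
  have pT: "param T = [:xF + 1 / xF^2, 1, 1:]"
    by (simp add: param_def T_def rhom.hpoly_pCons [OF rhom_comp [OF rhom_const_poly rhom_to_fract]]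
      rhom.hpoly_0 [OF rhom_comp [OF rhom_const_poly rhom_to_fract]])
  define y where "y = [:0, xF:]"
  have "param g = [:xF:]^3 + [:xF + 1 / xF^2, 1, 1:] * [:xF:]^2 + 1"
    by (simp only: g_def p.hom_simps px pT)
  then have yy: "y^2 = param x * y + param g"
    using xF_neq_0 by (simp add: px y_def power2_eq_square power3_eq_cube one_pCons field_simps)
  define \<alpha> where "\<alpha> = param q0 + param q1 * y"
  define \<beta> where "\<beta> = param r0 + param r1 * y"
  define \<sigma> where "\<sigma> = param s0 + param s1 * y"
  have "param x * (\<alpha>^2 + \<alpha> * \<beta> + \<beta>^2) + \<sigma>^2
    = param (x * (q0^2 + q1^2 * g + (q0 * r0 + q1 * r1 * g) + (r0^2 + r1^2 * g)) + (s0^2 + s1^2 * g))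
     + param (x * (q1^2 * x + (q0 * r1 + q1 * r0 + q1 * r1 * x) + r1^2 * x) + s1^2 * x) * y"
    unfolding \<alpha>_def \<beta>_def \<sigma>_def norm_form_expand [OF yy]
    by (simp only: p.hom_add p.hom_mult p.hom_power)
  also have "\<dots> = 0" unfolding I0 I1 by (simp add: p.hom_0)
  finally have "[:xF:] * (\<alpha>^2 + \<alpha> * \<beta> + \<beta>^2) = \<sigma>^2" by (simp only: add_eq_0_char2 px)
  from norm_form_fract_poly [OF this] have "\<alpha> = 0" "\<beta> = 0" .
  then show ?thesis unfolding \<alpha>_def \<beta>_def y_def using param_eq_0 by blast
qed

section \<open>Specialization of \<open>T\<close> to a root of \<open>t\<close> of 2-power
  exponent\<close>

type_synonym KK = "bit poly fract alg_closure"

definition of_F2 :: "bit \<Rightarrow> 'a::char2" where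
  "of_F2 b = (if b = 1 then 1 else 0)"

lemma rhom_of_F2: "rhom of_F2"
proof
  show "of_F2 (a + b) = of_F2 a + (of_F2 b :: 'a)" for a b
    by (cases a; cases b) (simp_all add: of_F2_def)
  show "of_F2 (a * b) = of_F2 a * (of_F2 b :: 'a)" for a b
    by (cases a; cases b) (simp_all add: of_F2_def)
qed (simp add: of_F2_def)

lemma of_F2_power: "n > 0 \<Longrightarrow> of_F2 b ^ n = of_F2 b"
  by (simp add: of_F2_def zero_power)

lemma power_2pow_Suc: "a ^ (2 ^ Suc n) = (a ^ (2 ^ n))^2" for a :: "'a::monoid_mult"
  using power_mult [of a "2 ^ n" 2] by (simp only: power_Suc2)

lemma add_power_2pow: "(a + b) ^ (2 ^ n) = a ^ (2 ^ n) + b ^ (2 ^ n)" for a b :: "'a::char2"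
  by (induction n) (simp, simp only: power_2pow_Suc square_add)

lemma power_2pow_inj: "a ^ (2 ^ n) = b ^ (2 ^ n) \<Longrightarrow> a = b" for a b :: "'a::{char2,idom}"
proof -
  assume "a ^ (2 ^ n) = b ^ (2 ^ n)"
  then have "(a + b) ^ (2 ^ n) = 0" by (simp add: add_power_2pow)
  then show "a = b" by (simp add: add_eq_0_char2)
qed

definition bev :: "'a::char2 \<Rightarrow> bit poly \<Rightarrow> 'a" where
  "bev z = hpoly of_F2 z"

lemma rhom_bev: "rhom (bev z)"
  unfolding bev_def by (rule rhom.rhom_hpoly [OF rhom_of_F2])

lemma bev_pCons [simp]: "bev z (pCons b p) = of_F2 b + z * bev z p"
  and bev_0 [simp]: "bev z 0 = 0"
  by (simp_all add: bev_def rhom.hpoly_pCons [OF rhom_of_F2] rhom.hpoly_0 [OF rhom_of_F2])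

text \<open>Frobenius fixes the coefficients, which come from the field with two elements.\<close>

lemma bev_power_2pow: "bev z p ^ (2 ^ n) = bev (z ^ (2 ^ n)) p"
  by (induction p) (simp_all add: add_power_2pow power_mult_distrib of_F2_power zero_power)

definition tt :: KK where "tt = to_ac (to_fract [:0, 1:])"

lemma bev_tt: "bev tt p = to_ac (to_fract p)"
proof (induction p)
  case (pCons b p)
  have "of_F2 b = to_ac (to_fract [:b:])"
    by (cases b) (simp_all add: of_F2_def one_pCons [symmetric])
  moreover have "to_fract (pCons b p) = to_fract [:b:] + to_fract [:0, 1:] * to_fract p"
    by (simp only: to_fract_add [symmetric] to_fract_mult [symmetric]) simp
  ultimately have "to_ac (to_fract (pCons b p)) = of_F2 b + tt * to_ac (to_fract p)"
    by (simp only: to_ac_add to_ac_mult tt_def)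
  then show ?case by (simp only: bev_pCons pCons.IH)
qed simp

text \<open>\<open>\<tau>\<close> is transcendental over the field with two elements because a power
  of Frobenius carries it to \<open>tt\<close>.\<close>

lemma bev_eq_0_iff:
  assumes "\<tau> ^ (2 ^ n) = tt"
  shows "bev \<tau> p = 0 \<longleftrightarrow> p = 0"
proof
  assume "bev \<tau> p = 0"
  then have "bev \<tau> p ^ (2 ^ n) = 0" by simp
  then show "p = 0" by (simp add: bev_power_2pow assms bev_tt)
qed simp

definition bpoly :: "bit poly \<Rightarrow> 'a::char2 poly" where
  "bpoly = hpoly (\<lambda>b. [:of_F2 b:]) [:0, 1:]"

lemma rhom_bpoly: "rhom bpoly"
  unfolding bpoly_def by (rule rhom.rhom_hpoly [OF rhom_comp [OF rhom_const_poly rhom_of_F2]])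

lemma bpoly_pCons: "bpoly (pCons b p) = pCons (of_F2 b) (bpoly p)"
  and bpoly_0 [simp]: "bpoly 0 = 0"
  by (simp_all add: bpoly_def rhom.hpoly_pCons [OF rhom_comp [OF rhom_const_poly rhom_of_F2]]
      rhom.hpoly_0 [OF rhom_comp [OF rhom_const_poly rhom_of_F2]])

lemma coeff_bpoly: "pcoeff (bpoly p) j = of_F2 (pcoeff p j)"
proof (induction p arbitrary: j)
  case (pCons b p)
  show ?case by (simp add: bpoly_pCons coeff_pCons pCons.IH split: nat.split)
qed (simp add: of_F2_def)

text \<open>\<open>T\<close> becomes \<open>\<tau>\<close>, while \<open>x\<close> remains a
  variable.\<close>

definition spec :: "'a::char2 \<Rightarrow> bit poly poly \<Rightarrow> 'a poly" where
  "spec \<tau> = hpoly bpoly [:\<tau>:]"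

lemma rhom_spec: "rhom (spec \<tau>)"
  unfolding spec_def by (rule rhom.rhom_hpoly [OF rhom_bpoly])

lemma spec_pCons [simp]: "spec \<tau> (pCons p A) = bpoly p + Polynomial.smult \<tau> (spec \<tau> A)"
  and spec_0 [simp]: "spec \<tau> 0 = 0"
  by (simp_all add: spec_def rhom.hpoly_pCons [OF rhom_bpoly] rhom.hpoly_0 [OF rhom_bpoly])

lemma coeff_spec: "pcoeff (spec \<tau> A) j = bev \<tau> (map_poly (\<lambda>p. pcoeff p j) A)"
proof (induction A)
  case (pCons p A)
  then show ?case by (simp add: coeff_bpoly map_poly_pCons)
qed simp

text \<open>For each power of \<open>x\<close> the coefficients form a polynomial in
  \<open>T\<close> that vanishes at the transcendental \<open>\<tau>\<close>.\<close>

lemma spec_eq_0: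
  assumes "\<tau> ^ (2 ^ n) = tt" "spec \<tau> A = 0"
  shows "A = 0"
proof -
  have "map_poly (\<lambda>p. pcoeff p j) A = 0" for j
    using coeff_spec [of \<tau> A j] assms by (simp add: bev_eq_0_iff)
  then have "pcoeff (pcoeff A i) j = 0" for i j
    by (metis coeff_0 coeff_map_poly)
  then show ?thesis by (intro poly_eqI) (simp add: poly_eqI)
qed

text \<open>Regards a polynomial in \<open>T\<close> alone as one in \<open>x\<close> and
  \<open>T\<close>: the variable moves to the outer place.\<close>

definition lift_bpoly :: "bit poly \<Rightarrow> bit poly poly" where
  "lift_bpoly = map_poly (\<lambda>b. [:b:])"

lemma spec_lift: "spec \<tau> (lift_bpoly p) = [:bev \<tau> p:]"
  unfolding lift_bpoly_def
  by (induction p) (simp_all add: map_poly_pCons bpoly_pCons)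

text \<open>
  \<open>level n\<close> is the field generated by the root of \<open>t\<close> of exponent \<open>2\<^sup>n\<close>.
\<close>

definition level :: "nat \<Rightarrow> KK set" where
  "level n = {z. z ^ (2 ^ n) \<in> range to_ac}"

lemma level_mono:
  assumes "z \<in> level m" "m \<le> n"
  shows "z \<in> level n"
  using assms(2,1)
proof (induction n rule: dec_induct)
  case (step n)
  then obtain w where "z ^ (2 ^ n) = to_ac w" by (auto simp: level_def)
  then have "z ^ (2 ^ Suc n) = to_ac (w^2)"
    by (simp only: power_2pow_Suc to_ac_power)
  then show ?case unfolding level_def by blast
qed

text \<open>Levels increase, so finitely many coefficients share one. Asking for all large
  \<open>m\<close> lets several polynomials share one too.\<close>

lemma kpoly_level:
  assumes "kpoly perfect_closure_F2t p"
  shows "\<exists>n. \<forall>m\<ge>n. kpoly (level m) p"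
proof -
  have "0 \<in> level m" for m
  proof -
    have "(0::KK) ^ (2 ^ m) = to_ac 0" by (simp add: zero_power)
    then show ?thesis unfolding level_def by blast
  qed
  have "\<exists>n. \<forall>i. pcoeff p i \<in> level n"
  proof -
    have "\<exists>n. \<forall>i\<in>{..pdeg p}. pcoeff p i \<in> level n"
    proof -
      have "\<forall>i. \<exists>n. pcoeff p i \<in> level n"
        using assms by (simp add: kpoly_def perfect_closure_F2t_def level_def)
      then obtain f where f: "pcoeff p i \<in> level (f i)" for i by metis
      have "f i \<le> Max (f ` {..pdeg p})" if "i \<in> {..pdeg p}" for i using that by simp
      then show ?thesis using f level_mono by blast
    qed
    then obtain n where n: "i \<le> pdeg p \<Longrightarrow> pcoeff p i \<in> level n" for i by auto
    have "pcoeff p i \<in> level n" for i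
      using n [of i] \<open>0 \<in> level n\<close> by (cases "i \<le> pdeg p") (simp_all add: coeff_eq_0)
    then show ?thesis by blast
  qed
  then show ?thesis unfolding kpoly_def using level_mono by metis
qed

text \<open>The power \<open>2 ^ n\<close> of \<open>z\<close> is a fraction in \<open>t\<close>; by
  injectivity of Frobenius its root is the same fraction in \<open>\<tau>\<close>.\<close>

lemma level_ratio:
  assumes "\<tau> ^ (2 ^ n) = tt" and "z \<in> level n"
  shows "\<exists>p d. d \<noteq> 0 \<and> bev \<tau> d * z = bev \<tau> p"
proof -
  obtain w where w: "z ^ (2 ^ n) = to_ac w" using assms(2) by (auto simp: level_def)
  obtain p d where pd: "w = Fract p d" "d \<noteq> 0" by (cases w) auto
  have "to_fract d * w = to_fract p"
    using pd(2) by (simp add: pd(1) Fract_conv_to_fract)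
  then have "to_ac (to_fract d) * to_ac w = to_ac (to_fract p)"
    by (simp only: to_ac_mult [symmetric])
  then have "(bev \<tau> d * z) ^ (2 ^ n) = bev \<tau> p ^ (2 ^ n)"
    by (simp add: power_mult_distrib bev_power_2pow assms(1) bev_tt w)
  then have "bev \<tau> d * z = bev \<tau> p" by (rule power_2pow_inj)
  with pd show ?thesis by blast
qed

lemma clear_denominator:
  assumes "\<tau> ^ (2 ^ n) = tt" and "kpoly (level n) p"
  shows "\<exists>d A. d \<noteq> 0 \<and> Polynomial.smult (bev \<tau> d) p = spec \<tau> A"
  using assms(2)
proof (induction p)
  case 0
  show ?case by (rule exI [of _ 1], rule exI [of _ 0]) simp
next
  case (pCons a p)
  interpret S: rhom "spec \<tau>" by (rule rhom_spec)
  interpret B: rhom "bev \<tau>" by (rule rhom_bev)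
  have "kpoly (level n) p" unfolding kpoly_def
    using pCons.prems [unfolded kpoly_def, rule_format, of "Suc _"] by simp
  then obtain d A where d: "d \<noteq> 0" "Polynomial.smult (bev \<tau> d) p = spec \<tau> A"
    using pCons.IH by blast
  have "a \<in> level n" using pCons.prems [unfolded kpoly_def, rule_format, of 0] by simp
  then obtain b e where e: "e \<noteq> 0" "bev \<tau> e * a = bev \<tau> b"
    using level_ratio [OF assms(1)] by blast
  have "Polynomial.smult (bev \<tau> (d * e)) (pCons a p)
      = [:bev \<tau> d * (bev \<tau> e * a):] + [:bev \<tau> e:] * [:0, 1:] * Polynomial.smult (bev \<tau> d) p"
    by (simp add: B.hom_mult algebra_simps)
  also have "\<dots> = spec \<tau> (lift_bpoly d * lift_bpoly b + lift_bpoly e * [:[:0, 1:]:] * A)"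
    unfolding S.hom_simps spec_lift d(2) [symmetric] e(2)
    by (simp add: bpoly_pCons of_F2_def)
  finally have "Polynomial.smult (bev \<tau> (d * e)) (pCons a p)
      = spec \<tau> (lift_bpoly d * lift_bpoly b + lift_bpoly e * [:[:0, 1:]:] * A)" .
  moreover have "d * e \<noteq> 0" using d(1) e(1) by simp
  ultimately show ?case by blast
qed

lemma clear_denominators:
  assumes "\<tau> ^ (2 ^ n) = tt" and "\<And>p. p \<in> set L \<Longrightarrow> kpoly (level n) p"
  shows "\<exists>d. d \<noteq> 0 \<and> (\<forall>p\<in>set L. \<exists>A. Polynomial.smult (bev \<tau> d) p = spec \<tau> A)"
  using assms(2)
proof (induction L)
  case Nil
  show ?case by (rule exI [of _ 1]) simp
next
  case (Cons p L)
  interpret S: rhom "spec \<tau>" by (rule rhom_spec)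
  interpret B: rhom "bev \<tau>" by (rule rhom_bev)
  obtain d where d: "d \<noteq> 0" "\<And>q. q \<in> set L \<Longrightarrow> \<exists>A. Polynomial.smult (bev \<tau> d) q = spec \<tau> A"
  proof -
    have "\<exists>d. d \<noteq> 0 \<and> (\<forall>p\<in>set L. \<exists>A. Polynomial.smult (bev \<tau> d) p = spec \<tau> A)"
      by (rule Cons.IH) (simp add: Cons.prems)
    then show ?thesis using that by (elim exE conjE) simp
  qed
  obtain e B where e: "e \<noteq> 0" "Polynomial.smult (bev \<tau> e) p = spec \<tau> B"
    using clear_denominator [OF assms(1) Cons.prems [of p]] by auto
  have "\<exists>A. Polynomial.smult (bev \<tau> (d * e)) q = spec \<tau> A" if q: "q \<in> set (p # L)" for q
  proof (cases "q = p")
    case True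
    have "Polynomial.smult (bev \<tau> (d * e)) q = spec \<tau> (lift_bpoly d * B)"
      unfolding S.hom_mult spec_lift e(2) [symmetric] True by (simp add: B.hom_mult mult.commute)
    then show ?thesis by blast
  next
    case False
    then obtain A where A: "Polynomial.smult (bev \<tau> d) q = spec \<tau> A" using q d(2) by auto
    have "Polynomial.smult (bev \<tau> (d * e)) q = spec \<tau> (lift_bpoly e * A)"
      unfolding S.hom_mult spec_lift A [symmetric] by (simp add: B.hom_mult mult.commute)
    then show ?thesis by blast
  qed
  moreover have "d * e \<noteq> 0" using d(1) e(1) by simp
  ultimately show ?case by blast
qed

text \<open>The sum of \<open>\<tau> ^ (2 ^ i)\<close> over \<open>i < n\<close> telescopes.\<close>

lemma artin_schreier_shift: "\<exists>p. bev \<tau> p ^ 2 + bev \<tau> p = \<tau> + \<tau> ^ (2 ^ n)"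
proof (induction n)
  case 0
  show ?case by (rule exI [of _ 0]) simp
next
  case (Suc n)
  interpret B: rhom "bev \<tau>" by (rule rhom_bev)
  from Suc obtain p where p: "bev \<tau> p ^ 2 + bev \<tau> p = \<tau> + \<tau> ^ (2 ^ n)" by blast
  have xx: "bev \<tau> [:0, 1:] = \<tau>" by (simp add: of_F2_def)
  have "bev \<tau> (p + [:0, 1:] ^ (2 ^ n)) ^ 2 + bev \<tau> (p + [:0, 1:] ^ (2 ^ n))
      = (bev \<tau> p ^ 2 + bev \<tau> p) + ((\<tau> ^ (2 ^ n))^2 + \<tau> ^ (2 ^ n))"
    unfolding B.hom_add B.hom_power xx square_add by (simp add: algebra_simps)
  also have "\<dots> = \<tau> + (\<tau> ^ (2 ^ n))^2" unfolding p by (simp add: algebra_simps)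
  also have "(\<tau> ^ (2 ^ n))^2 = \<tau> ^ (2 ^ Suc n)" by (simp only: power_2pow_Suc)
  finally show ?case by blast
qed

lemma not_norm:
  assumes k: "kpair perfect_closure_F2t q" "kpair perfect_closure_F2t r" "kpair perfect_closure_F2t s"
    and oc: "on_curve tt x y" and inj: "\<And>p. p \<noteq> 0 \<Longrightarrow> hpoly fls_const x p \<noteq> 0"
    and eq: "x * (pev x y q ^ 2 + pev x y q * pev x y r + pev x y r ^ 2) = pev x y s ^ 2"
  shows "q = (0, 0) \<and> r = (0, 0)"
proof -
  define L where "L = [fst q, snd q, fst r, snd r, fst s, snd s]"
  have "\<forall>p\<in>set L. \<exists>n. \<forall>m\<ge>n. kpoly (level m) p"
    using k kpoly_level by (auto simp: L_def kpair_def)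
  then obtain f where f: "\<And>p m. p \<in> set L \<Longrightarrow> m \<ge> f p \<Longrightarrow> kpoly (level m) p" by metis
  define n where "n = Max (f ` set L)"
  have n: "kpoly (level n) p" if "p \<in> set L" for p
    using f [OF that, of n] that by (simp add: n_def)
  obtain \<tau> where \<tau>: "\<tau> ^ (2 ^ n) = tt" using nth_root_exists [of "2 ^ n" tt] by auto
  obtain d where d: "d \<noteq> 0" "\<And>p. p \<in> set L \<Longrightarrow> \<exists>A. Polynomial.smult (bev \<tau> d) p = spec \<tau> A"
    using clear_denominators [OF \<tau>, of L] n by blast
  define D where "D = bev \<tau> d"
  have D0: "D \<noteq> 0" using d(1) bev_eq_0_iff [OF \<tau>] by (simp add: D_def)
  obtain q0 where A1: "Polynomial.smult D (fst q) = spec \<tau> q0" using d(2) [of "fst q"] by (auto simp: D_def L_def)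
  obtain q1 where A2: "Polynomial.smult D (snd q) = spec \<tau> q1" using d(2) [of "snd q"] by (auto simp: D_def L_def)
  obtain r0 where A3: "Polynomial.smult D (fst r) = spec \<tau> r0" using d(2) [of "fst r"] by (auto simp: D_def L_def)
  obtain r1 where A4: "Polynomial.smult D (snd r) = spec \<tau> r1" using d(2) [of "snd r"] by (auto simp: D_def L_def)
  obtain s0 where A5: "Polynomial.smult D (fst s) = spec \<tau> s0" using d(2) [of "fst s"] by (auto simp: D_def L_def)
  obtain s1 where A6: "Polynomial.smult D (snd s) = spec \<tau> s1" using d(2) [of "snd s"] by (auto simp: D_def L_def)
  note A = A1 A2 A3 A4 A5 A6
  obtain \<theta>p where \<theta>p: "bev \<tau> \<theta>p ^ 2 + bev \<tau> \<theta>p = \<tau> + \<tau> ^ (2 ^ n)" using artin_schreier_shift by blast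
  define \<theta> where "\<theta> = bev \<tau> \<theta>p"
  have \<theta>: "\<theta>^2 + \<theta> = \<tau> + tt" using \<theta>p by (simp add: \<theta>_def \<tau>)
  \<comment> \<open>The relation for \<open>\<theta>\<close> changes the parameter of the curve from
    \<open>tt\<close> to \<open>\<tau>\<close>.\<close>
  define y' where "y' = y + x * fls_const \<theta>"
  have oc': "on_curve \<tau> x y'"
  proof -
    have eq\<theta>: "(fls_const \<theta>)^2 + fls_const \<theta> = fls_const \<tau> + fls_const tt"
      using arg_cong [OF \<theta>, of fls_const] by (simp add: fls_hom.hom_simps)
    have "y'^2 + x * y' = (y^2 + x * y) + x^2 * ((fls_const \<theta>)^2 + fls_const \<theta>)"
      by (simp add: y'_def square_add power_mult_distrib algebra_simps power2_eq_square)
    also have "\<dots> = (y^2 + x * y) + x^2 * (fls_const \<tau> + fls_const tt)" by (simp only: eq\<theta>)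
    also have "\<dots> = x^3 + fls_const \<tau> * x^2 + 1"
      using oc by (simp add: on_curve_def algebra_simps)
    finally show ?thesis by (simp add: on_curve_def)
  qed
  interpret S: rhom "spec \<tau>" by (rule rhom_spec)
  interpret h: rhom "hpoly fls_const x" by (rule fls_hom.rhom_hpoly)
  interpret E: rhom "\<lambda>A. hpoly fls_const x (spec \<tau> A)" by (rule rhom_comp [OF h.rhom_axioms S.rhom_axioms])
  let ?E = "\<lambda>A. hpoly fls_const x (spec \<tau> A)"
  define xx where "xx = ([:[:0, 1:]:] :: bit poly poly)"
  define T where "T = ([:0, 1:] :: bit poly poly)"
  define g where "g = xx^3 + T * xx^2 + 1"
  \<comment> \<open>As \<open>y = y' + \<theta> x\<close>, passing from \<open>1, y\<close> to
    \<open>1, y'\<close> adds \<open>\<theta> x b\<close> to the first component.\<close>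
  define sh where "sh a b = a + lift_bpoly \<theta>p * xx * b" for a b
  have EX: "?E xx = x" by (simp add: xx_def bpoly_pCons of_F2_def)
  have ET: "?E T = fls_const \<tau>" by (simp add: T_def bpoly_pCons of_F2_def bpoly_def [symmetric] rhom.hom_1 [OF rhom_bpoly])
  have E\<theta>: "?E (lift_bpoly \<theta>p) = fls_const \<theta>" by (simp add: spec_lift \<theta>_def)
  have yy: "y'^2 = ?E xx * y' + ?E g"
    using on_curve_square [OF oc'] unfolding g_def E.hom_simps EX ET
    by (simp add: power2_eq_square power3_eq_cube algebra_simps)
  have pevE: "fls_const D * pev x y p = ?E (sh a b) + ?E b * y'"
    if "Polynomial.smult D (fst p) = spec \<tau> a" "Polynomial.smult D (snd p) = spec \<tau> b" for p a b
    unfolding sh_def E.hom_simps EX E\<theta> that [symmetric] pev_def fls_hom.hpoly_smult y'_def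
    by (simp add: algebra_simps)
  define q0' where "q0' = sh q0 q1"
  define r0' where "r0' = sh r0 r1"
  define s0' where "s0' = sh s0 s1"
  define I0 where "I0 = xx * (q0'^2 + q1^2 * g + (q0' * r0' + q1 * r1 * g) + (r0'^2 + r1^2 * g)) + (s0'^2 + s1^2 * g)"
  define I1 where "I1 = xx * (q1^2 * xx + (q0' * r1 + q1 * r0' + q1 * r1 * xx) + r1^2 * xx) + s1^2 * xx"
  have scale: "x * ((c * q)^2 + (c * q) * (c * r) + (c * r)^2) + (c * s)^2
      = c^2 * (x * (q^2 + q * r + r^2) + s^2)" for c q r s :: "KK fls"
    by (simp add: power_mult_distrib algebra_simps power2_eq_square)
  \<comment> \<open>Recombined on the branch, the components give the assumed equation times the
    square of the common denominator.\<close>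
  have "?E I0 + ?E I1 * y' = ?E xx * ((?E q0' + ?E q1 * y')^2 + (?E q0' + ?E q1 * y') * (?E r0' + ?E r1 * y') + (?E r0' + ?E r1 * y')^2) + (?E s0' + ?E s1 * y')^2"
    unfolding norm_form_expand [OF yy] I0_def I1_def by (simp only: E.hom_add E.hom_mult E.hom_power)
  also have "\<dots> = (fls_const D)^2 * (x * (pev x y q ^ 2 + pev x y q * pev x y r + pev x y r ^ 2) + pev x y s ^ 2)"
    unfolding q0'_def r0'_def s0'_def pevE [OF A(1,2), symmetric] pevE [OF A(3,4), symmetric] pevE [OF A(5,6), symmetric] EX
    by (rule scale)
  also have "\<dots> = 0" unfolding eq by simp
  finally have "pev x y' (spec \<tau> I0, spec \<tau> I1) = 0" by (simp add: pev_def)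
  from pev_eq_0 [OF oc' inj this] have "I0 = 0" "I1 = 0" using spec_eq_0 [OF \<tau>] by auto
  then have "q0' = 0 \<and> q1 = 0 \<and> r0' = 0 \<and> r1 = 0"
    unfolding I0_def I1_def g_def xx_def T_def by (rule generic_fibre)
  then have "spec \<tau> q0 = 0" "spec \<tau> q1 = 0" "spec \<tau> r0 = 0" "spec \<tau> r1 = 0"
    by (auto simp: q0'_def r0'_def sh_def)
  then show ?thesis using A D0 by (simp add: prod_eq_iff)
qed

lemma perfect_closure_eq_level: "perfect_closure_F2t = (\<Union>n. level n)"
  by (auto simp: perfect_closure_F2t_def level_def)

lemma perfect_set_F2t: "perfect_set perfect_closure_F2t"
proof -
  have pow: "(0::KK) ^ (2 ^ n) = 0" for n by (simp add: zero_power)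
  have common: "\<exists>n u v. a ^ (2 ^ n) = to_ac u \<and> b ^ (2 ^ n) = to_ac v"
    if ab: "a \<in> perfect_closure_F2t" "b \<in> perfect_closure_F2t" for a b
  proof -
    obtain m n where "a \<in> level m" "b \<in> level n" using ab by (auto simp: perfect_closure_eq_level)
    then have "a \<in> level (max m n)" "b \<in> level (max m n)" by (auto elim: level_mono)
    then show ?thesis unfolding level_def by blast
  qed
  have memI: "a \<in> perfect_closure_F2t" if "a ^ (2 ^ n) = to_ac u" for a :: KK and n u
    using that unfolding perfect_closure_F2t_def by blast
  show ?thesis
  proof
    show "0 \<in> perfect_closure_F2t" by (rule memI [of _ 0 0]) simp
    show "1 \<in> perfect_closure_F2t" by (rule memI [of _ 0 1]) simp
    fix a b :: KK assume ab: "a \<in> perfect_closure_F2t"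
    show "- a \<in> perfect_closure_F2t" using ab by simp
    obtain n u where "a ^ (2 ^ n) = to_ac u" using ab unfolding perfect_closure_F2t_def by blast
    then show "inverse a \<in> perfect_closure_F2t"
      by (intro memI [of _ n "inverse u"]) (simp add: power_inverse)
    obtain b where b: "b^2 = a" using sqrt_exists by blast
    from \<open>a ^ (2 ^ n) = to_ac u\<close> have "b ^ (2 ^ Suc n) = to_ac u"
      unfolding b [symmetric] power_2pow_Suc by (simp add: mult.commute flip: power_mult)
    then have "b \<in> perfect_closure_F2t" by (rule memI)
    with b show "\<exists>b\<in>perfect_closure_F2t. b^2 = a" by blast
  next
    fix a b :: KK assume ab: "a \<in> perfect_closure_F2t" "b \<in> perfect_closure_F2t"
    obtain n u v where uv: "a ^ (2 ^ n) = to_ac u" "b ^ (2 ^ n) = to_ac v" using common [OF ab] by blast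
    show "a + b \<in> perfect_closure_F2t"
      by (rule memI [of _ n "u + v"]) (simp add: add_power_2pow uv)
    show "a * b \<in> perfect_closure_F2t"
      by (rule memI [of _ n "u * v"]) (simp add: power_mult_distrib uv)
  qed
qed

interpretation perf: perfect_set perfect_closure_F2t
  by (rule perfect_set_F2t)

lemma tt_mem: "tt \<in> perfect_closure_F2t"
  unfolding perfect_closure_F2t_def tt_def by (rule CollectI, rule exI [of _ 0]) simp

theorem no_tame_function:
  assumes p: "kpair perfect_closure_F2t p0" "kpair perfect_closure_F2t p1"
    and affine: "\<And>x0 x y. affine_at tt x0 x y \<Longrightarrow> pev x y p1 \<noteq> 0 \<and> (\<exists>c0. odd (fls_subdegree (pev x y p0 / pev x y p1 + fls_const c0)))"
    and torsion: "\<And>x y. torsion_at tt x y \<Longrightarrow> pev x y p1 \<noteq> 0 \<and> (\<exists>c0. odd (fls_subdegree (pev x y p0 / pev x y p1 + fls_const c0)))"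
    and infinity: "\<And>x y. infinity_at tt x y \<Longrightarrow> pev x y p1 \<noteq> 0 \<and> (\<exists>c0. odd (fls_subdegree (pev x y p0 / pev x y p1 + fls_const c0)))"
  shows False
proof -
  let ?k = perfect_closure_F2t
  \<comment> \<open>This is the function times the fourth power of \<open>p1\<close>: denominators
    are cleared without disturbing the expansion over fourth powers.\<close>
  define R where "R = pmul tt p0 (pmul tt p1 (pmul tt p1 p1))"
  have "kpair ?k R" unfolding R_def by (intro perf.kpair_pmul tt_mem p)
  then have kR: "kpoly ?k (fst R)" "kpoly ?k (snd R)" by (simp_all add: kpair_def)
  obtain a c q r where k: "kpair ?k a" "kpair ?k c" "kpair ?k q" "kpair ?k r"
    and eq: "\<And>x y. on_curve tt x y \<Longrightarrow> x^4 * pev x y R = pev x y a ^ 4 + pev x y c ^ 4 * x^2 + pev x y q ^ 4 * x + pev x y r ^ 4 * x^3"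
    by (rule perf.fourth_power_decomp [OF tt_mem kR, unfolded prod.collapse], rule that)
  have odd: "\<exists>c0 w. odd (fls_subdegree (pev x y a ^ 4 + pev x y c ^ 4 * x^2 + pev x y q ^ 4 * x + pev x y r ^ 4 * x^3 + fls_const c0 * w^4))"
    if oc: "on_curve tt x y" and x: "x \<noteq> 0" and f: "pev x y p1 \<noteq> 0 \<and> (\<exists>c0. odd (fls_subdegree (pev x y p0 / pev x y p1 + fls_const c0)))" for x y
  proof -
    obtain c0 where c0: "odd (fls_subdegree (pev x y p0 / pev x y p1 + fls_const c0))" using f by blast
    define u where "u = pev x y p0 / pev x y p1 + fls_const c0"
    define w where "w = x * pev x y p1"
    have u0: "u \<noteq> 0" and w0: "w \<noteq> 0" using c0 f x by (auto simp: u_def w_def)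
    have "x^4 * pev x y R + fls_const c0 * w^4 = u * w^4"
      using f by (simp add: R_def pev_pmul [OF oc] u_def w_def field_simps power4_eq_xxxx)
    moreover have "fls_subdegree (u * w^4) = fls_subdegree u + 4 * fls_subdegree w"
      using u0 w0 by (simp add: power4_eq_xxxx)
    ultimately have "odd (fls_subdegree (x^4 * pev x y R + fls_const c0 * w^4))"
      using c0 by (simp add: u_def)
    then show ?thesis unfolding eq [OF oc] by blast
  qed
  have oa: "\<exists>c0 w. odd (fls_subdegree (pev x y a ^ 4 + pev x y c ^ 4 * x^2 + pev x y q ^ 4 * x + pev x y r ^ 4 * x^3 + fls_const c0 * w^4))"
    if "affine_at tt x0 x y" for x0 x y
  proof -
    have "x \<noteq> 0" "on_curve tt x y"
      using affine_at_neq_0 [OF that, of "[:0, 1:]"] that by (auto simp: affine_at_def)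
    then show ?thesis using odd affine [OF that] by blast
  qed
  have ot: "\<exists>c0 w. odd (fls_subdegree (pev x y a ^ 4 + pev x y c ^ 4 * x^2 + pev x y q ^ 4 * x + pev x y r ^ 4 * x^3 + fls_const c0 * w^4))"
    if "torsion_at tt x y" for x y
  proof -
    have "x \<noteq> 0" "on_curve tt x y"
      using torsion_at_neq_0 [OF that, of "[:0, 1:]"] that by (auto simp: torsion_at_def)
    then show ?thesis using odd torsion [OF that] by blast
  qed
  have oi: "\<exists>c0 w. odd (fls_subdegree (pev x y a ^ 4 + pev x y c ^ 4 * x^2 + pev x y q ^ 4 * x + pev x y r ^ 4 * x^3 + fls_const c0 * w^4))"
    if "infinity_at tt x y" for x y
  proof -
    have "x \<noteq> 0" "on_curve tt x y"
      using infinity_at_subdegree [OF that, of "[:0, 1:]"] that by (auto simp: infinity_at_def)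
    then show ?thesis using odd infinity [OF that] by blast
  qed
  obtain x y where xy: "torsion_at tt x y" using ex_torsion by blast
  then have oc: "on_curve tt x y" by (auto simp: torsion_at_def)
  have nontriv: "q \<noteq> (0, 0) \<or> r \<noteq> (0, 0)"
    by (rule tame_global_nontrivial' [where t = tt]) (erule oa ot oi | assumption)+
  let ?X = "([:0, 1:], 0) :: KK poly \<times> KK poly"
  define r' where "r' = pmul tt ?X r"
  define s where "s = pmul tt ?X (padd c (padd q r))"
  have kX: "kpair ?k ?X" by (simp add: kpair_def perf.kpoly_pCons_iff)
  have k': "kpair ?k r'" "kpair ?k s"
    unfolding r'_def s_def by (intro perf.kpair_pmul perf.kpair_padd tt_mem kX k)+
  have pX: "pev x y ?X = x" by (simp add: pev_def)
  have r': "pev x y r' = x * pev x y r" and s: "pev x y s = x * (pev x y c + pev x y q + pev x y r)"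
    by (simp_all add: r'_def s_def pev_pmul [OF oc] pev_padd pX algebra_simps)
  have key: "x * (pev x y c ^ 2 + pev x y q * pev x y r) = (x + 1) * (pev x y q ^ 2 + pev x y r ^ 2 * x)"
    by (rule tame_global' [where t = tt, OF _ _ _ _ oc]) (erule oa ot oi | assumption)+
  \<comment> \<open>Once \<open>x^2 c^2\<close> is replaced by means of the relation, the terms
    \<open>x^2 q^2\<close> and \<open>x^2 r^2\<close> cancel and the norm form is left.\<close>
  have "pev x y s ^ 2 = x * (x * (pev x y c ^ 2 + pev x y q * pev x y r)) + x^2 * pev x y q * pev x y r + x^2 * pev x y q ^ 2 + x^2 * pev x y r ^ 2"
    by (simp add: s square_add power_mult_distrib power2_eq_square algebra_simps)
  also have "\<dots> = x * (pev x y q ^ 2 + pev x y q * pev x y r' + pev x y r' ^ 2)"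
    unfolding key r' by (simp add: power2_eq_square algebra_simps)
  finally have "q = (0, 0) \<and> r' = (0, 0)"
    using not_norm [OF k(3) k' oc torsion_at_neq_0 [OF xy]] by metis
  moreover have "r = (0, 0)"
  proof (rule pev_eq_0 [OF oc torsion_at_neq_0 [OF xy]])
    have "x \<noteq> 0" using xy by (auto simp: torsion_at_def)
    moreover have "x * pev x y r = 0" using calculation r' \<open>q = (0, 0) \<and> r' = (0, 0)\<close> by (simp add: pev_def)
    ultimately show "pev x y r = 0" by simp
  qed
  ultimately show False using nontriv by blast
qed

section \<open>The function field of a hypersurface\<close>

lemma UNIV_3: "(UNIV :: 3 set) = {0, 1, 2}"
proof -
  have "card {0, 1, 2 :: 3} = 3" by simp
  moreover have "CARD(3) = 3" by simp
  ultimately show ?thesis by (metis card_subset_eq finite subset_UNIV)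
qed

lemma UNIV_2: "(UNIV :: 2 set) = {0, 1}"
proof -
  have "card {0, 1 :: 2} = 2" by simp
  moreover have "CARD(2) = 2" by simp
  ultimately show ?thesis by (metis card_subset_eq finite subset_UNIV)
qed

lemma distinct_3 [simp]: "(0::3) \<noteq> 1" "(1::3) \<noteq> 0" "(0::3) \<noteq> 2" "(2::3) \<noteq> 0" "(1::3) \<noteq> 2" "(2::3) \<noteq> 1"
  by simp_all

lemma exhaust_3: "i = 0 \<or> i = 1 \<or> i = 2" for i :: 3
  using UNIV_3 by blast

lemma prod_3: "(\<Prod>i\<in>UNIV. f i) = f (0::3) * f 1 * f 2" for f :: "3 \<Rightarrow> 'a::comm_monoid_mult"
  unfolding UNIV_3 by (simp add: mult.assoc)

lemma sum_3: "(\<Sum>i\<in>UNIV. f i) = f (0::3) + f 1 + f 2" for f :: "3 \<Rightarrow> 'a::comm_monoid_add"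
  unfolding UNIV_3 by (simp add: add.assoc)

abbreviation Fw :: "'a \<Rightarrow> (3, 'a::field) mpoly" where
  "Fw t \<equiv> weierstrass 1 t 0 0 1"

lemma peval_weierstrass:
  fixes \<phi> :: "'a::field \<Rightarrow> 'b::comm_ring_1"
  assumes "rhom \<phi>"
  shows "peval \<phi> v (weierstrass a1 a2 a3 a4 a6) = v 1 ^ 2 * v 2 + \<phi> a1 * v 0 * v 1 * v 2 + \<phi> a3 * v 1 * v 2 ^ 2
     - (v 0 ^ 3 + \<phi> a2 * v 0 ^ 2 * v 2 + \<phi> a4 * v 0 * v 2 ^ 2 + \<phi> a6 * v 2 ^ 3)"
proof -
  interpret \<phi>: rhom \<phi> by fact
  interpret p: rhom "peval \<phi> v :: (3, 'a) mpoly \<Rightarrow> 'b" by (rule \<phi>.rhom_peval)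
  show ?thesis unfolding weierstrass_def Let_def p.hom_simps \<phi>.peval_mvar \<phi>.peval_mconst ..
qed

text \<open>
  \<open>E\<close> evaluates forms on a generic point of the hypersurface. It induces an embedding \<open>\<Phi>\<close> of the function
  field into \<open>'S\<close>.
\<close>

locale fn_field = subfield_set k + E: rhom E
  for k :: "'K::field set" and F :: "('v::{finite,linorder}, 'K) mpoly" and E :: "('v, 'K) mpoly \<Rightarrow> 'S::field" +
  assumes E_eq_0_iff: "form UNIV d A \<Longrightarrow> E A = 0 \<longleftrightarrow> F dvd A"
begin

definition fracs :: "('v, 'K) mpoly \<Rightarrow> ('v, 'K) mpoly \<Rightarrow> bool" where
  "fracs A B \<longleftrightarrow> (\<exists>d. form k d A \<and> form k d B) \<and> \<not> F dvd B"

lemma fracs_E: "fracs A B \<Longrightarrow> E B \<noteq> 0"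
  unfolding fracs_def using E_eq_0_iff form_UNIV by blast

lemma fracs_dvd_iff: "fracs A B \<Longrightarrow> F dvd A \<longleftrightarrow> E A = 0"
  unfolding fracs_def using E_eq_0_iff form_UNIV by blast

lemma fracs_neq_0: "fracs A B \<Longrightarrow> B \<noteq> 0"
  by (auto simp: fracs_def)

lemma fracsI: "form k d A \<Longrightarrow> form k d B \<Longrightarrow> E B \<noteq> 0 \<Longrightarrow> fracs A B"
  unfolding fracs_def using E_eq_0_iff form_UNIV by blast

lemma fracs_mult: "fracs A B \<Longrightarrow> fracs C D \<Longrightarrow> fracs (A * C) (B * D)"
proof -
  assume AB: "fracs A B" and CD: "fracs C D"
  then obtain d e where "form k d A" "form k d B" "form k e C" "form k e D" by (auto simp: fracs_def)
  then have "form k (d + e) (A * C)" "form k (d + e) (B * D)" by (simp_all add: form_mult)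
  then show ?thesis using fracs_E [OF AB] fracs_E [OF CD] by (intro fracsI) (simp_all add: E.hom_mult)
qed

lemma fracs_add: "fracs A B \<Longrightarrow> fracs C D \<Longrightarrow> fracs (A * D + C * B) (B * D)"
proof -
  assume AB: "fracs A B" and CD: "fracs C D"
  then obtain d e where de: "form k d A" "form k d B" "form k e C" "form k e D" by (auto simp: fracs_def)
  have "form k (d + e) (A * D)" "form k (e + d) (C * B)" "form k (d + e) (B * D)"
    using de by (simp_all only: form_mult)
  then show ?thesis using fracs_E [OF AB] fracs_E [OF CD]
    by (intro fracsI [of "d + e"]) (simp_all add: E.hom_mult form_add add.commute)
qed

lemma fracs_uminus: "fracs A B \<Longrightarrow> fracs (- A) B"
  unfolding fracs_def using form_uminus by blast

lemma fracs_1: "fracs 1 1" and fracs_0: "fracs 0 1"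
  by (rule fracsI [of 0]; simp add: form_1 E.hom_1)+

abbreviation "R \<equiv> fraction_ring k F"
abbreviation "L \<equiv> function_field k F"

lemma carrier_R: "carrier R = {Fract A B | A B. fracs A B}"
  by (auto simp: fraction_ring_def fracs_def)

lemma R_simps [simp]: "monoid.mult R = (*)" "one R = 1" "ring.zero R = 0" "add R = (+)"
  by (simp_all add: fraction_ring_def)

lemma cring_R: "cring R"
proof (rule cringI)
  show "abelian_group R"
  proof (rule abelian_groupI)
    fix x y assume "x \<in> carrier R" "y \<in> carrier R"
    then show "x \<oplus>\<^bsub>R\<^esub> y \<in> carrier R"
      using fracs_add fracs_neq_0 by (fastforce simp: carrier_R add_fract)
  next
    show "\<zero>\<^bsub>R\<^esub> \<in> carrier R" using fracs_0 by (auto simp: carrier_R Zero_fract_def)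
  next
    fix x assume "x \<in> carrier R"
    then obtain A B where x: "x = Fract A B" "fracs A B" by (auto simp: carrier_R)
    then have "- x \<in> carrier R" using fracs_uminus by (auto simp: carrier_R)
    then show "\<exists>y\<in>carrier R. y \<oplus>\<^bsub>R\<^esub> x = \<zero>\<^bsub>R\<^esub>" by (intro bexI [of _ "- x"]) simp_all
  qed (simp_all add: algebra_simps)
  show "comm_monoid R"
  proof (rule comm_monoidI)
    fix x y assume "x \<in> carrier R" "y \<in> carrier R"
    then show "x \<otimes>\<^bsub>R\<^esub> y \<in> carrier R"
      using fracs_mult by (fastforce simp: carrier_R)
  next
    show "\<one>\<^bsub>R\<^esub> \<in> carrier R" using fracs_1 by (auto simp: carrier_R One_fract_def)
  qed (simp_all add: algebra_simps)
qed (simp add: algebra_simps)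

text \<open>An element of \<open>fract\<close> has many representations by forms, hence
  \<open>THE\<close>; independence is shown in \<open>val_Fract\<close>.\<close>

definition val :: "('v, 'K) mpoly fract \<Rightarrow> 'S" where
  "val z = (THE w. \<exists>A B. fracs A B \<and> z = Fract A B \<and> w = E A / E B)"

lemma val_Fract:
  assumes "fracs A B"
  shows "val (Fract A B) = E A / E B"
  unfolding val_def
proof (rule the_equality)
  fix w assume "\<exists>A' B'. fracs A' B' \<and> Fract A B = Fract A' B' \<and> w = E A' / E B'"
  then obtain A' B' where *: "fracs A' B'" "Fract A B = Fract A' B'" "w = E A' / E B'" by blast
  then have "A * B' = A' * B" using assms fracs_neq_0 by (simp add: eq_fract)
  then have "E A * E B' = E A' * E B" by (simp flip: E.hom_mult)
  then show "w = E A / E B"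
    unfolding *(3) by (simp add: frac_eq_eq [OF fracs_E [OF *(1)] fracs_E [OF assms]])
qed (use assms in blast)

abbreviation "T \<equiv> (ring_of_type_algebra :: 'S ring)"

lemma T_simps [simp]: "carrier T = UNIV" "monoid.mult T = (*)" "one T = 1" "ring.zero T = 0" "add T = (+)"
  by (simp_all add: ring_of_type_algebra_def)

lemma val_hom: "ring_hom_ring R T val"
proof (rule ring_hom_ringI)
  show "ring R" using cring_R by (simp add: cring_def)
  show "ring T" by (rule ring_from_type_algebra)
  show "val x \<in> carrier T" for x by simp
  show "val \<one>\<^bsub>R\<^esub> = \<one>\<^bsub>T\<^esub>"
    using val_Fract [OF fracs_1] by (simp add: One_fract_def E.hom_1)
next
  fix x y assume "x \<in> carrier R" "y \<in> carrier R"
  then obtain A B C D where xy: "x = Fract A B" "fracs A B" "y = Fract C D" "fracs C D"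
    by (auto simp: carrier_R)
  show "val (x \<otimes>\<^bsub>R\<^esub> y) = val x \<otimes>\<^bsub>T\<^esub> val y"
    using val_Fract [OF fracs_mult [OF xy(2,4)]] by (simp add: xy val_Fract E.hom_mult)
  show "val (x \<oplus>\<^bsub>R\<^esub> y) = val x \<oplus>\<^bsub>T\<^esub> val y"
    using val_Fract [OF fracs_add [OF xy(2,4)]] fracs_E [OF xy(2)] fracs_E [OF xy(4)] xy(2,4)
      fracs_neq_0 [OF xy(2)] fracs_neq_0 [OF xy(4)]
    by (simp add: xy val_Fract E.hom_mult E.hom_add add_fract add_frac_eq)
qed

text \<open>This makes \<open>function_field\<close> the quotient by a kernel, so that the
  isomorphism theorem provides the injective \<open>\<Phi>\<close>.\<close>

lemma kernel_val: "a_kernel R T val = fraction_ideal k F"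
proof -
  have "val (Fract A B) = 0 \<longleftrightarrow> F dvd A" if "fracs A B" for A B
    using val_Fract [OF that] fracs_E [OF that] fracs_dvd_iff [OF that] by simp
  then have "{z \<in> carrier R. val z = 0} = {Fract A B | A B. fracs A B \<and> F dvd A}"
    unfolding carrier_R by blast
  also have "\<dots> = fraction_ideal k F"
    unfolding fraction_ideal_def fracs_def by blast
  finally show ?thesis unfolding a_kernel_def' by simp
qed

definition \<Phi> :: "('v, 'K) mpoly fract set \<Rightarrow> 'S" where
  "\<Phi> = (\<lambda>z. the_elem (val ` z))"

lemma L_eq: "L = R Quot (a_kernel R T val)"
  by (simp add: function_field_def kernel_val)

lemma ring_L: "ring L"
  unfolding L_eq by (rule ideal.quotient_is_ring [OF ring_hom_ring.kernel_is_ideal [OF val_hom]])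

lemma cring_L: "cring L"
  unfolding L_eq by (rule ideal.quotient_is_cring [OF ring_hom_ring.kernel_is_ideal [OF val_hom] cring_R])

lemma Phi_rat:
  assumes "fracs A B"
  shows "\<Phi> (rat k F A B) = E A / E B"
  unfolding \<Phi>_def rat_def kernel_val [symmetric]
  using ring_hom_ring.the_elem_simp [OF val_hom, of "Fract A B"] assms val_Fract [OF assms]
  by (auto simp: carrier_R)

lemma carrier_L: "carrier L = {rat k F A B | A B. fracs A B}"
proof
  show "carrier L \<subseteq> {rat k F A B | A B. fracs A B}"
    using ring_hom_ring.quot_mem [OF val_hom] unfolding L_eq rat_def kernel_val by (fastforce simp: carrier_R)
  show "{rat k F A B | A B. fracs A B} \<subseteq> carrier L"
  proof safe
    fix A B assume "fracs A B"
    then have "Fract A B \<in> carrier R" by (auto simp: carrier_R)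
    then show "rat k F A B \<in> carrier L"
      unfolding L_eq rat_def kernel_val [symmetric] FactRing_def A_RCOSETS_def' by auto
  qed
qed

lemma rat_mem: "fracs A B \<Longrightarrow> rat k F A B \<in> carrier L"
  by (auto simp: carrier_L)

lemma Phi_inj: "x \<in> carrier L \<Longrightarrow> y \<in> carrier L \<Longrightarrow> \<Phi> x = \<Phi> y \<Longrightarrow> x = y"
  unfolding \<Phi>_def L_eq by (rule ring_hom_ring.the_elem_inj [OF val_hom])

lemma Phi_hom: "\<Phi> \<in> ring_hom L T"
  unfolding \<Phi>_def L_eq by (rule ring_hom_ring.the_elem_hom [OF val_hom])

lemma Phi_mult: "x \<in> carrier L \<Longrightarrow> y \<in> carrier L \<Longrightarrow> \<Phi> (x \<otimes>\<^bsub>L\<^esub> y) = \<Phi> x * \<Phi> y"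
  and Phi_add: "x \<in> carrier L \<Longrightarrow> y \<in> carrier L \<Longrightarrow> \<Phi> (x \<oplus>\<^bsub>L\<^esub> y) = \<Phi> x + \<Phi> y"
  and Phi_one: "\<Phi> \<one>\<^bsub>L\<^esub> = 1"
  using Phi_hom by (auto simp: ring_hom_def)

lemma Phi_zero: "\<Phi> \<zero>\<^bsub>L\<^esub> = 0"
proof -
  interpret L: ring L by (rule ring_L)
  have "\<Phi> (\<zero>\<^bsub>L\<^esub> \<oplus>\<^bsub>L\<^esub> \<zero>\<^bsub>L\<^esub>) = \<Phi> \<zero>\<^bsub>L\<^esub> + \<Phi> \<zero>\<^bsub>L\<^esub>" by (rule Phi_add) simp_all
  then have "\<Phi> \<zero>\<^bsub>L\<^esub> + 0 = \<Phi> \<zero>\<^bsub>L\<^esub> + \<Phi> \<zero>\<^bsub>L\<^esub>" by simp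
  then show ?thesis by (simp only: add_left_cancel)
qed

lemma rat_eq_iff: "fracs A B \<Longrightarrow> fracs C D \<Longrightarrow> rat k F A B = rat k F C D \<longleftrightarrow> E A / E B = E C / E D"
  using Phi_inj [OF rat_mem rat_mem, of A B C D] by (auto simp flip: Phi_rat)

lemma inverse_mem_L:
  assumes "x \<in> carrier L" "\<Phi> x \<noteq> 0"
  shows "\<exists>y\<in>carrier L. \<Phi> y = inverse (\<Phi> x)"
proof -
  obtain A B where AB: "x = rat k F A B" "fracs A B" using assms by (auto simp: carrier_L)
  then have "E A \<noteq> 0" using assms Phi_rat by force
  then have "fracs B A" using AB(2) fracsI unfolding fracs_def by blast
  then show ?thesis using Phi_rat rat_mem AB by (intro bexI [of _ "rat k F B A"]) simp_all
qed

end

section \<open>Local rings of the curve\<close>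

text \<open>A generic point of the curve in homogeneous Laurent series coordinates; the last
  condition says that its \<open>x\<close> is transcendental.\<close>

definition cv :: "'a::field \<Rightarrow> (3 \<Rightarrow> 'a fls) \<Rightarrow> bool" where
  "cv t v \<longleftrightarrow> v 2 \<noteq> 0 \<and> on_curve t (v 0 / v 2) (v 1 / v 2) \<and> (\<forall>p. p \<noteq> 0 \<longrightarrow> hpoly fls_const (v 0 / v 2) p \<noteq> 0)"

text \<open>The link between homogeneous forms and pairs. One pair serves all branches at once, and
  its coefficients stay in \<open>k\<close>.\<close>

lemma form_reduce:
  fixes t :: "'K::{field,char2}" and A :: "(3, 'K) mpoly"
  assumes k: "subfield_set k" and "form k d A" and t: "t \<in> k"
  shows "\<exists>p. kpair k p \<and> (\<forall>v. v 2 \<noteq> 0 \<and> on_curve t (v 0 / v 2) (v 1 / v 2) \<longrightarrow>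
    peval fls_const v A = v 2 ^ d * pev (v 0 / v 2) (v 1 / v 2) p)"
proof -
  interpret subfield_set k by (rule k)
  show ?thesis using assms(2)
proof (induction rule: form_induct)
  case (zero d)
  show ?case by (rule exI [of _ "(0, 0)"]) (simp add: kpair_def pev_def)
next
  case (const c)
  then show ?case
    by (intro exI [of _ "([:c:], 0)"]) (simp add: kpair_def pev_def kpoly_pCons_iff)
next
  case (add d A B)
  then obtain p q where "kpair k p" "kpair k q"
    "\<And>v. v 2 \<noteq> 0 \<and> on_curve t (v 0 / v 2) (v 1 / v 2) \<Longrightarrow> peval fls_const v A = v 2 ^ d * pev (v 0 / v 2) (v 1 / v 2) p"
    "\<And>v. v 2 \<noteq> 0 \<and> on_curve t (v 0 / v 2) (v 1 / v 2) \<Longrightarrow> peval fls_const v B = v 2 ^ d * pev (v 0 / v 2) (v 1 / v 2) q"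
    by blast
  then show ?case
    by (intro exI [of _ "padd p q"]) (simp add: kpair_padd pev_padd fls_hom.peval_add distrib_left)
next
  case (var d i A)
  then obtain p where p: "kpair k p"
    "\<And>v. v 2 \<noteq> 0 \<and> on_curve t (v 0 / v 2) (v 1 / v 2) \<Longrightarrow> peval fls_const v A = v 2 ^ d * pev (v 0 / v 2) (v 1 / v 2) p"
    by blast
  define m :: "'K poly \<times> 'K poly" where "m = (if i = 0 then ([:0, 1:], 0) else if i = 1 then (0, 1) else (1, 0))"
  have m: "kpair k m" by (simp add: m_def kpair_def kpoly_pCons_iff)
  have "pev (v 0 / v 2) (v 1 / v 2) m = v i / v 2" if "v 2 \<noteq> 0" for v
    using exhaust_3 [of i] that by (auto simp: m_def pev_def)
  then show ?case using p m
    by (intro exI [of _ "pmul t m p"]) (auto simp: kpair_pmul t pev_pmul fls_hom.peval_mult)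
qed
qed

context
  fixes t :: "'a::{alg_closed_field,char2}"
begin

text \<open>Vanishing is decided by the reduced pair, which does not depend on the generic
  point.\<close>

lemma cv_vanish:
  assumes "cv t v" "cv t v'" "form UNIV d A" "peval fls_const v A = 0"
  shows "peval fls_const v' A = 0"
proof -
  obtain p where p: "\<And>v. v 2 \<noteq> 0 \<and> on_curve t (v 0 / v 2) (v 1 / v 2) \<Longrightarrow> peval fls_const v A = v 2 ^ d * pev (v 0 / v 2) (v 1 / v 2) p"
    using form_reduce [OF subfield_set_UNIV assms(3), of t] by blast
  have "pev (v 0 / v 2) (v 1 / v 2) p = 0"
    using p [of v] assms(1,4) by (auto simp: cv_def)
  then have "p = (0, 0)" using assms(1) by (intro pev_eq_0 [of t]) (auto simp: cv_def)
  then show ?thesis using p [of v'] assms(2) by (auto simp: cv_def pev_def)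
qed

lemma peval_Fw:
  assumes "cv t v"
  shows "peval fls_const v (Fw t) = 0"
proof -
  have v2: "v 2 \<noteq> 0" and "on_curve t (v 0 / v 2) (v 1 / v 2)" using assms by (auto simp: cv_def)
  then have "(v 1 / v 2)^2 + v 0 / v 2 * (v 1 / v 2) + ((v 0 / v 2)^3 + fls_const t * (v 0 / v 2)^2 + 1) = 0"
    by (simp add: on_curve_def)
  then have "v 2 ^ 3 * ((v 1 / v 2)^2 + v 0 / v 2 * (v 1 / v 2) + ((v 0 / v 2)^3 + fls_const t * (v 0 / v 2)^2 + 1)) = 0"
    by (simp only: mult_zero_right)
  moreover have "peval fls_const v (Fw t) = v 2 ^ 3 * ((v 1 / v 2)^2 + v 0 / v 2 * (v 1 / v 2) + ((v 0 / v 2)^3 + fls_const t * (v 0 / v 2)^2 + 1))"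
    using v2 by (simp add: peval_weierstrass [OF rhom_fls_const] field_simps power2_eq_square power3_eq_cube)
  ultimately show ?thesis by simp
qed

definition rem_index :: "nat \<Rightarrow> (nat \<times> nat) set" where
  "rem_index d = {(i, j). i < 3 \<and> i + j \<le> d}"

lemma finite_rem_index: "finite (rem_index d)"
  by (rule finite_subset [of _ "{..<3} \<times> {..d}"]) (auto simp: rem_index_def)

definition rem_form :: "nat \<Rightarrow> (nat \<times> nat \<Rightarrow> 'a) \<Rightarrow> (3, 'a) mpoly" where
  "rem_form d c = (\<Sum>(i, j)\<in>rem_index d. mconst (c (i, j)) * (mvar 0 ^ i * mvar 1 ^ j * mvar 2 ^ (d - i - j)))"

definition has_rem :: "nat \<Rightarrow> (3, 'a) mpoly \<Rightarrow> bool" where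
  "has_rem d A \<longleftrightarrow> (\<exists>H c. A = Fw t * H + rem_form d c)"

text \<open>
  Division with remainder by \<open>Fw t\<close>, which is monic and cubic in the first variable.
\<close>

lemma has_rem_add: "has_rem d A \<Longrightarrow> has_rem d B \<Longrightarrow> has_rem d (A + B)"
proof -
  assume "has_rem d A" "has_rem d B"
  then obtain H c H' c' where "A = Fw t * H + rem_form d c" "B = Fw t * H' + rem_form d c'"
    unfolding has_rem_def by blast
  moreover have "rem_form d (\<lambda>x. c x + c' x) = rem_form d c + rem_form d c'"
    unfolding rem_form_def sum.distrib [symmetric]
    by (rule sum.cong) (auto simp: rhom.hom_add [OF rhom_mconst] distrib_right)
  ultimately show ?thesis unfolding has_rem_def
    by (intro exI [of _ "H + H'"] exI [of _ "\<lambda>x. c x + c' x"]) (simp add: algebra_simps)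
qed

lemma has_rem_smult: "has_rem d A \<Longrightarrow> has_rem d (mconst a * A)"
proof -
  assume "has_rem d A"
  then obtain H c where "A = Fw t * H + rem_form d c" unfolding has_rem_def by blast
  moreover have "rem_form d (\<lambda>x. a * c x) = mconst a * rem_form d c"
    unfolding rem_form_def sum_distrib_left
    by (rule sum.cong) (auto simp: rhom.hom_mult [OF rhom_mconst] mult.assoc)
  ultimately show ?thesis unfolding has_rem_def
    by (intro exI [of _ "mconst a * H"] exI [of _ "\<lambda>x. a * c x"]) (simp add: algebra_simps)
qed

lemma has_rem_0: "has_rem d 0"
  unfolding has_rem_def by (intro exI [of _ 0] exI [of _ "\<lambda>_. 0"]) (simp add: rem_form_def case_prod_beta)

lemma has_rem_ideal: "has_rem d (Fw t * H)"
  unfolding has_rem_def by (intro exI [of _ H] exI [of _ "\<lambda>_. 0"]) (simp add: rem_form_def case_prod_beta)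

lemma has_rem_monomial: "a + b + e = d \<Longrightarrow> has_rem d (mvar 0 ^ a * mvar 1 ^ b * mvar 2 ^ e)"
proof (induction a arbitrary: b e rule: less_induct)
  case (less a)
  show ?case
  proof (cases "a < 3")
    case True
    have in_index: "(a, b) \<in> rem_index d" using less.prems True by (simp add: rem_index_def)
    have e: "e = d - a - b" using less.prems by simp
    have "rem_form d (\<lambda>x. if x = (a, b) then 1 else 0)
        = (\<Sum>x\<in>rem_index d. if x = (a, b) then mvar 0 ^ a * mvar 1 ^ b * mvar 2 ^ e else 0)"
      unfolding rem_form_def case_prod_beta prod.collapse
    proof (rule sum.cong)
      fix x
      show "mconst (if x = (a, b) then 1 else 0) * (mvar 0 ^ fst x * mvar 1 ^ snd x * mvar 2 ^ (d - fst x - snd x))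
          = (if x = (a, b) then mvar 0 ^ a * mvar 1 ^ b * mvar 2 ^ e else 0 :: (3, 'a) mpoly)"
        by (cases "x = (a, b)") (simp_all only: e if_True if_False refl mconst_0 mconst_1 fst_conv snd_conv mult_1_left mult_zero_left)
    qed simp
    also have "\<dots> = mvar 0 ^ a * mvar 1 ^ b * mvar 2 ^ e"
      using in_index finite_rem_index by simp
    finally show ?thesis unfolding has_rem_def
      by (intro exI [of _ 0] exI [of _ "\<lambda>x. if x = (a, b) then 1 else 0"]) simp
  next
    case False
    define a' where "a' = a - 3"
    then have a: "a = a' + 3" using False by simp
    let ?x = "mvar 0 :: (3, 'a) mpoly" and ?y = "mvar 1 :: (3, 'a) mpoly" and ?z = "mvar 2 :: (3, 'a) mpoly"
    let ?m = "?x ^ a' * ?y ^ b * ?z ^ e"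
    \<comment> \<open>Modulo \<open>Fw t\<close> this replaces \<open>x^3\<close> by monomials with
      smaller powers of \<open>x\<close>, open to the induction hypothesis.\<close>
    have "?x ^ 3 = Fw t + ?y^2 * ?z + ?x * ?y * ?z + mconst t * ?x^2 * ?z + ?z^3"
      by (simp add: weierstrass_def Let_def algebra_simps)
    then have m: "?m * ?x ^ 3 = ?m * (Fw t + ?y^2 * ?z + ?x * ?y * ?z + mconst t * ?x^2 * ?z + ?z^3)"
      by (simp only:)
    have "?x ^ a * ?y ^ b * ?z ^ e = ?m * ?x ^ 3"
      unfolding a power_add by (simp only: mult.assoc mult.commute mult.left_commute)
    also have "\<dots> = Fw t * ?m + ?x ^ a' * ?y ^ (b + 2) * ?z ^ (e + 1) + ?x ^ (a' + 1) * ?y ^ (b + 1) * ?z ^ (e + 1)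
       + mconst t * (?x ^ (a' + 2) * ?y ^ b * ?z ^ (e + 1)) + ?x ^ a' * ?y ^ b * ?z ^ (e + 3)"
      unfolding m power_add power_one_right by (simp only: algebra_simps)
    also have "has_rem d \<dots>"
      using less.prems a by (intro has_rem_add has_rem_smult has_rem_ideal less.IH) simp_all
    finally show ?thesis .
  qed
qed

lemma form_has_rem:
  assumes "form UNIV d A"
  shows "has_rem d A"
  using assms
proof (induction rule: form_monomial_induct)
  case (single m c)
  have "Poly_Mapping.lookup m 0 + Poly_Mapping.lookup m 1 + Poly_Mapping.lookup m 2 = d"
    using single unfolding mdeg_def sum_3 by (simp only:)
  then show ?case
    unfolding single_conv_monomial prod_3 by (intro has_rem_smult has_rem_monomial)
qed (simp_all add: has_rem_0 has_rem_add)

end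

lemma fls_nth_sum: "(\<Sum>i\<in>S. f i) $$ n = (\<Sum>i\<in>S. f i $$ n)" for f :: "'i \<Rightarrow> 'a::comm_monoid_add fls"
  by (induction S rule: infinite_finite_induct) simp_all

lemma fls_subdegree_power: "f \<noteq> 0 \<Longrightarrow> fls_subdegree (f ^ n) = int n * fls_subdegree f" for f :: "'a::field fls"
  by (induction n) (simp_all add: algebra_simps)

text \<open>A nonzero term of least order would survive in the sum.\<close>

lemma fls_sum_distinct_eq_0:
  fixes g :: "'i \<Rightarrow> 'a::field fls"
  assumes "finite S" and g: "\<And>i. i \<in> S \<Longrightarrow> g i \<noteq> 0" "inj_on (\<lambda>i. fls_subdegree (g i)) S"
    and sum: "(\<Sum>i\<in>S. fls_const (c i) * g i) = 0"
  shows "\<forall>i\<in>S. c i = 0"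
proof (rule ccontr)
  assume neg: "\<not> ?thesis"
  define V where "V = {i \<in> S. c i \<noteq> 0}"
  have V: "finite V" "V \<noteq> {}" "V \<subseteq> S" using assms(1) neg by (auto simp: V_def)
  define i where "i = arg_min_on (\<lambda>i. fls_subdegree (g i)) V"
  have i: "i \<in> V" and min: "\<And>j. j \<in> V \<Longrightarrow> fls_subdegree (g i) \<le> fls_subdegree (g j)"
    unfolding i_def by (rule arg_min_if_finite(1) [OF V(1,2)], rule arg_min_least [OF V(1,2)])
  let ?n = "fls_subdegree (g i)"
  have "(\<Sum>j\<in>S. fls_const (c j) * g j) = (\<Sum>j\<in>V. fls_const (c j) * g j)"
    using V assms(1) by (intro sum.mono_neutral_right) (auto simp: V_def)
  then have "0 = (\<Sum>j\<in>V. fls_const (c j) * g j) $$ ?n" using sum by simp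
  also have "\<dots> = (\<Sum>j\<in>V. c j * g j $$ ?n)" by (simp add: fls_nth_sum)
  also have "\<dots> = (\<Sum>j\<in>V. if j = i then c i * g i $$ ?n else 0)"
  proof (rule sum.cong)
    fix j assume j: "j \<in> V"
    have "?n < fls_subdegree (g j)" if "j \<noteq> i"
      using min [OF j] g(2) j i V(3) that by (auto simp: inj_on_def less_le)
    then show "c j * g j $$ ?n = (if j = i then c i * g i $$ ?n else 0)" by auto
  qed simp
  also have "\<dots> = c i * g i $$ ?n" using V i by simp
  also have "\<dots> \<noteq> 0" using i g(1) V(3) by (auto simp: V_def)
  finally show False by simp
qed

context
  fixes t :: "'a::{alg_closed_field,char2}"
begin

text \<open>
  The monomials that occur in a remainder have pairwise distinct orders at infinity.
\<close>

lemma infinity_dvd: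
  assumes z: "z \<noteq> 0" "fls_subdegree z = 3" and A: "form UNIV d A"
    and v: "v = (\<lambda>i::3. if i = 0 then fls_X else if i = 1 then 1 else z)"
    and cv: "cv t v" and 0: "peval fls_const v A = 0"
  shows "Fw t dvd A"
proof -
  interpret p: rhom "peval fls_const v :: (3, 'a) mpoly \<Rightarrow> 'a fls" by (rule fls_hom.rhom_peval)
  obtain H c where A: "A = Fw t * H + rem_form d c" using form_has_rem [OF A] unfolding has_rem_def by blast
  have "peval fls_const v (rem_form d c) = 0"
    using 0 by (simp add: A p.hom_simps peval_Fw [OF cv])
  then have "(\<Sum>x\<in>rem_index d. fls_const (c x) * (fls_X ^ fst x * z ^ (d - fst x - snd x))) = 0"
    unfolding rem_form_def case_prod_beta p.hom_simps fls_hom.peval_mvar fls_hom.peval_mconst by (simp add: v)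
  moreover have "inj_on (\<lambda>x. fls_subdegree (fls_X ^ fst x * z ^ (d - fst x - snd x) :: 'a fls)) (rem_index d)"
  proof (rule inj_onI, clarify)
    fix i j i' j' assume ij: "(i, j) \<in> rem_index d" "(i', j') \<in> rem_index d"
      and "fls_subdegree (fls_X ^ fst (i, j) * z ^ (d - fst (i, j) - snd (i, j))) =
        fls_subdegree (fls_X ^ fst (i', j') * z ^ (d - fst (i', j') - snd (i', j')))"
    then have "int i + int (d - (i + j)) * 3 = int i' + int (d - (i' + j')) * 3"
      using z by (simp add: fls_subdegree_power)
    moreover have "i < 3" "i + j \<le> d" "i' < 3" "i' + j' \<le> d" using ij by (auto simp: rem_index_def)
    \<comment> \<open>Reduction modulo 3 determines \<open>i\<close>, which is below 3, and then
      \<open>j\<close>.\<close>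
    ultimately have "2 * int i + 3 * int j = 2 * int i' + 3 * int j'" by (simp add: of_nat_diff)
    moreover from this have "i = i'" using \<open>i < 3\<close> \<open>i' < 3\<close> by presburger
    ultimately show "i = i' \<and> j = j'" by simp
  qed
  moreover have "fls_X ^ fst x * z ^ (d - fst x - snd x) \<noteq> (0 :: 'a fls)" for x
    using z by simp
  ultimately have "\<forall>x\<in>rem_index d. c x = 0"
    by (intro fls_sum_distinct_eq_0 [OF finite_rem_index])
  then have "rem_form d c = 0"
    unfolding rem_form_def by (intro sum.neutral) (simp add: case_prod_beta)
  then show ?thesis by (simp add: A)
qed

end

lemma rhom_fls_eval: "rhom (peval fls_const v :: ('v::finite, 'a::field) mpoly \<Rightarrow> 'a fls)"
  by (rule fls_hom.rhom_peval)

lemma meval_scale: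
  fixes A :: "('v::finite, 'a::field) mpoly"
  assumes "form k d A"
  shows "meval A (\<lambda>i. c * x i) = c ^ d * meval A x"
  unfolding meval_eq_peval by (rule rhom.peval_scale [OF rhom_ident assms])

lemma vanishes_at_proj_point:
  fixes A :: "('v::finite, 'a::field) mpoly"
  assumes "form k d A"
  shows "vanishes_at A (proj_point x) \<longleftrightarrow> meval A x = 0"
proof
  assume "vanishes_at A (proj_point x)"
  moreover have "x \<in> proj_point x" unfolding proj_point_def by (rule CollectI, rule exI [of _ 1]) simp
  ultimately show "meval A x = 0" unfolding vanishes_at_def by blast
next
  assume "meval A x = 0"
  then show "vanishes_at A (proj_point x)"
    unfolding vanishes_at_def proj_point_def using meval_scale [OF assms] by auto
qed

text \<open>A first order expansion: without its value at \<open>q\<close>, the form lies in the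
  ideal of the linear forms vanishing at \<open>q\<close>. The clause for \<open>d = 0\<close> makes
  up for the truncated \<open>d - 1\<close>.\<close>

lemma form_at_point:
  fixes A :: "('v::finite, 'a::field) mpoly" and q :: "'v \<Rightarrow> 'a"
  assumes "form UNIV d A" and q: "q k = 1"
  shows "\<exists>B. (\<forall>i. form UNIV (d - 1) (B i) \<and> (d = 0 \<longrightarrow> B i = 0)) \<and>
    A = mconst (meval A q) * mvar k ^ d + (\<Sum>i\<in>UNIV. (mvar i - mconst (q i) * mvar k) * B i)"
  using assms(1)
proof (induction rule: form_induct)
  case (zero d)
  show ?case by (rule exI [of _ "\<lambda>_. 0"]) (simp add: meval_def)
next
  case (const c)
  show ?case
    by (rule exI [of _ "\<lambda>_. 0"]) (simp add: meval_eq_peval rhom.peval_mconst [OF rhom_ident])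
next
  case (add d A A')
  then obtain B B' where B: "\<forall>i. form UNIV (d - 1) (B i) \<and> (d = 0 \<longrightarrow> B i = 0)"
     "A = mconst (meval A q) * mvar k ^ d + (\<Sum>i\<in>UNIV. (mvar i - mconst (q i) * mvar k) * B i)"
    and B': "\<forall>i. form UNIV (d - 1) (B' i) \<and> (d = 0 \<longrightarrow> B' i = 0)"
     "A' = mconst (meval A' q) * mvar k ^ d + (\<Sum>i\<in>UNIV. (mvar i - mconst (q i) * mvar k) * B' i)"
    by blast
  have "mconst (meval (A + A') q) = mconst (meval A q) + (mconst (meval A' q) :: ('v, 'a) mpoly)"
    by (simp add: meval_eq_peval rhom.peval_add [OF rhom_ident] rhom.hom_add [OF rhom_mconst])
  then have "A + A' = mconst (meval (A + A') q) * mvar k ^ d + (\<Sum>i\<in>UNIV. (mvar i - mconst (q i) * mvar k) * (B i + B' i))"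
    by (subst B(2), subst B'(2)) (simp only: distrib_left distrib_right sum.distrib ac_simps)
  moreover have "form UNIV (d - 1) (B i + B' i) \<and> (d = 0 \<longrightarrow> B i + B' i = 0)" for i
    using B(1) B'(1) subfield_set.form_add [OF subfield_set_UNIV, of "d - 1" "B i" "B' i"] by auto
  ultimately show ?case by (intro exI [of _ "\<lambda>i. B i + B' i"] conjI allI) blast+
next
  case (var d j A)
  then obtain B where B: "\<forall>i. form UNIV (d - 1) (B i) \<and> (d = 0 \<longrightarrow> B i = 0)"
     "A = mconst (meval A q) * mvar k ^ d + (\<Sum>i\<in>UNIV. (mvar i - mconst (q i) * mvar k) * B i)"
    by blast
  interpret subfield_set UNIV by (rule subfield_set_UNIV)
  define c where "c = meval A q"
  define B' where "B' i = mvar j * B i + (if i = j then mconst c * mvar k ^ d else 0)" for i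
  have "form UNIV d (B' i)" for i
  proof -
    have "form UNIV d (mvar j * B i)"
    proof (cases "d = 0")
      case False
      then show ?thesis using form_mult [OF form_mvar, of "d - 1" "B i" j] B(1) by simp
    qed (use B(1) in simp)
    moreover have "form UNIV d (mconst c * mvar k ^ d)"
      using form_smult [of c, OF _ form_power [OF form_mvar [of k], of d]] by simp
    ultimately show ?thesis by (simp add: B'_def form_add)
  qed
  moreover have "mvar j * A = mconst (meval (mvar j * A) q) * mvar k ^ Suc d + (\<Sum>i\<in>UNIV. (mvar i - mconst (q i) * mvar k) * B' i)"
  proof -
    have "mconst (meval (mvar j * A) q) = mconst (q j) * (mconst c :: ('v, 'a) mpoly)"
      by (simp add: c_def meval_eq_peval rhom.peval_mult [OF rhom_ident] rhom.peval_mvar [OF rhom_ident] rhom.hom_mult [OF rhom_mconst])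
    moreover have "(\<Sum>i\<in>UNIV. (mvar i - mconst (q i) * mvar k) * B' i)
       = mvar j * (\<Sum>i\<in>UNIV. (mvar i - mconst (q i) * mvar k) * B i) + (mvar j - mconst (q j) * mvar k) * (mconst c * mvar k ^ d)"
    proof -
      have "(\<Sum>i\<in>UNIV. (mvar i - mconst (q i) * mvar k) * B' i)
        = (\<Sum>i\<in>UNIV. mvar j * ((mvar i - mconst (q i) * mvar k) * B i) + (if i = j then (mvar j - mconst (q j) * mvar k) * (mconst c * mvar k ^ d) else 0))"
        by (rule sum.cong) (auto simp: B'_def algebra_simps)
      then show ?thesis by (simp add: sum.distrib sum_distrib_left)
    qed
    ultimately show ?thesis
      by (subst B(2)) (simp add: c_def algebra_simps)
  qed
  ultimately show ?case by (intro exI [of _ B']) simp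
qed

definition fv :: "(3 \<Rightarrow> 'a::zero fps) \<Rightarrow> 3 \<Rightarrow> 'a fls" where
  "fv p i = fps_to_fls (p i)"

definition p0 :: "(3 \<Rightarrow> 'a fps) \<Rightarrow> 3 \<Rightarrow> 'a" where
  "p0 p i = fps_nth (p i) 0"

lemma peval_fv: "peval fls_const (fv p) A = fps_to_fls (peval fps_const p A)" for p :: "3 \<Rightarrow> 'a::field fps"
proof -
  have "fps_to_fls (fps_const c) = fls_const c" for c :: 'a
    by (simp add: fls_const_def fls_eq_iff)
  then show ?thesis
    using rhom.hom_peval [OF rhom_fps_const rhom_fps_to_fls, of p A] by (simp add: fv_def [abs_def])
qed

lemma peval_fps_nth_0: "fps_nth (peval fps_const p A) 0 = meval A (p0 p)" for p :: "3 \<Rightarrow> 'a::field fps"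
proof -
  have "rhom (\<lambda>f :: 'a fps. fps_nth f 0)" by standard simp_all
  from rhom.hom_peval [OF rhom_fps_const this] show ?thesis
    by (simp add: meval_eq_peval p0_def [abs_def])
qed

text \<open>
  A point of the curve, given by a branch \<open>p\<close> with centre \<open>p0 p\<close>, at which the local ring is a discrete
  valuation ring: up to a unit, a form vanishing at the point is divisible by \<open>\<l>\<close>.
\<close>

locale upoint =
  fixes t :: "'a::{alg_closed_field,char2}" and p :: "3 \<Rightarrow> 'a fps" and \<l> :: "(3, 'a) mpoly"
  assumes cv: "cv t (fv p)" and nz: "\<exists>i. p0 p i \<noteq> 0"
    and form_l: "form UNIV 1 \<l>" and ord_l: "fls_subdegree (peval fls_const (fv p) \<l>) = 1"
    and uniformizer: "form UNIV d A \<Longrightarrow> meval A (p0 p) = 0 \<Longrightarrow> Fw t dvd A \<or>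
      (\<exists>e u d' A'. d + e = Suc d' \<and> form UNIV e u \<and> meval u (p0 p) \<noteq> 0 \<and> form UNIV d' A' \<and> Fw t dvd u * A - \<l> * A')"

text \<open>The linear forms at \<open>a\<close> and \<open>b\<close> generate the ideal of the
  point. By \<open>eq\<close>, the second one times the local unit \<open>u\<close> is a multiple of
  the first modulo \<open>Fw t\<close>, so the first generates locally.\<close>

lemma upointI:
  fixes t :: "'a::{alg_closed_field,char2}"
  assumes cv: "cv t (fv p)" and q: "p0 p k = 1" and UNIV: "UNIV = {k, a, b}" "a \<noteq> b" "k \<noteq> a" "k \<noteq> b"
    and ord: "fv p a + fls_const (p0 p a) * fv p k = fls_X"
    and u: "form UNIV 2 u" "meval u (p0 p) \<noteq> 0" and m: "form UNIV 2 m"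
    and eq: "Fw t = u * (mvar b + mconst (p0 p b) * mvar k) + (mvar a + mconst (p0 p a) * mvar k) * m"
  shows "upoint t p (mvar a + mconst (p0 p a) * mvar k)"
proof
  interpret subfield_set "UNIV :: 'a set" by (rule subfield_set_UNIV)
  let ?l = "mvar a + mconst (p0 p a) * mvar k" and ?l' = "mvar b + mconst (p0 p b) * mvar k"
  show "cv t (fv p)" by fact
  show "\<exists>i. p0 p i \<noteq> 0" using q by (intro exI [of _ k]) simp
  show "form UNIV 1 ?l" by (intro form_add form_mvar form_smult) simp
  show "fls_subdegree (peval fls_const (fv p) ?l) = 1"
    using ord by (simp add: fls_hom.peval_add fls_hom.peval_mult)
  fix d A assume A: "form UNIV d A" and 0: "meval A (p0 p) = 0"
  obtain B where B: "\<forall>i. form UNIV (d - 1) (B i) \<and> (d = 0 \<longrightarrow> B i = 0)"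
    "A = mconst (meval A (p0 p)) * mvar k ^ d + (\<Sum>i\<in>UNIV. (mvar i - mconst (p0 p i) * mvar k) * B i)"
    using form_at_point [of d A "p0 p" k, OF A q] by blast
  have sum: "(\<Sum>i\<in>UNIV. f i) = f k + f a + f b" for f :: "3 \<Rightarrow> (3, 'a) mpoly"
    unfolding UNIV(1) using UNIV(2-4) by (simp add: add.assoc)
  have A': "A = ?l * B a + ?l' * B b"
    using B(2) q unfolding sum by (simp add: 0)
  show "Fw t dvd A \<or> (\<exists>e u d' A'. d + e = Suc d' \<and> form UNIV e u \<and> meval u (p0 p) \<noteq> 0 \<and> form UNIV d' A' \<and> Fw t dvd u * A - ?l * A')"
  proof (cases "d = 0")
    case True
    then show ?thesis using A' B(1) by simp
  next
    case False
    have "u * A - ?l * (u * B a + m * B b) = Fw t * B b"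
      unfolding eq A' by (simp add: algebra_simps)
    moreover have "form UNIV (d + 1) (u * B a + m * B b)"
    proof -
      have "form UNIV (2 + (d - 1)) (u * B a + m * B b)"
        using B(1) u m by (intro form_add form_mult) simp_all
      then show ?thesis using False by (simp add: numeral_2_eq_2)
    qed
    ultimately show ?thesis using u
      by (intro disjI2 exI [of _ 2] exI [of _ u] exI [of _ "d + 1"] exI [of _ "u * B a + m * B b"]) simp
  qed
qed

context upoint
begin

abbreviation "ev \<equiv> peval fls_const (fv p) :: (3, 'a) mpoly \<Rightarrow> 'a fls"

sublocale ev: rhom ev by (rule rhom_fls_eval)

lemma ev_nonneg: "vge (ev A) 0"
  unfolding peval_fv by (simp add: vge_def)

lemma ev_unit_iff: "ev A \<noteq> 0 \<and> fls_subdegree (ev A) = 0 \<longleftrightarrow> meval A (p0 p) \<noteq> 0"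
proof -
  have 0: "ev A $$ 0 = meval A (p0 p)" unfolding peval_fv by (simp add: peval_fps_nth_0)
  show ?thesis
  proof
    assume "ev A \<noteq> 0 \<and> fls_subdegree (ev A) = 0"
    then show "meval A (p0 p) \<noteq> 0" using nth_fls_subdegree_nonzero [of "ev A"] 0 by simp
  next
    assume "meval A (p0 p) \<noteq> 0"
    then have "ev A \<noteq> 0" "fls_subdegree (ev A) \<le> 0"
      using 0 fls_subdegree_leI [of "ev A" 0] by auto
    then show "ev A \<noteq> 0 \<and> fls_subdegree (ev A) = 0" using ev_nonneg [of A] by (auto simp: vge_iff)
  qed
qed

text \<open>Vanishing is transported to the branch at infinity, where division with remainder
  detects the ideal.\<close>

lemma ev_dvd: "form UNIV d A \<Longrightarrow> ev A = 0 \<longleftrightarrow> Fw t dvd A"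
proof
  assume A: "form UNIV d A" and 0: "ev A = 0"
  obtain z where z: "fps_nth z 0 = 0" "z + fps_X * z + z^3 + fps_const t * fps_X^2 * z = fps_X^3"
    using ex_infinity_fps by blast
  note inf = infinity_at_fps [OF z]
  define v where "v = (\<lambda>i::3. if i = 0 then fls_X else if i = 1 then 1 else fps_to_fls z)"
  have "cv t v"
    using inf infinity_at_subdegree [OF inf(1)] by (auto simp: cv_def v_def infinity_at_def)
  from infinity_dvd [OF inf(2,3) A v_def this cv_vanish [OF cv this A 0]] show "Fw t dvd A" .
next
  assume "Fw t dvd A"
  then show "ev A = 0" using peval_Fw [OF cv] by (auto simp: ev.hom_mult elim!: dvdE)
qed

sublocale fn_field UNIV "Fw t" ev
  by (intro fn_field.intro fn_field_axioms.intro subfield_set_UNIV ev.rhom_axioms ev_dvd)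

text \<open>\<open>uniformizer\<close> is applied \<open>n\<close> times; each time a factor
  \<open>\<l>\<close> is split off at the cost of a local unit.\<close>

lemma ev_factor:
  assumes "form UNIV d A" "ev A \<noteq> 0" "fls_subdegree (ev A) = int n"
  shows "\<exists>e u d' A'. d + e = d' + n \<and> form UNIV e u \<and> meval u (p0 p) \<noteq> 0 \<and> form UNIV d' A' \<and> meval A' (p0 p) \<noteq> 0
    \<and> ev u * ev A = ev \<l> ^ n * ev A'"
  using assms
proof (induction n arbitrary: d A)
  case 0
  then show ?case using ev_unit_iff [of A]
    by (intro exI [of _ 0] exI [of _ 1] exI [of _ d] exI [of _ A])
      (simp add: form_1 ev.hom_1 meval_eq_peval rhom.hom_1 [OF rhom.rhom_peval [OF rhom_ident]])
next
  case (Suc n)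
  have "meval A (p0 p) = 0" using Suc.prems ev_unit_iff [of A] by auto
  then obtain e u d' A' where *: "d + e = Suc d'" "form UNIV e u" "meval u (p0 p) \<noteq> 0" "form UNIV d' A'"
    "Fw t dvd u * A - \<l> * A'"
    using uniformizer [OF Suc.prems(1)] ev_dvd [OF Suc.prems(1)] Suc.prems(2) by blast
  have "ev (u * A - \<l> * A') = 0"
  proof -
    have "form UNIV (e + d) (u * A)" "form UNIV (1 + d') (\<l> * A')"
      using * Suc.prems form_l by (intro form_mult; simp)+
    then have "form UNIV (e + d) (u * A - \<l> * A')" using *(1) by (intro form_diff) (simp_all add: add.commute)
    then show ?thesis using ev_dvd *(5) by blast
  qed
  then have eq: "ev u * ev A = ev \<l> * ev A'"
    by (simp add: ev.hom_simps add_eq_0_char2)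
  have u: "ev u \<noteq> 0" "fls_subdegree (ev u) = 0" using ev_unit_iff [of u] * by auto
  have l: "ev \<l> \<noteq> 0" using ord_l by auto
  have A'0: "ev A' \<noteq> 0" using eq u Suc.prems by auto
  have "fls_subdegree (ev u * ev A) = fls_subdegree (ev \<l> * ev A')" by (simp only: eq)
  then have "fls_subdegree (ev A') = int n" using u l A'0 Suc.prems ord_l by simp
  from Suc.IH [OF *(4) A'0 this] obtain e' u' d'' A'' where
    **: "d' + e' = d'' + n" "form UNIV e' u'" "meval u' (p0 p) \<noteq> 0" "form UNIV d'' A''" "meval A'' (p0 p) \<noteq> 0"
      "ev u' * ev A' = ev \<l> ^ n * ev A''" by blast
  have "form UNIV (e + e') (u * u')" using * ** by (intro form_mult)
  moreover have "meval (u * u') (p0 p) \<noteq> 0"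
    using * ** by (simp add: meval_eq_peval rhom.peval_mult [OF rhom_ident])
  moreover have "ev (u * u') * ev A = ev \<l> ^ Suc n * ev A''"
  proof -
    have "ev (u * u') * ev A = ev u' * (ev u * ev A)" by (simp add: ev.hom_mult algebra_simps)
    also have "\<dots> = ev \<l> * (ev u' * ev A')" unfolding eq by (simp add: algebra_simps)
    finally show ?thesis unfolding **(6) by (simp add: algebra_simps)
  qed
  moreover have "d + (e + e') = d'' + Suc n" using *(1) **(1) by simp
  ultimately show ?case using ** by blast
qed

text \<open>Numerator and denominator are local units times powers of \<open>\<l>\<close>;
  cancelling these leaves a denominator that is nonzero at the point.\<close>

lemma ev_quotient_regular:
  assumes A: "form UNIV d A" and B: "form UNIV d B" "ev B \<noteq> 0" and ge: "vge (ev A / ev B) 0"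
  shows "\<exists>e C D. form UNIV e C \<and> form UNIV e D \<and> meval D (p0 p) \<noteq> 0 \<and> ev A / ev B = ev C / ev D"
proof (cases "ev A = 0")
  case True
  obtain k where "p0 p k \<noteq> 0" using nz by blast
  then have "meval (mvar k) (p0 p) \<noteq> 0" by (simp add: meval_eq_peval rhom.peval_mvar [OF rhom_ident])
  then show ?thesis using True form_mvar [of k] form_0 [of UNIV 1]
    by (intro exI [of _ 1] exI [of _ 0] exI [of _ "mvar k"]) (simp add: ev.hom_0)
next
  case False
  obtain a where a: "fls_subdegree (ev A) = int a" using ev_nonneg [of A] False by (auto simp: vge_iff intro: nonneg_int_cases)
  obtain b where b: "fls_subdegree (ev B) = int b" using ev_nonneg [of B] B by (auto simp: vge_iff intro: nonneg_int_cases)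
  have ab: "b \<le> a" using ge False B a b by (simp add: vge_iff fls_divide_subdegree)
  obtain e u d' A' where 1: "d + e = d' + a" "form UNIV e u" "meval u (p0 p) \<noteq> 0" "form UNIV d' A'" "meval A' (p0 p) \<noteq> 0"
    "ev u * ev A = ev \<l> ^ a * ev A'" using ev_factor [OF A False a] by blast
  obtain e' u' d'' B' where 2: "d + e' = d'' + b" "form UNIV e' u'" "meval u' (p0 p) \<noteq> 0" "form UNIV d'' B'" "meval B' (p0 p) \<noteq> 0"
    "ev u' * ev B = ev \<l> ^ b * ev B'" using ev_factor [OF B b] by blast
  have nz': "ev u \<noteq> 0" "ev u' \<noteq> 0" "ev A' \<noteq> 0" "ev B' \<noteq> 0" using 1 2 ev_unit_iff by blast+
  have l: "ev \<l> \<noteq> 0" using ord_l by auto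
  have "form UNIV ((a - b) + d' + e') (\<l> ^ (a - b) * A' * u')"
    using form_mult [OF form_mult [OF form_power [OF form_l, of "a - b"] 1(4)] 2(2)] by simp
  moreover have "form UNIV (d'' + e) (B' * u)" by (rule form_mult [OF 2(4) 1(2)])
  moreover have "(a - b) + d' + e' = d'' + e" using 1(1) 2(1) ab by simp
  moreover have "meval (B' * u) (p0 p) \<noteq> 0" using 1 2 by (simp add: meval_eq_peval rhom.peval_mult [OF rhom_ident])
  moreover have "ev A / ev B = ev (\<l> ^ (a - b) * A' * u') / ev (B' * u)"
  proof -
    have "ev \<l> ^ a = ev \<l> ^ (a - b) * ev \<l> ^ b" using ab by (simp flip: power_add)
    then have "ev A * ev u * (ev \<l> ^ b * ev B') = (ev u' * ev B) * (ev \<l> ^ (a - b) * ev A') * ev \<l> ^ b"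
      unfolding 2(6) using 1(6) by (simp add: algebra_simps)
    then have "ev A * (ev B' * ev u) = (ev \<l> ^ (a - b) * ev A' * ev u') * ev B"
      using l by (simp add: algebra_simps)
    then show ?thesis using nz' B by (simp add: ev.hom_simps frac_eq_eq)
  qed
  ultimately show ?thesis by metis
qed

abbreviation "P \<equiv> proj_point (p0 p)"

lemma local_ring_eq: "local_ring UNIV (Fw t) P = {h \<in> carrier L. vge (\<Phi> h) 0}"
proof
  show "local_ring UNIV (Fw t) P \<subseteq> {h \<in> carrier L. vge (\<Phi> h) 0}"
  proof
    fix h assume "h \<in> local_ring UNIV (Fw t) P"
    then obtain A B d where h: "h = rat UNIV (Fw t) A B" "form UNIV d A" "form UNIV d B" "\<not> vanishes_at B P"
      unfolding local_ring_def by blast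
    then have "ev B \<noteq> 0" "fls_subdegree (ev B) = 0"
      using ev_unit_iff [of B] vanishes_at_proj_point [OF h(3)] by auto
    then show "h \<in> {h \<in> carrier L. vge (\<Phi> h) 0}"
      using h fracsI [OF h(2,3)] rat_mem Phi_rat ev_nonneg [of A] by (auto simp: vge_iff fls_divide_subdegree)
  qed
  show "{h \<in> carrier L. vge (\<Phi> h) 0} \<subseteq> local_ring UNIV (Fw t) P"
  proof clarify
    fix h assume h: "h \<in> carrier L" "vge (\<Phi> h) 0"
    then obtain A B where AB: "h = rat UNIV (Fw t) A B" "fracs A B" by (auto simp: carrier_L)
    then obtain d where d: "form UNIV d A" "form UNIV d B" "ev B \<noteq> 0" using fracs_E by (auto simp: fracs_def)
    then obtain e C D where CD: "form UNIV e C" "form UNIV e D" "meval D (p0 p) \<noteq> 0" "ev A / ev B = ev C / ev D"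
      using ev_quotient_regular [OF d] h AB Phi_rat by auto
    have "fracs C D" using CD ev_unit_iff [of D] by (intro fracsI) auto
    then have "h = rat UNIV (Fw t) C D" using AB rat_eq_iff CD(4) by blast
    then show "h \<in> local_ring UNIV (Fw t) P"
      unfolding local_ring_def using CD vanishes_at_proj_point [OF CD(2)] by blast
  qed
qed

lemma max_ideal_eq: "max_ideal UNIV (Fw t) P = {h \<in> carrier L. vge (\<Phi> h) 1}"
proof -
  have val: "vge (\<Phi> (rat UNIV (Fw t) A B)) 1 \<longleftrightarrow> vanishes_at A P"
    if AB: "form UNIV d A" "form UNIV d B" "\<not> vanishes_at B P" for A B d
  proof -
    have B: "ev B \<noteq> 0" "fls_subdegree (ev B) = 0"
      using AB ev_unit_iff [of B] vanishes_at_proj_point [OF AB(2)] by auto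
    then have "\<Phi> (rat UNIV (Fw t) A B) = ev A / ev B" using Phi_rat fracsI AB by blast
    then have "vge (\<Phi> (rat UNIV (Fw t) A B)) 1 \<longleftrightarrow> ev A = 0 \<or> 1 \<le> fls_subdegree (ev A)"
      using B by (auto simp: vge_iff fls_divide_subdegree)
    also have "\<dots> \<longleftrightarrow> \<not> (ev A \<noteq> 0 \<and> fls_subdegree (ev A) = 0)"
      using ev_nonneg [of A] by (auto simp: vge_iff)
    finally show ?thesis using ev_unit_iff vanishes_at_proj_point [OF AB(1)] by blast
  qed
  have "max_ideal UNIV (Fw t) P = {h \<in> local_ring UNIV (Fw t) P. vge (\<Phi> h) 1}"
    unfolding max_ideal_def local_ring_def using val by blast
  then show ?thesis unfolding local_ring_eq using vge_mono [of _ 1 0] by fastforce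
qed

lemma ex_uniformizer: "\<exists>w\<in>carrier L. \<Phi> w \<noteq> 0 \<and> fls_subdegree (\<Phi> w) = 1"
proof -
  obtain k where "p0 p k \<noteq> 0" using nz by blast
  then have "meval (mvar k) (p0 p) \<noteq> 0" by (simp add: meval_eq_peval rhom.peval_mvar [OF rhom_ident])
  then have k: "ev (mvar k) \<noteq> 0" "fls_subdegree (ev (mvar k)) = 0" using ev_unit_iff by blast+
  have l: "ev \<l> \<noteq> 0" using ord_l by auto
  have "fracs \<l> (mvar k)" using form_l form_mvar k by (intro fracsI)
  then show ?thesis using Phi_rat rat_mem k l ord_l
    by (intro bexI [of _ "rat UNIV (Fw t) \<l> (mvar k)"]) (auto simp: fls_divide_subdegree)
qed

end

section \<open>Ramification\<close>

context upoint
begin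

abbreviation "OP \<equiv> L\<lparr>carrier := local_ring UNIV (Fw t) P\<rparr>"

definition filt :: "int \<Rightarrow> (3, 'a) mpoly fract set set" where
  "filt n = {h \<in> carrier L. vge (\<Phi> h) n}"

lemma filt_mono: "m \<le> n \<Longrightarrow> filt n \<subseteq> filt m"
  by (auto simp: filt_def elim: vge_mono)

lemma carrier_OP: "carrier OP = filt 0"
  by (simp add: local_ring_eq filt_def)

lemma max_ideal_filt: "max_ideal UNIV (Fw t) P = filt 1"
  by (simp add: max_ideal_eq filt_def)

lemma Phi_minus: "h \<in> carrier L \<Longrightarrow> \<Phi> (\<ominus>\<^bsub>L\<^esub> h) = \<Phi> h"
proof -
  assume h: "h \<in> carrier L"
  interpret L: cring L by (rule cring_L)
  have "\<Phi> (\<ominus>\<^bsub>L\<^esub> h \<oplus>\<^bsub>L\<^esub> h) = \<Phi> (\<ominus>\<^bsub>L\<^esub> h) + \<Phi> h" using h by (intro Phi_add) simp_all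
  then have "\<Phi> (\<ominus>\<^bsub>L\<^esub> h) + \<Phi> h = 0" using h by (simp add: L.l_neg Phi_zero)
  then show ?thesis by (simp only: add_eq_0_char2)
qed

lemma filt_add: "g \<in> filt n \<Longrightarrow> h \<in> filt n \<Longrightarrow> g \<oplus>\<^bsub>L\<^esub> h \<in> filt n"
  and filt_minus: "g \<in> filt n \<Longrightarrow> \<ominus>\<^bsub>L\<^esub> g \<in> filt n"
  and filt_zero: "\<zero>\<^bsub>L\<^esub> \<in> filt n"
  and filt_mult: "g \<in> filt m \<Longrightarrow> h \<in> filt n \<Longrightarrow> g \<otimes>\<^bsub>L\<^esub> h \<in> filt (m + n)"
proof -
  interpret L: cring L by (rule cring_L)
  show "g \<in> filt n \<Longrightarrow> h \<in> filt n \<Longrightarrow> g \<oplus>\<^bsub>L\<^esub> h \<in> filt n"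
    by (simp add: filt_def Phi_add vge_add)
  show "g \<in> filt n \<Longrightarrow> \<ominus>\<^bsub>L\<^esub> g \<in> filt n"
    by (simp add: filt_def Phi_minus)
  show "\<zero>\<^bsub>L\<^esub> \<in> filt n" by (simp add: filt_def Phi_zero)
  show "g \<in> filt m \<Longrightarrow> h \<in> filt n \<Longrightarrow> g \<otimes>\<^bsub>L\<^esub> h \<in> filt (m + n)"
    by (simp add: filt_def Phi_mult vge_mult)
qed

lemma ring_OP: "ring OP"
proof -
  interpret L: cring L by (rule cring_L)
  have "subring (filt 0) L"
  proof (rule L.subringI)
    show "filt 0 \<subseteq> carrier L" by (auto simp: filt_def)
    show "\<one>\<^bsub>L\<^esub> \<in> filt 0" by (simp add: filt_def Phi_one vge_1)
  qed (use filt_minus filt_add filt_mult [of _ 0 _ 0] in auto)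
  then show ?thesis using L.subring_is_ring carrier_OP by simp
qed

lemma ideal_filt:
  assumes "n \<ge> 0"
  shows "ideal (filt n) OP"
proof (rule idealI)
  interpret L: cring L by (rule cring_L)
  interpret O: ring OP by (rule ring_OP)
  show "ring OP" by (rule ring_OP)
  have inv: "\<ominus>\<^bsub>OP\<^esub> h = \<ominus>\<^bsub>L\<^esub> h" if "h \<in> filt n" for h
  proof (rule O.minus_equality)
    show "\<ominus>\<^bsub>L\<^esub> h \<oplus>\<^bsub>OP\<^esub> h = \<zero>\<^bsub>OP\<^esub>" using that by (simp add: filt_def L.l_neg)
    show "h \<in> carrier OP" "\<ominus>\<^bsub>L\<^esub> h \<in> carrier OP"
      unfolding carrier_OP using that filt_mono [OF assms] filt_minus by blast+
  qed
  show "subgroup (filt n) (add_monoid OP)"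
  proof (rule group.subgroupI)
    show "group (add_monoid OP)" by (rule O.add.group_axioms)
    show "filt n \<subseteq> carrier (add_monoid OP)" using filt_mono [OF assms] carrier_OP by simp
    show "filt n \<noteq> {}" using filt_zero by blast
    show "inv\<^bsub>add_monoid OP\<^esub> h \<in> filt n" if "h \<in> filt n" for h
      using inv [OF that] filt_minus [OF that] by (simp add: a_inv_def)
    show "g \<otimes>\<^bsub>add_monoid OP\<^esub> h \<in> filt n" if "g \<in> filt n" "h \<in> filt n" for g h
      using filt_add [OF that] by simp
  qed
  show "x \<otimes>\<^bsub>OP\<^esub> a \<in> filt n" "a \<otimes>\<^bsub>OP\<^esub> x \<in> filt n" if "a \<in> filt n" "x \<in> carrier OP" for a x
    using filt_mult [of x 0 a n] filt_mult [of a n x 0] that unfolding carrier_OP by simp_all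
qed

lemma filt_divide:
  assumes "h \<in> filt (m + n)" "g \<in> carrier L" "\<Phi> g \<noteq> 0" "fls_subdegree (\<Phi> g) = n"
  shows "\<exists>h'\<in>filt m. h = h' \<otimes>\<^bsub>L\<^esub> g"
proof -
  interpret L: cring L by (rule cring_L)
  obtain g' where g': "g' \<in> carrier L" "\<Phi> g' = inverse (\<Phi> g)" using inverse_mem_L assms by blast
  have "h \<otimes>\<^bsub>L\<^esub> g' \<in> filt m"
  proof -
    have "g' \<in> filt (- n)" using g' assms by (simp add: filt_def vge_iff)
    from filt_mult [OF assms(1) this] show ?thesis by simp
  qed
  moreover have "h = h \<otimes>\<^bsub>L\<^esub> g' \<otimes>\<^bsub>L\<^esub> g"
    using assms g' by (intro Phi_inj) (auto simp: filt_def Phi_mult)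
  ultimately show ?thesis by blast
qed

text \<open>In a valuation ring an ideal is generated by any element of least order.\<close>

lemma genideal_filt:
  assumes "n \<ge> 0" "S \<subseteq> filt n" "g \<in> S" "\<Phi> g \<noteq> 0" "fls_subdegree (\<Phi> g) = n"
  shows "Idl\<^bsub>OP\<^esub> S = filt n"
proof
  show "Idl\<^bsub>OP\<^esub> S \<subseteq> filt n"
    unfolding genideal_def using ideal_filt [OF assms(1)] assms(2) by blast
  have "h \<in> I" if I: "ideal I OP" "S \<subseteq> I" and h: "h \<in> filt n" for I h
  proof -
    have "g \<in> carrier L" using assms by (auto simp: filt_def)
    then obtain h' where h': "h' \<in> filt 0" "h = h' \<otimes>\<^bsub>L\<^esub> g"
      using filt_divide [of h 0 n g] h assms by auto
    then have "h' \<otimes>\<^bsub>OP\<^esub> g \<in> I"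
      using ideal.I_l_closed [OF I(1), of g h'] I(2) assms(3) unfolding carrier_OP by blast
    then show ?thesis using h' by simp
  qed
  then show "filt n \<subseteq> Idl\<^bsub>OP\<^esub> S" unfolding genideal_def by blast
qed

lemma ideal_prod_filt:
  assumes "n \<ge> 0"
  shows "ideal_prod OP (filt n) (filt 1) = filt (n + 1)"
proof
  show "ideal_prod OP (filt n) (filt 1) \<subseteq> filt (n + 1)"
  proof
    fix h assume "h \<in> ideal_prod OP (filt n) (filt 1)"
    then show "h \<in> filt (n + 1)"
      by (induction rule: ideal_prod.induct) (simp_all add: filt_mult filt_add)
  qed
  obtain w where w: "w \<in> carrier L" "\<Phi> w \<noteq> 0" "fls_subdegree (\<Phi> w) = 1" using ex_uniformizer by blast
  show "filt (n + 1) \<subseteq> ideal_prod OP (filt n) (filt 1)"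
  proof
    fix h assume "h \<in> filt (n + 1)"
    then obtain h' where "h' \<in> filt n" "h = h' \<otimes>\<^bsub>L\<^esub> w" using filt_divide w by blast
    moreover have "w \<in> filt 1" using w by (simp add: filt_def vge_iff)
    ultimately show "h \<in> ideal_prod OP (filt n) (filt 1)"
      using ideal_prod.prod [of h' "filt n" w "filt 1" OP] by simp
  qed
qed

lemma max_ideal_power: "filt 1 [^]\<^bsub>ideals_set OP\<^esub> (e::nat) = filt (int e)"
proof (induction e)
  case 0
  show ?case using carrier_OP by (simp add: nat_pow_def ideals_set_def)
next
  case (Suc e)
  have "filt 1 [^]\<^bsub>ideals_set OP\<^esub> Suc e = ideal_prod OP (filt 1 [^]\<^bsub>ideals_set OP\<^esub> e) (filt 1)"
    by (simp add: nat_pow_def ideals_set_def)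
  then show ?case unfolding Suc using ideal_prod_filt [of "int e"] by (simp add: add.commute)
qed

text \<open>Products of uniformizers realize every order, which makes the exponent in
  \<open>ramification_index\<close> unique.\<close>

lemma filt_inj: "filt (int m) = filt (int n) \<Longrightarrow> m = n"
proof -
  have "\<exists>h\<in>carrier L. \<Phi> h \<noteq> 0 \<and> fls_subdegree (\<Phi> h) = int n" for n
  proof (induction n)
    case 0
    interpret L: cring L by (rule cring_L)
    show ?case by (rule bexI [of _ "\<one>\<^bsub>L\<^esub>"]) (simp_all add: Phi_one)
  next
    case (Suc n)
    then obtain h where h: "h \<in> carrier L" "\<Phi> h \<noteq> 0" "fls_subdegree (\<Phi> h) = int n" by blast
    obtain w where w: "w \<in> carrier L" "\<Phi> w \<noteq> 0" "fls_subdegree (\<Phi> w) = 1" using ex_uniformizer by blast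
    interpret L: cring L by (rule cring_L)
    show ?case using h w by (intro bexI [of _ "h \<otimes>\<^bsub>L\<^esub> w"]) (simp_all add: Phi_mult)
  qed
  then have "int n \<le> int m" if "filt (int m) = filt (int n)" for m n
  proof -
    obtain h where "h \<in> carrier L" "\<Phi> h \<noteq> 0" "fls_subdegree (\<Phi> h) = int m"
      using \<open>\<And>n. \<exists>h\<in>carrier L. \<Phi> h \<noteq> 0 \<and> fls_subdegree (\<Phi> h) = int n\<close> by blast
    then have "h \<in> filt (int m)" by (simp add: filt_def vge_iff)
    then have "h \<in> filt (int n)" using that by simp
    then show ?thesis using \<open>\<Phi> h \<noteq> 0\<close> \<open>fls_subdegree (\<Phi> h) = int m\<close> by (simp add: filt_def vge_iff)
  qed
  then show "filt (int m) = filt (int n) \<Longrightarrow> m = n" by (metis antisym of_nat_le_iff)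
qed

lemma ramification_index_eq:
  assumes "e > 0" "pullback UNIV (Fw t) F' f (max_ideal UNIV F' (f P)) \<subseteq> filt (int e)"
    and "g \<in> pullback UNIV (Fw t) F' f (max_ideal UNIV F' (f P))" "\<Phi> g \<noteq> 0" "fls_subdegree (\<Phi> g) = int e"
  shows "ramification_index (Fw t) F' f P = e"
proof -
  have gen: "Idl\<^bsub>OP\<^esub> (pullback UNIV (Fw t) F' f (max_ideal UNIV F' (f P))) = filt (int e)"
    using assms by (intro genideal_filt) simp_all
  show ?thesis
    unfolding ramification_index_def Let_def gen max_ideal_filt max_ideal_power
    using assms(1) filt_inj by (intro the_equality) auto
qed

end

text \<open>Otherwise \<open>1 + x q(x)\<close> has a root, which is nonzero and at which
  \<open>q\<close> is nonzero.\<close>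

lemma poly_zero_if_zero_on_nonzero:
  fixes q :: "'a::alg_closed_field poly"
  assumes "\<And>x. x \<noteq> 0 \<Longrightarrow> poly q x = 0"
  shows "q = 0"
proof (rule ccontr)
  assume "q \<noteq> 0"
  have "pdeg (pCons 1 q) > 0" using \<open>q \<noteq> 0\<close> by simp
  then obtain x where "poly (pCons 1 q) x = 0" using alg_closed_imp_poly_has_root by blast
  then have "1 + x * poly q x = 0" by simp
  then show False using assms [of x] by (cases "x = 0") auto
qed

text \<open>A Nullstellensatz by hand: over each nonzero \<open>x\<close> lie two points, conjugate
  under \<open>y\<close> to \<open>y + x\<close>, and they force both components of the reduced pair
  to vanish at \<open>x\<close>.\<close>

lemma form_vanishing_on_points:
  fixes t :: "'a::{alg_closed_field,char2}"
  assumes A: "form UNIV d A" and v: "cv t v"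
    and vanish: "\<And>x. x \<noteq> (\<lambda>_. 0) \<Longrightarrow> meval (Fw t) x = 0 \<Longrightarrow> meval A x = 0"
  shows "peval fls_const v A = 0"
proof -
  obtain q where q: "\<And>v. v 2 \<noteq> 0 \<and> on_curve t (v 0 / v 2) (v 1 / v 2) \<Longrightarrow> peval fls_const v A = v 2 ^ d * pev (v 0 / v 2) (v 1 / v 2) q"
    using form_reduce [OF subfield_set_UNIV A, of t] by blast
  have hc: "hpoly fls_const (fls_const x) p = fls_const (poly p x)" for x :: 'a and p
    by (induction p) (simp_all only: poly_0 poly_pCons fls_hom.hpoly_0 fls_hom.hpoly_pCons fls_hom.hom_add fls_hom.hom_mult fls_hom.hom_0)
  have 0: "poly (fst q) x + poly (snd q) x * y = 0" if xy: "y^2 + x * y = x^3 + t * x^2 + 1" for x y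
  proof -
    define u where "u = (\<lambda>i::3. if i = 0 then x else if i = 1 then y else 1)"
    have "meval (Fw t) u = (y^2 + x * y) + (x^3 + t * x^2 + 1)"
      by (simp add: meval_eq_peval peval_weierstrass [OF rhom_ident] u_def algebra_simps)
    then have "meval (Fw t) u = 0" using xy by simp
    moreover have "u \<noteq> (\<lambda>_. 0)"
    proof
      assume "u = (\<lambda>_. 0)"
      then have "u 2 = 0" by (rule fun_cong)
      then show False by (simp add: u_def)
    qed
    ultimately have Au: "meval A u = 0" using vanish by blast
    have "peval fls_const (\<lambda>i. fls_const (u i)) A = fls_const (meval A u)"
      unfolding meval_eq_peval by (rule rhom.hom_peval [OF rhom_ident rhom_fls_const, symmetric])
    moreover have "on_curve t (fls_const x) (fls_const y)"
      using arg_cong [OF xy, of fls_const] by (simp only: on_curve_def fls_hom.hom_simps)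
    ultimately have "pev (fls_const x) (fls_const y) q = 0"
      using q [of "\<lambda>i. fls_const (u i)"] Au by (simp add: u_def)
    then have "fls_const (poly (fst q) x + poly (snd q) x * y) = fls_const 0"
      by (simp only: pev_def hc fls_hom.hom_add fls_hom.hom_mult fls_hom.hom_0)
    then show ?thesis by simp
  qed
  have "poly (snd q) x = 0 \<and> poly (fst q) x = 0" if "x \<noteq> 0" for x
  proof -
    obtain y where "poly [:x^3 + t * x^2 + 1, x, 1:] y = 0"
      using alg_closed_imp_poly_has_root [of "[:x^3 + t * x^2 + 1, x, 1:]"] by auto
    then have "(y^2 + x * y) + (x^3 + t * x^2 + 1) = 0"
      by (simp add: algebra_simps power2_eq_square)
    then have y: "y^2 + x * y = x^3 + t * x^2 + 1" by (simp only: add_eq_0_char2)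
    moreover have "(y + x)^2 + x * (y + x) = y^2 + x * y"
      by (simp add: square_add algebra_simps power2_eq_square)
    ultimately have "poly (fst q) x + poly (snd q) x * y = 0" "poly (fst q) x + poly (snd q) x * (y + x) = 0"
      using 0 by simp_all
    then have "(poly (fst q) x + poly (snd q) x * y) + (poly (fst q) x + poly (snd q) x * (y + x)) = 0" by simp
    then have "poly (snd q) x * x = 0" by (simp add: algebra_simps)
    then show ?thesis using that \<open>poly (fst q) x + poly (snd q) x * y = 0\<close> by simp
  qed
  then have "fst q = 0" "snd q = 0" using poly_zero_if_zero_on_nonzero by blast+
  then show ?thesis using q [of v] v by (simp add: cv_def pev_def)
qed

section \<open>Representatives of a morphism to the projective line and its ramification\<close>

lemma exhaust_2: "i = 0 \<or> i = 1" for i :: 2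
  using UNIV_2 by blast

lemma represents_mono: "represents k F G f \<Longrightarrow> represents UNIV F G f"
  unfolding represents_def using form_UNIV by blast

lemma proj_point_eqD: "proj_point a = proj_point b \<Longrightarrow> \<exists>c. b = (\<lambda>i. c * a i)"
proof -
  assume eq: "proj_point a = proj_point b"
  have "b \<in> proj_point b" unfolding proj_point_def by (rule CollectI, rule exI [of _ 1]) simp
  then have "b \<in> proj_point a" by (simp only: eq)
  then show ?thesis unfolding proj_point_def by blast
qed

interpretation P1: fn_field "UNIV :: 'a::field set" "P1 :: (2, 'a) mpoly" "to_fract :: (2, 'a) mpoly \<Rightarrow> _"
  by (intro fn_field.intro fn_field_axioms.intro subfield_set_UNIV rhom_to_fract) (simp add: P1_def)

lemma meval_Fw_p0:
  fixes t :: "'a::{alg_closed_field,char2}"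
  assumes "cv t (fv p)"
  shows "meval (Fw t) (p0 p) = 0"
proof -
  have "fps_to_fls (peval fps_const p (Fw t)) = 0" using peval_Fw [OF assms] unfolding peval_fv .
  then show ?thesis using peval_fps_nth_0 [of p "Fw t"] by simp
qed

context upoint
begin

lemma p0_neq_0: "p0 p \<noteq> (\<lambda>_. 0)"
  using nz by auto

lemma P_in_points: "P \<in> points (Fw t)"
  unfolding points_def using meval_Fw_p0 [OF cv] p0_neq_0 by blast

text \<open>Where both representatives are defined they give the same point, and elsewhere both
  products are 0; so the minor vanishes at all points and hence generically.\<close>

lemma represents_cross:
  assumes "represents UNIV (Fw t) G f" "represents UNIV (Fw t) G' f"
  shows "ev (G (0::2)) * ev (G' 1) = ev (G 1) * ev (G' 0)"
proof -
  obtain d d' where d: "\<And>i. form UNIV d (G i)" "\<And>i. form UNIV d' (G' i)"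
    using assms unfolding represents_def by blast
  have f: "f (proj_point x) = proj_point (\<lambda>i. meval (G i) x)"
    if "x \<noteq> (\<lambda>_. 0)" "meval (Fw t) x = 0" "meval (G i) x \<noteq> 0" for x i
    using assms(1) that unfolding represents_def by blast
  have f': "f (proj_point x) = proj_point (\<lambda>i. meval (G' i) x)"
    if "x \<noteq> (\<lambda>_. 0)" "meval (Fw t) x = 0" "meval (G' i) x \<noteq> 0" for x i
    using assms(2) that unfolding represents_def by blast
  interpret m: rhom "\<lambda>A. meval A x" for x :: "3 \<Rightarrow> 'a"
    unfolding meval_eq_peval by (rule rhom.rhom_peval [OF rhom_ident])
  have "ev (G 0 * G' 1 - G 1 * G' 0) = 0"
  proof (rule form_vanishing_on_points [OF _ cv])
    show "form UNIV (d + d') (G 0 * G' 1 - G 1 * G' 0)"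
      by (intro form_diff form_mult d)
    fix x :: "3 \<Rightarrow> 'a" assume x: "x \<noteq> (\<lambda>_. 0)" "meval (Fw t) x = 0"
    have "meval (G 0) x * meval (G' 1) x = meval (G 1) x * meval (G' 0) x"
    proof (cases "(\<exists>i. meval (G i) x \<noteq> 0) \<and> (\<exists>i. meval (G' i) x \<noteq> 0)")
      case True
      then have "proj_point (\<lambda>i. meval (G i) x) = proj_point (\<lambda>i. meval (G' i) x)"
        using f [OF x] f' [OF x] by metis
      then obtain c where "(\<lambda>i. meval (G' i) x) = (\<lambda>i. c * meval (G i) x)" using proj_point_eqD by blast
      then have "meval (G' i) x = c * meval (G i) x" for i by (rule fun_cong)
      then show ?thesis by (simp only: ac_simps)
    qed auto
    then show "meval (G 0 * G' 1 - G 1 * G' 0) x = 0" by (simp only: m.hom_diff m.hom_mult diff_self)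
  qed
  then have "ev (G 0) * ev (G' 1) - ev (G 1) * ev (G' 0) = 0" by (simp only: ev.hom_diff ev.hom_mult)
  then show ?thesis by (simp only: right_minus_eq)
qed

lemma represents_proportional:
  assumes "represents UNIV (Fw t) G f" "represents UNIV (Fw t) G' f" "ev (G k) \<noteq> 0"
  obtains c where "\<And>i :: 2. ev (G' i) = c * ev (G i)"
proof -
  have "ev (G' i) = ev (G' k) / ev (G k) * ev (G i)" for i
    using represents_cross [OF assms(1,2)] assms(3) exhaust_2 [of i] exhaust_2 [of k]
    by (auto simp: field_simps)
  then show ?thesis by (rule that)
qed

lemma peval_ev: "peval fls_const (\<lambda>i. ev (G i)) a = ev (peval mconst G a)" for G :: "2 \<Rightarrow> (3, 'a) mpoly"
  by (rule fls_hom.peval_peval [symmetric])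

lemma meval_peval: "meval (peval mconst G a) x = meval a (\<lambda>i. meval (G i) x)" for G :: "2 \<Rightarrow> (3, 'a) mpoly"
  unfolding meval_eq_peval by (rule rhom.peval_peval [OF rhom_ident])

context
  fixes f and G :: "2 \<Rightarrow> (3, 'a) mpoly" and D k
  assumes G: "\<And>i. form UNIV D (G i)" and rep: "represents UNIV (Fw t) G f"
    and Gk: "meval (G k) (p0 p) \<noteq> 0"
begin

definition "q i = meval (G i) (p0 p)"

lemma image_P: "f P = proj_point q"
  using rep p0_neq_0 meval_Fw_p0 [OF cv] Gk unfolding represents_def q_def by blast

lemma evG_k: "ev (G k) \<noteq> 0" "fls_subdegree (ev (G k)) = 0"
  using ev_unit_iff Gk by blast+

text \<open>The pullback of the linear form that vanishes at the image point.\<close>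

definition "N = fls_const (q 1) * ev (G 0) + fls_const (q 0) * ev (G 1)"

lemma N_ge: "vge N 1"
proof -
  have N: "N = ev (mconst (q 1) * G 0 + mconst (q 0) * G 1)" by (simp add: N_def ev.hom_simps)
  have "meval (mconst (q 1) * G 0 + mconst (q 0) * G 1) (p0 p) = 0"
    by (simp add: q_def meval_eq_peval rhom.peval_add [OF rhom_ident] rhom.peval_mult [OF rhom_ident]
        rhom.peval_mconst [OF rhom_ident])
  then have "\<not> (N \<noteq> 0 \<and> fls_subdegree N = 0)" unfolding N using ev_unit_iff by blast
  then show ?thesis using ev_nonneg [of "mconst (q 1) * G 0 + mconst (q 0) * G 1"]
    unfolding N [symmetric] by (auto simp: vge_iff)
qed

text \<open>A form vanishing at the image point is a combination of linear forms that pull back to 0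
  or a constant multiple of \<open>N\<close>.\<close>

lemma vanishing_ge:
  assumes a: "form UNIV d a" and 0: "meval a q = 0" and N: "vge N e"
  shows "vge (peval fls_const (\<lambda>i. ev (G i)) a) e"
proof -
  define q' where "q' i = inverse (q k) * q i" for i
  have qk: "q k \<noteq> 0" using Gk by (simp add: q_def)
  then have q'k: "q' k = 1" by (simp add: q'_def)
  have "meval a q' = 0" using meval_scale [OF a, of "inverse (q k)" q] 0 by (simp add: q'_def [abs_def])
  then obtain B where B: "a = (\<Sum>i\<in>UNIV. (mvar i - mconst (q' i) * mvar k) * B i)"
    using form_at_point [where q = q' and k = k, OF a q'k] by auto
  let ?g = "peval fls_const (\<lambda>i. ev (G i)) :: (2, 'a) mpoly \<Rightarrow> 'a fls"
  interpret g: rhom ?g by (rule rhom_fls_eval)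
  have lin: "vge (?g (mvar i - mconst (q' i) * mvar k)) e" for i
  proof -
    have "fls_const (q k) * ?g (mvar i - mconst (q' i) * mvar k) = fls_const (q k) * ev (G i) + fls_const (q k) * fls_const (q' i) * ev (G k)"
      by (simp only: diff_char2 g.hom_add g.hom_mult fls_hom.peval_mvar fls_hom.peval_mconst distrib_left mult.assoc)
    also have "fls_const (q k) * fls_const (q' i) = fls_const (q i)"
    proof -
      have "q k * q' i = q i" using qk by (simp add: q'_def)
      then show ?thesis by (simp only: fls_const_mult_const)
    qed
    \<comment> \<open>There are only two coordinates: \<open>i = k\<close> gives 0, the other index
      gives the determinant.\<close>
    also have "fls_const (q k) * ev (G i) + fls_const (q i) * ev (G k) \<in> {0, N}"
      using exhaust_2 [of i] exhaust_2 [of k] by (auto simp: N_def add.commute)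
    finally have "vge (fls_const (q k) * ?g (mvar i - mconst (q' i) * mvar k)) e" using N by auto
    then show ?thesis using qk by (auto simp: vge_iff)
  qed
  have "?g a = (\<Sum>i\<in>UNIV. ?g (mvar i - mconst (q' i) * mvar k) * ?g (B i))"
    unfolding B by (simp only: g.hom_sum g.hom_mult)
  also have "\<dots> = ?g (mvar 0 - mconst (q' 0) * mvar k) * ?g (B 0) + ?g (mvar 1 - mconst (q' 1) * mvar k) * ?g (B 1)"
    unfolding UNIV_2 by simp
  also have "vge \<dots> e"
    unfolding peval_ev [of G "B _"]
    by (intro vge_add vge_mult' [OF lin ev_nonneg]) simp_all
  finally show ?thesis .
qed

text \<open>The maximal ideal at the image pulls back to orders at least that of \<open>N\<close>,
  and the linear form defining \<open>N\<close> over the coordinate \<open>k\<close> attains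
  it.\<close>

lemma ramification_index_N:
  assumes N0: "N \<noteq> 0"
  shows "int (ramification_index (Fw t) P1 f P) = fls_subdegree N"
proof -
  define e where "e = nat (fls_subdegree N)"
  have e: "fls_subdegree N = int e" "e > 0" using N_ge N0 by (simp_all add: vge_iff e_def)
  let ?g = "peval fls_const (\<lambda>i. ev (G i)) :: (2, 'a) mpoly \<Rightarrow> 'a fls"
  interpret g: rhom ?g by (rule rhom_fls_eval)
  let ?S = "pullback UNIV (Fw t) P1 f (max_ideal UNIV P1 (f P))"
  have "?S \<subseteq> filt (int e)"
  proof
    fix h assume "h \<in> ?S"
    then obtain a b G' d where h: "h = rat UNIV (Fw t) (msubst a G') (msubst b G')"
      and ab: "form UNIV d a" "form UNIV d b" "\<not> P1 dvd b" "rat UNIV P1 a b \<in> max_ideal UNIV P1 (f P)"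
      and G': "represents UNIV (Fw t) G' f" "\<not> Fw t dvd msubst b G'"
      unfolding pullback_def by blast
    \<comment> \<open>In the given fraction \<open>b\<close> may vanish at the image point;
      membership in the maximal ideal supplies an equal fraction whose denominator does not.\<close>
    obtain a' b' d' where ab': "rat UNIV P1 a b = rat UNIV P1 a' b'" "form UNIV d' a'" "form UNIV d' b'"
      "meval b' q \<noteq> 0" "meval a' q = 0"
      using ab(4) vanishes_at_proj_point unfolding max_ideal_def image_P by blast
    have "b' \<noteq> 0" using ab'(4) by (auto simp: meval_def)
    then have fr: "P1.fracs a b" "P1.fracs a' b'"
      unfolding P1.fracs_def using ab ab' by (auto simp: P1_def)
    have "to_fract a / to_fract b = to_fract a' / to_fract b'"
      using ab'(1) P1.rat_eq_iff [OF fr] by blast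
    then have "to_fract a * to_fract b' = to_fract a' * to_fract b"
      using P1.fracs_E [OF fr(1)] P1.fracs_E [OF fr(2)] by (simp add: frac_eq_eq)
    then have "a * b' = a' * b" by (simp flip: to_fract_mult)
    then have cross: "?g a * ?g b' = ?g a' * ?g b" by (simp flip: g.hom_mult)
    obtain D' where D': "\<And>i. form UNIV D' (G' i)" using G'(1) unfolding represents_def by blast
    obtain c where c: "\<And>i. ev (G' i) = c * ev (G i)"
      using represents_proportional [OF rep G'(1) evG_k(1)] by blast
    have evs: "ev (msubst r G') = c ^ d * ?g r" if "form UNIV d r" for r
      unfolding msubst_eq_peval peval_ev [symmetric] c by (rule fls_hom.peval_scale [OF that])
    have forms: "form UNIV (D' * d) (msubst a G')" "form UNIV (D' * d) (msubst b G')"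
      unfolding msubst_eq_peval using ab D' by (intro form_peval_mconst; simp)+
    have nz: "ev (msubst b G') \<noteq> 0" using G'(2) ev_dvd [OF forms(2)] by blast
    then have cb: "c ^ d \<noteq> 0" "?g b \<noteq> 0" unfolding evs [OF ab(2)] by auto
    have fr': "fracs (msubst a G') (msubst b G')" using forms nz by (rule fracsI)
    have b': "?g b' \<noteq> 0" "fls_subdegree (?g b') = 0"
      using ev_unit_iff [of "peval mconst G b'"] ab'(4) unfolding peval_ev meval_peval q_def [abs_def] by auto
    have "\<Phi> h = ?g a / ?g b" unfolding h Phi_rat [OF fr'] evs [OF ab(1)] evs [OF ab(2)] by (rule mult_divide_mult_cancel_left [OF cb(1)])
    also have "\<dots> = ?g a' / ?g b'" using cross cb b' by (simp add: frac_eq_eq)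
    finally have Ph: "\<Phi> h = ?g a' / ?g b'" .
    have "vge (?g a') (int e)" by (rule vanishing_ge [OF ab'(2,5)]) (simp add: vge_iff e)
    then have "vge (\<Phi> h) (int e)" unfolding Ph using b' by (auto simp: vge_iff fls_divide_subdegree)
    then show "h \<in> filt (int e)" using rat_mem [OF fr'] h by (simp add: filt_def)
  qed
  moreover
  define a where "a = mconst (q 1) * mvar 0 + mconst (q 0) * (mvar 1 :: (2, 'a) mpoly)"
  define b where "b = (mvar k :: (2, 'a) mpoly)"
  define h where "h = rat UNIV (Fw t) (msubst a G) (msubst b G)"
  have ab: "form UNIV 1 a" "form UNIV 1 b"
    unfolding a_def b_def by (intro form_add form_smult form_mvar; simp)+
  have ga: "ev (msubst a G) = N" "ev (msubst b G) = ev (G k)"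
    unfolding msubst_eq_peval peval_ev [symmetric] a_def b_def
    by (simp_all add: fls_hom.peval_add fls_hom.peval_mult N_def)
  have forms: "form UNIV (D * 1) (msubst a G)" "form UNIV (D * 1) (msubst b G)"
    unfolding msubst_eq_peval by (intro form_peval_mconst ab G)+
  have fr: "fracs (msubst a G) (msubst b G)" using forms by (rule fracsI) (simp add: ga evG_k)
  have "h \<in> ?S"
  proof -
    have "meval a q = 0" "meval b q \<noteq> 0"
      using Gk by (simp_all add: a_def b_def q_def meval_eq_peval rhom.peval_add [OF rhom_ident]
        rhom.peval_mult [OF rhom_ident] rhom.peval_mconst [OF rhom_ident] rhom.peval_mvar [OF rhom_ident])
    then have "rat UNIV P1 a b \<in> max_ideal UNIV P1 (f P)"
      unfolding max_ideal_def image_P using ab vanishes_at_proj_point [OF ab(1)] vanishes_at_proj_point [OF ab(2)] by blast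
    moreover have "\<not> P1 dvd b" using \<open>meval b q \<noteq> 0\<close> by (auto simp: P1_def meval_def)
    moreover have "\<not> Fw t dvd msubst b G" using fr by (simp add: fracs_def)
    ultimately show ?thesis unfolding pullback_def h_def using ab rep by blast
  qed
  moreover have "\<Phi> h = N / ev (G k)" unfolding h_def Phi_rat [OF fr] ga ..
  then have "\<Phi> h \<noteq> 0" "fls_subdegree (\<Phi> h) = int e"
    using N0 e evG_k by (simp_all add: fls_divide_subdegree)
  ultimately have "ramification_index (Fw t) P1 f P = e"
    using e(2) by (intro ramification_index_eq)
  then show ?thesis using e by simp
qed

text \<open>\<open>G\<close> is a local representative and computes the index, \<open>G'\<close> is
  a global one; being proportional they have the same ratio. The constant is the value at the point,
  or 0 at a pole, where the ratio has the negative of the order of \<open>N\<close>.\<close>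

lemma tame_odd:
  assumes tame: "odd (ramification_index (Fw t) P1 f P)"
    and G': "represents UNIV (Fw t) G' f"
    and nonconst: "\<And>c0 c1. c0 \<noteq> 0 \<or> c1 \<noteq> 0 \<Longrightarrow> fls_const c1 * ev (G' 0) + fls_const c0 * ev (G' 1) \<noteq> 0"
  shows "ev (G' 1) \<noteq> 0 \<and> (\<exists>c0. odd (fls_subdegree (ev (G' 0) / ev (G' 1) + fls_const c0)))"
proof -
  obtain c where c: "\<And>i. ev (G' i) = c * ev (G i)"
    using represents_proportional [OF rep G' evG_k(1)] by blast
  have G'1: "ev (G' 1) \<noteq> 0" using nonconst [of 1 0] by simp
  then have c0: "c \<noteq> 0" and G1: "ev (G 1) \<noteq> 0" using c [of 1] by auto
  have ratio: "ev (G' 0) / ev (G' 1) = ev (G 0) / ev (G 1)" using c0 by (simp add: c)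
  have qk: "q k \<noteq> 0" using Gk by (simp add: q_def)
  have q01: "q 0 \<noteq> 0 \<or> q 1 \<noteq> 0" using qk exhaust_2 [of k] by auto
  have "c * N = fls_const (q 1) * ev (G' 0) + fls_const (q 0) * ev (G' 1)"
    by (simp add: N_def c algebra_simps)
  then have N0: "N \<noteq> 0" using nonconst [OF q01] by auto
  have odd: "odd (fls_subdegree N)" using ramification_index_N [OF N0] tame by (metis even_of_nat)
  have "\<exists>c0. odd (fls_subdegree (ev (G 0) / ev (G 1) + fls_const c0))"
  proof (cases "q 1 = 0")
    case True
    then have "q 0 \<noteq> 0" using q01 by simp
    then have g0: "ev (G 0) \<noteq> 0" "fls_subdegree (ev (G 0)) = 0" using ev_unit_iff [of "G 0"] by (auto simp: q_def)
    have "fls_subdegree (ev (G 1)) = fls_subdegree N"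
      using True \<open>q 0 \<noteq> 0\<close> G1 by (simp add: N_def)
    then have "odd (fls_subdegree (ev (G 0) / ev (G 1) + fls_const 0))"
      using odd g0 G1 by (simp add: fls_divide_subdegree)
    then show ?thesis by blast
  next
    case False
    then have g1: "fls_subdegree (ev (G 1)) = 0" using ev_unit_iff [of "G 1"] by (auto simp: q_def)
    have "fls_const (q 1) * fls_const (q 0 / q 1) = fls_const (q 0)"
      using False by (simp add: fls_const_mult_const)
    then have "fls_const (q 1) * ev (G 1) * (ev (G 0) / ev (G 1) + fls_const (q 0 / q 1)) = N"
      using G1 by (simp add: N_def distrib_left mult.left_commute [of _ "ev (G 1)"])
    then have eq: "ev (G 0) / ev (G 1) + fls_const (q 0 / q 1) = N / (fls_const (q 1) * ev (G 1))"
      using G1 False by (simp add: field_simps)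
    have "fls_subdegree (N / (fls_const (q 1) * ev (G 1))) = fls_subdegree N"
      using N0 G1 g1 False by (simp add: fls_divide_subdegree)
    then show ?thesis using odd eq by metis
  qed
  then show ?thesis using G'1 ratio by simp
qed

end

end

section \<open>Discrete valuation rings at the three kinds of branches\<close>

definition pt :: "'a \<Rightarrow> 'a \<Rightarrow> 'a \<Rightarrow> 3 \<Rightarrow> 'a" where
  "pt a b c i = (if i = 0 then a else if i = 1 then b else c)"

lemma pt_simps [simp]: "pt a b c 0 = a" "pt a b c 1 = b" "pt a b c 2 = c"
  by (simp_all add: pt_def)

lemma fps_to_fls_regpart: "vge f 0 \<Longrightarrow> fps_to_fls (fls_regpart f) = f"
  by (rule fls_eqI) (auto simp: vge_def)

text \<open>For \<open>zz = 1\<close> this comes from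
  \<open>y^2 + x y + b^2 + a b = (y + b) (y + b + x) + b (x + a)\<close>; the terms in
  \<open>x\<close> alone contribute multiples of \<open>x + a\<close>.\<close>

lemma affine_factorization:
  fixes a b T xx yy zz :: "'a::{comm_ring_1,char2}"
  assumes "b^2 + a * b = a^3 + T * a^2 + 1"
  shows "yy^2 * zz + xx * yy * zz + xx^3 + T * xx^2 * zz + zz^3 =
    (yy + b * zz + xx) * zz * (yy + b * zz) + (xx + a * zz) * (xx^2 + a * xx * zz + a^2 * zz^2 + T * (xx + a * zz) * zz + b * zz^2)"
proof -
  have "(yy + b * zz + xx) * zz * (yy + b * zz) + (xx + a * zz) * (xx^2 + a * xx * zz + a^2 * zz^2 + T * (xx + a * zz) * zz + b * zz^2)
    = yy^2 * zz + xx * yy * zz + xx^3 + T * xx^2 * zz + zz^3 * (b^2 + a * b + (a^3 + T * a^2))"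
    by (simp add: algebra_simps power2_eq_square power3_eq_cube)
  also have "b^2 + a * b + (a^3 + T * a^2) = 1" unfolding assms by (simp add: add.assoc add.left_commute)
  finally show ?thesis by simp
qed

lemma Fw_conv: "Fw t = mvar 1 ^ 2 * mvar 2 + mvar 0 * mvar 1 * mvar 2 + mvar 0 ^ 3 + mconst t * mvar 0 ^ 2 * mvar 2 + mvar 2 ^ 3"
  for t :: "'a::{field,char2}"
  by (simp add: weierstrass_def Let_def add.assoc)

lemma form_mult_linear: "form UNIV 1 A \<Longrightarrow> form UNIV 1 B \<Longrightarrow> form UNIV 2 (A * B)"
  and form_square_linear: "form UNIV 1 A \<Longrightarrow> form UNIV 2 (A ^ 2)" for A B :: "('v::finite, 'a::field) mpoly"
  using P1.form_mult [of 1 A 1 B] P1.form_power [of 1 A 2] by (simp_all add: numeral_2_eq_2)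

definition branch_at :: "'a::comm_ring_1 \<Rightarrow> 'a fls \<Rightarrow> 'a fls \<Rightarrow> bool" where
  "branch_at t x y \<longleftrightarrow> (\<exists>x0. affine_at t x0 x y) \<or> torsion_at t x y \<or> infinity_at t x y"

context
  fixes t :: "'a::{alg_closed_field,char2}"
begin

text \<open>The parameter is \<open>x + x0\<close>, and the cofactor of \<open>y + y0\<close> has
  the value \<open>x0\<close> at the point, which is nonzero.\<close>

lemma upoint_affine:
  assumes "affine_at t x0 x y"
  shows "\<exists>p l. upoint t p l \<and> x = fv p 0 / fv p 2 \<and> y = fv p 1 / fv p 2"
proof -
  define p where "p = pt (fps_const x0 + fps_X) (fls_regpart y) (1 :: 'a fps)"
  have x: "x = fls_const x0 + fls_X" "on_curve t x y" and y: "fps_to_fls (fls_regpart y) = y"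
    using assms by (auto simp: affine_at_def fps_to_fls_regpart)
  have fv: "fv p 0 = x" "fv p 1 = y" "fv p 2 = 1"
    by (simp_all add: fv_def p_def x y rhom.hom_add [OF rhom_fps_to_fls] rhom.hom_1 [OF rhom_fps_to_fls])
  have cv: "cv t (fv p)" using affine_at_neq_0 [OF assms] x by (simp add: cv_def fv)
  define y0 where "y0 = fps_nth (fls_regpart y) 0"
  have p0: "p0 p 0 = x0" "p0 p 1 = y0" "p0 p 2 = 1" by (simp_all add: p0_def p_def y0_def)
  have "y0^2 + x0 * y0 + (x0^3 + t * x0^2 + 1) = 0"
    using meval_Fw_p0 [OF cv] by (simp add: meval_eq_peval peval_weierstrass [OF rhom_ident] p0)
  then have "y0^2 + x0 * y0 = x0^3 + t * x0^2 + 1" by (simp only: add_eq_0_char2)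
  then have "mconst (y0^2 + x0 * y0) = (mconst (x0^3 + t * x0^2 + 1) :: (3, 'a) mpoly)" by (simp only:)
  then have eq: "mconst y0^2 + mconst x0 * mconst y0 = mconst x0^3 + mconst t * mconst x0^2 + (1 :: (3, 'a) mpoly)"
    by (simp only: rhom.hom_add [OF rhom_mconst] rhom.hom_mult [OF rhom_mconst] rhom.hom_power [OF rhom_mconst] rhom.hom_1 [OF rhom_mconst])
  have "upoint t p (mvar 0 + mconst (p0 p 0) * mvar 2)"
  proof (rule upointI [where b = 1, OF cv])
    show "p0 p 2 = 1" by (simp add: p0)
    show "UNIV = {2, 0, 1 :: 3}" unfolding UNIV_3 by auto
    show "fv p 0 + fls_const (p0 p 0) * fv p 2 = fls_X" by (simp add: fv p0 x)
    let ?u = "(mvar 1 + mconst y0 * mvar 2 + mvar 0) * mvar 2 :: (3, 'a) mpoly"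
    let ?m = "mvar 0 ^ 2 + mconst x0 * mvar 0 * mvar 2 + mconst x0 ^ 2 * mvar 2 ^ 2 + mconst t * (mvar 0 + mconst x0 * mvar 2) * mvar 2 + mconst y0 * mvar 2 ^ 2 :: (3, 'a) mpoly"
    show "form UNIV 2 ?u" by (intro P1.form_add P1.form_smult P1.form_mvar UNIV_I form_mult_linear form_square_linear)
    show "meval ?u (p0 p) \<noteq> 0"
      using assms by (simp add: meval_eq_peval rhom.hom_simps [OF rhom.rhom_peval [OF rhom_ident]]
        rhom.peval_mvar [OF rhom_ident] rhom.peval_mconst [OF rhom_ident] p0 affine_at_def)
    have "?m = mvar 0 ^ 2 + mconst x0 * (mvar 0 * mvar 2) + mconst (x0^2) * mvar 2 ^ 2 + mconst t * ((mvar 0 + mconst x0 * mvar 2) * mvar 2) + mconst y0 * mvar 2 ^ 2"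
      by (simp add: rhom.hom_power [OF rhom_mconst] mult.assoc)
    also have "form UNIV 2 \<dots>" by (intro P1.form_add P1.form_smult P1.form_mvar UNIV_I form_mult_linear form_square_linear)
    finally show "form UNIV 2 ?m" .
    show "Fw t = ?u * (mvar 1 + mconst (p0 p 1) * mvar 2) + (mvar 0 + mconst (p0 p 0) * mvar 2) * ?m"
      unfolding Fw_conv p0 by (rule affine_factorization [OF eq])
  qed simp_all
  then show ?thesis by (intro exI [of _ p] exI conjI) (simp_all add: fv)
qed

text \<open>\<open>x\<close> has order 2 here, so the parameter is \<open>y + 1\<close>; the
  cofactor of \<open>x\<close> has value 1.\<close>

lemma upoint_torsion:
  assumes "torsion_at t x y"
  shows "\<exists>p l. upoint t p l \<and> x = fv p 0 / fv p 2 \<and> y = fv p 1 / fv p 2"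
proof -
  define p where "p = pt (fls_regpart x) (1 + fps_X) (1 :: 'a fps)"
  have y: "y = 1 + fls_X" "on_curve t x y" "fls_subdegree x = 2" using assms by (auto simp: torsion_at_def)
  then have x: "fps_to_fls (fls_regpart x) = x" by (intro fps_to_fls_regpart) (simp add: vge_iff)
  have fv: "fv p 0 = x" "fv p 1 = y" "fv p 2 = 1"
    by (simp_all add: fv_def p_def x y rhom.hom_add [OF rhom_fps_to_fls] rhom.hom_1 [OF rhom_fps_to_fls])
  have cv: "cv t (fv p)" using torsion_at_neq_0 [OF assms] y by (simp add: cv_def fv)
  have p0: "p0 p 0 = 0" "p0 p 1 = 1" "p0 p 2 = 1" using y(3) by (simp_all add: p0_def p_def)
  have "upoint t p (mvar 1 + mconst (p0 p 1) * mvar 2)"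
  proof (rule upointI [where b = 0, OF cv])
    show "p0 p 2 = 1" by (simp add: p0)
    show "UNIV = {2, 1, 0 :: 3}" unfolding UNIV_3 by auto
    show "fv p 1 + fls_const (p0 p 1) * fv p 2 = fls_X" by (simp add: fv p0 y add.assoc add.left_commute)
    let ?u = "mvar 1 * mvar 2 + mvar 0 ^ 2 + mconst t * (mvar 0 * mvar 2) :: (3, 'a) mpoly"
    let ?m = "(mvar 1 + mvar 2) * mvar 2 :: (3, 'a) mpoly"
    show "form UNIV 2 ?u" by (intro P1.form_add P1.form_smult P1.form_mvar UNIV_I form_mult_linear form_square_linear)
    show "form UNIV 2 ?m" by (intro P1.form_add P1.form_mvar form_mult_linear form_square_linear)
    show "meval ?u (p0 p) \<noteq> 0"
      by (simp add: meval_eq_peval rhom.hom_simps [OF rhom.rhom_peval [OF rhom_ident]]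
        rhom.peval_mvar [OF rhom_ident] rhom.peval_mconst [OF rhom_ident] p0)
    show "Fw t = ?u * (mvar 0 + mconst (p0 p 0) * mvar 2) + (mvar 1 + mconst (p0 p 1) * mvar 2) * ?m"
      unfolding Fw_conv p0 by (simp add: algebra_simps power2_eq_square power3_eq_cube)
  qed simp_all
  then show ?thesis by (intro exI [of _ p] exI conjI) (simp_all add: fv)
qed

lemma upoint_infinity:
  assumes "infinity_at t x y"
  shows "\<exists>p l. upoint t p l \<and> x = fv p 0 / fv p 2 \<and> y = fv p 1 / fv p 2"
proof -
  define p where "p = pt fps_X (1 :: 'a fps) (fls_regpart (1 / y))"
  have y: "y = x * fls_X_inv" "on_curve t x y" "fls_subdegree x = - 2" using assms by (auto simp: infinity_at_def)
  then have x0: "x \<noteq> 0" by auto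
  then have y0: "y \<noteq> 0" "fls_subdegree y = - 3" using y by simp_all
  then have z: "fls_subdegree (1 / y) = 3" by (simp add: fls_divide_subdegree)
  then have z': "fps_to_fls (fls_regpart (1 / y)) = 1 / y" by (intro fps_to_fls_regpart) (simp add: vge_iff)
  have fv: "fv p 0 = fls_X" "fv p 1 = 1" "fv p 2 = 1 / y"
    by (simp_all add: fv_def p_def z')
  have "fls_X * y = x" unfolding y(1) by (simp add: mult.left_commute [of fls_X] fls_X_inv_conv_shift_1 fls_X_conv_shift_1 fls_shifted_times_simps)
  then have xy: "x = fv p 0 / fv p 2" "y = fv p 1 / fv p 2" using y0 by (simp_all add: fv)
  have cv: "cv t (fv p)" using infinity_at_subdegree [OF assms] y y0 unfolding cv_def xy [symmetric] by (simp add: fv)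
  have "fps_nth (fls_regpart (1 / y)) 0 = 0" using z by simp
  then have p0: "p0 p 0 = 0" "p0 p 1 = 1" "p0 p 2 = 0" by (simp_all add: p0_def p_def)
  have "upoint t p (mvar 0 + mconst (p0 p 0) * mvar 1)"
  proof (rule upointI [where b = 2, OF cv])
    show "p0 p 1 = 1" by (simp add: p0)
    show "UNIV = {1, 0, 2 :: 3}" unfolding UNIV_3 by auto
    show "fv p 0 + fls_const (p0 p 0) * fv p 1 = fls_X" by (simp add: fv p0)
    let ?u = "mvar 1 ^ 2 + mvar 0 * mvar 1 + mvar 2 ^ 2 + mconst t * mvar 0 ^ 2 :: (3, 'a) mpoly"
    let ?m = "mvar 0 ^ 2 :: (3, 'a) mpoly"
    show "form UNIV 2 ?u" by (intro P1.form_add P1.form_smult P1.form_mvar UNIV_I form_mult_linear form_square_linear)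
    show "form UNIV 2 ?m" by (intro P1.form_mvar form_mult_linear form_square_linear)
    show "meval ?u (p0 p) \<noteq> 0"
      by (simp add: meval_eq_peval rhom.hom_simps [OF rhom.rhom_peval [OF rhom_ident]]
        rhom.peval_mvar [OF rhom_ident] rhom.peval_mconst [OF rhom_ident] p0)
    show "Fw t = ?u * (mvar 2 + mconst (p0 p 2) * mvar 1) + (mvar 0 + mconst (p0 p 0) * mvar 1) * ?m"
      unfolding Fw_conv p0 by (simp add: algebra_simps power2_eq_square power3_eq_cube)
  qed simp_all
  then show ?thesis using xy by blast
qed

lemma branch_upoint:
  assumes "branch_at t x y"
  obtains p l where "upoint t p l" "x = fv p 0 / fv p 2" "y = fv p 1 / fv p 2"
  using assms upoint_affine upoint_torsion upoint_infinity unfolding branch_at_def by blast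

end

section \<open>Separability\<close>

context fn_field
begin

lemma Phi_pow: "x \<in> carrier L \<Longrightarrow> \<Phi> (x [^]\<^bsub>L\<^esub> (n::nat)) = \<Phi> x ^ n"
proof -
  assume x: "x \<in> carrier L"
  interpret L: cring L by (rule cring_L)
  show ?thesis
    by (induction n) (simp_all add: Phi_one Phi_mult x mult.commute)
qed

text \<open>Under \<open>\<Phi>\<close> an algebraic relation over \<open>S\<close> becomes a
  polynomial with constant coefficients that vanishes at \<open>\<Phi> x\<close>. The work lies in
  passing from coefficient lists to \<open>hpoly\<close>.\<close>

lemma transcendental_over_constants:
  fixes \<phi> :: "'c::field \<Rightarrow> 'S"
  assumes \<phi>: "rhom \<phi>" and S: "S \<subseteq> carrier L" "\<And>h. h \<in> S \<Longrightarrow> \<Phi> h \<in> range \<phi>"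
    and x: "x \<in> carrier L" and inj: "\<And>p. p \<noteq> 0 \<Longrightarrow> hpoly \<phi> (\<Phi> x) p \<noteq> 0"
  shows "(ring.transcendental L over S) x"
proof -
  interpret \<phi>: rhom \<phi> by (rule \<phi>)
  interpret L: cring L by (rule cring_L)
  define cc where "cc h = (SOME c. \<Phi> h = \<phi> c)" for h
  have cc: "\<Phi> h = \<phi> (cc h)" if "h \<in> S" for h
    unfolding cc_def using S(2) [OF that] by (rule_tac someI_ex) blast
  have Poly_snoc: "hpoly \<phi> w (Poly (as @ [a])) = hpoly \<phi> w (Poly as) + \<phi> a * w ^ length as" for w a and as :: "'c list"
    by (induction as) (simp_all add: algebra_simps)
  have ev: "\<Phi> (L.eval p x) = hpoly \<phi> (\<Phi> x) (Poly (rev (map cc p)))" if "set p \<subseteq> S" for p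
    using that
  proof (induction p)
    case Nil
    then show ?case by (simp add: Phi_zero)
  next
    case (Cons a p)
    then have "a \<in> carrier L" "L.eval p x \<in> carrier L"
      using S(1) x by (auto intro!: L.eval_in_carrier)
    then show ?case using Cons x
      by (simp add: Phi_add Phi_mult Phi_pow cc Poly_snoc add.commute)
  qed
  \<comment> \<open>A nonzero leading coefficient yields a nonzero constant, so \<open>Poly\<close>
    trims nothing and the list can be recovered.\<close>
  have coeffs: "coeffs (Poly (rev (map cc p))) = rev (map cc p)" if "polynomial\<^bsub>L\<^esub> S p" for p
  proof (cases p)
    case (Cons a p')
    then have a: "a \<in> S" "a \<noteq> \<zero>\<^bsub>L\<^esub>" using that by (auto simp: polynomial_def)
    have "cc a \<noteq> 0"
    proof
      assume "cc a = 0"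
      then have "\<Phi> a = \<Phi> \<zero>\<^bsub>L\<^esub>" using cc [OF a(1)] by (simp add: Phi_zero \<phi>.hom_0)
      then show False using a S Phi_inj by blast
    qed
    then show ?thesis by (simp add: Cons)
  qed simp
  have "inj_on (\<lambda>p. L.eval p x) (carrier (univ_poly L S))"
  proof (rule inj_onI)
    fix p q assume "p \<in> carrier (univ_poly L S)" "q \<in> carrier (univ_poly L S)" and eq: "L.eval p x = L.eval q x"
    then have pq: "polynomial\<^bsub>L\<^esub> S p" "polynomial\<^bsub>L\<^esub> S q" by (simp_all add: univ_poly_carrier)
    then have sub: "set p \<subseteq> S" "set q \<subseteq> S" by (auto simp: polynomial_def)
    let ?P = "\<lambda>p. Poly (rev (map cc p))"
    have "hpoly \<phi> (\<Phi> x) (?P p - ?P q) + hpoly \<phi> (\<Phi> x) (?P q) = hpoly \<phi> (\<Phi> x) (?P p)"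
      by (simp flip: \<phi>.hpoly_add)
    also have "\<dots> = hpoly \<phi> (\<Phi> x) (?P q)" using eq ev [OF sub(1)] ev [OF sub(2)] by simp
    finally have "hpoly \<phi> (\<Phi> x) (?P p - ?P q) = 0" by simp
    then have "?P p = ?P q" using inj [of "?P p - ?P q"] by (metis right_minus_eq)
    then have "rev (map cc p) = rev (map cc q)" using coeffs [OF pq(1)] coeffs [OF pq(2)] by metis
    then have "map cc p = map cc q" by simp
    moreover have "inj_on cc (set p \<union> set q)"
    proof (rule inj_onI)
      fix g h assume gh: "g \<in> set p \<union> set q" "h \<in> set p \<union> set q" and eq: "cc g = cc h"
      then have "g \<in> S" "h \<in> S" using sub by auto
      moreover from this have "\<Phi> g = \<Phi> h" using cc eq by simp
      ultimately show "g = h" using S(1) Phi_inj by blast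
    qed
    ultimately show "p = q" by (rule map_inj_on)
  qed
  then show ?thesis by (simp add: L.transcendental_def over_def)
qed

end

text \<open>A linear relation would make \<open>f\<close> constant and all pulled back functions
  constants, over which \<open>x\<close> is transcendental; a separable extension is
  algebraic.\<close>

lemma (in upoint) separable_imp_nonconstant:
  fixes f and G :: "2 \<Rightarrow> (3, 'a) mpoly"
  assumes k: "subfield_set k" and sep: "separable_morphism k (Fw t) P1 f"
    and G: "represents k (Fw t) G f" "ev (G j) \<noteq> 0" and c: "c0 \<noteq> 0 \<or> c1 \<noteq> 0"
  shows "fls_const c1 * ev (G 0) + fls_const c0 * ev (G 1) \<noteq> 0"
proof
  assume rel: "fls_const c1 * ev (G 0) + fls_const c0 * ev (G 1) = 0"
  interpret K: fn_field k "Fw t" ev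
    by (intro fn_field.intro fn_field_axioms.intro k ev.rhom_axioms ev_dvd)
  \<comment> \<open>Both components are constant multiples of \<open>w\<close>, whose powers cancel
    in fractions of forms of equal degree.\<close>
  obtain g w where w: "\<And>i. ev (G i) = w * fls_const (g i)"
  proof (cases "c1 = 0")
    case True
    then have "ev (G 1) = 0" using rel c by simp
    then have "ev (G i) = ev (G 0) * fls_const (if i = 0 then 1 else 0)" for i
      using exhaust_2 [of i] by auto
    then show ?thesis by (rule that)
  next
    case False
    have "fls_const (inverse c1) * fls_const c1 = 1"
      using False by (simp add: fls_const_mult_const)
    then have "ev (G 0) = fls_const (inverse c1) * fls_const c1 * ev (G 0)" by simp
    also have "\<dots> = fls_const (inverse c1) * (fls_const c1 * ev (G 0))" by (rule mult.assoc)
    also have "fls_const c1 * ev (G 0) = fls_const c0 * ev (G 1)" using rel by (simp only: add_eq_0_char2)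
    also have "fls_const (inverse c1) * (fls_const c0 * ev (G 1)) = fls_const (inverse c1 * c0) * ev (G 1)"
      by (simp only: fls_const_mult_const mult.assoc [symmetric])
    also have "\<dots> = ev (G 1) * fls_const (inverse c1 * c0)" by (rule mult.commute)
    finally have "ev (G 0) = ev (G 1) * fls_const (inverse c1 * c0)" .
    then have "ev (G i) = ev (G 1) * fls_const (if i = 0 then inverse c1 * c0 else 1)" for i
      using exhaust_2 [of i] by auto
    then show ?thesis by (rule that)
  qed
  have const: "K.\<Phi> h \<in> range fls_const \<and> h \<in> carrier K.L" if h_in: "h \<in> pullback k (Fw t) P1 f H" for h H
  proof -
    obtain a b G' d where h: "h = rat k (Fw t) (msubst a G') (msubst b G')"
      and ab: "form k d a" "form k d b"
      and G': "represents k (Fw t) G' f" "\<not> Fw t dvd msubst b G'"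
      using h_in unfolding pullback_def by blast
    obtain D' where D': "\<And>i. form k D' (G' i)" using G'(1) unfolding represents_def by blast
    obtain c where c: "\<And>i. ev (G' i) = c * ev (G i)"
      using represents_proportional [OF represents_mono [OF G(1)] represents_mono [OF G'(1)] G(2)] by blast
    have evs: "ev (msubst r G') = (c * w) ^ d * fls_const (meval r g)" if "form k d r" for r
    proof -
      have "ev (msubst r G') = peval fls_const (\<lambda>i. (c * w) * fls_const (g i)) r"
        unfolding msubst_eq_peval peval_ev [symmetric] c w by (simp only: mult.assoc)
      also have "\<dots> = (c * w) ^ d * peval fls_const (\<lambda>i. fls_const (g i)) r"
        by (rule fls_hom.peval_scale [OF that])
      also have "peval fls_const (\<lambda>i. fls_const (g i)) r = fls_const (meval r g)"
        unfolding meval_eq_peval by (rule rhom.hom_peval [OF rhom_ident rhom_fls_const, symmetric])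
      finally show ?thesis .
    qed
    have forms: "form k (D' * d) (msubst a G')" "form k (D' * d) (msubst b G')"
      unfolding msubst_eq_peval using ab D' by (intro K.form_peval_mconst; simp)+
    have nz: "ev (msubst b G') \<noteq> 0" using G'(2) ev_dvd form_UNIV [OF forms(2)] by blast
    then have fr: "K.fracs (msubst a G') (msubst b G')" using forms by (intro K.fracsI)
    have b0: "meval b g \<noteq> 0" "(c * w) ^ d \<noteq> 0" using nz unfolding evs [OF ab(2)] by auto
    have "fls_const (meval a g / meval b g) * fls_const (meval b g) = fls_const (meval a g / meval b g * meval b g)"
      by (rule fls_const_mult_const)
    then have "fls_const (meval a g / meval b g) * fls_const (meval b g) = fls_const (meval a g)"
      unfolding times_divide_eq_left nonzero_mult_div_cancel_right [OF b0(1)] .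
    moreover have "K.\<Phi> h = fls_const (meval a g) / fls_const (meval b g)"
      unfolding h K.Phi_rat [OF fr] evs [OF ab(1)] evs [OF ab(2)] by (rule mult_divide_mult_cancel_left [OF b0(2)])
    moreover have "fls_const (meval b g) \<noteq> 0" using b0(1) by simp
    ultimately have "K.\<Phi> h = fls_const (meval a g / meval b g)" by (metis nonzero_mult_div_cancel_right)
    then show ?thesis using K.rat_mem [OF fr] h by blast
  qed
  have v2: "ev (mvar 2) \<noteq> 0" using cv by (simp add: cv_def)
  have fr: "K.fracs (mvar 0) (mvar 2)" by (rule K.fracsI [OF K.form_mvar K.form_mvar v2])
  let ?x = "rat k (Fw t) (mvar 0) (mvar 2)"
  have "(ring.transcendental K.L over pullback k (Fw t) P1 f (carrier (function_field k P1))) ?x"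
  proof (rule K.transcendental_over_constants [OF rhom_fls_const])
    show "hpoly fls_const (K.\<Phi> ?x) r \<noteq> 0" if "r \<noteq> 0" for r :: "'a poly"
      using cv that unfolding K.Phi_rat [OF fr] by (simp add: cv_def)
  qed (use const K.rat_mem [OF fr] in blast)+
  moreover have "(ring.algebraic K.L over pullback k (Fw t) P1 f (carrier (function_field k P1))) ?x"
    by (rule conjunct1 [OF bspec [OF _ K.rat_mem [OF fr]]])
      (rule sep [unfolded separable_morphism_def separable_extension_def, THEN conjunct2])
  ultimately show False by (simp add: over_def)
qed

section \<open>Smoothness and ordinarity\<close>

lemma mderiv_superset:
  assumes "finite S" "Poly_Mapping.keys p \<subseteq> S"
  shows "mderiv i p = (\<Sum>m\<in>S. Poly_Mapping.single (m - Poly_Mapping.single i 1) (of_nat (Poly_Mapping.lookup m i) * Poly_Mapping.lookup p m))"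
  unfolding mderiv_def using assms by (intro sum.mono_neutral_left) (auto simp: in_keys_iff)

lemma mderiv_add: "mderiv i (p + q) = mderiv i p + mderiv i q"
proof -
  let ?S = "Poly_Mapping.keys p \<union> Poly_Mapping.keys q"
  have "finite ?S" "Poly_Mapping.keys (p + q) \<subseteq> ?S" using Poly_Mapping.keys_add [of p q] by simp_all
  then show ?thesis
    by (simp add: mderiv_superset [where S = ?S] lookup_add distrib_left single_add sum.distrib)
qed

lemma mderiv_single:
  "mderiv i (Poly_Mapping.single m c) = Poly_Mapping.single (m - Poly_Mapping.single i 1) (of_nat (Poly_Mapping.lookup m i) * c)"
  by (cases "c = 0") (simp_all add: mderiv_def)

lemma meval_single: "meval (Poly_Mapping.single m c) x = c * (\<Prod>i\<in>UNIV. x i ^ Poly_Mapping.lookup m i)"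
  by (cases "c = 0") (simp_all add: meval_def)

definition expo :: "nat \<Rightarrow> nat \<Rightarrow> nat \<Rightarrow> 3 \<Rightarrow>\<^sub>0 nat" where
  "expo a b c = Poly_Mapping.single 0 a + Poly_Mapping.single 1 b + Poly_Mapping.single 2 c"

lemma lookup_expo [simp]:
  "Poly_Mapping.lookup (expo a b c) 0 = a" "Poly_Mapping.lookup (expo a b c) 1 = b" "Poly_Mapping.lookup (expo a b c) 2 = c"
  by (simp_all add: expo_def lookup_add lookup_single)

lemma Fw_single:
  fixes t :: "'a::{field,char2}"
  shows "Fw t = Poly_Mapping.single (expo 0 2 1) 1 + Poly_Mapping.single (expo 1 1 1) 1 + Poly_Mapping.single (expo 3 0 0) 1
    + Poly_Mapping.single (expo 2 0 1) t + Poly_Mapping.single (expo 0 0 3) 1"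
  unfolding Fw_conv single_conv_monomial prod_3 lookup_expo by (simp add: mconst_1 mult.assoc)

lemma meval_add: "meval (p + q) x = meval p x + meval q x"
  unfolding meval_eq_peval by (rule rhom.peval_add [OF rhom_ident])

text \<open>In characteristic two the partial derivatives are \<open>y z + x^2\<close>,
  \<open>x z\<close> and \<open>y^2 + x y + t x^2 + z^2\<close>; their only common zero is the
  origin.\<close>

lemma smooth_Fw:
  fixes t :: "'a::{field,char2}"
  shows "smooth (Fw t)"
  unfolding smooth_def
proof
  fix P assume "P \<in> points (Fw t)"
  then obtain x where x: "P = proj_point x" "x \<noteq> (\<lambda>_. 0)" unfolding points_def by blast
  have "x \<in> P" unfolding x proj_point_def by (rule CollectI, rule exI [of _ 1]) simp
  show "\<exists>i. \<not> vanishes_at (mderiv i (Fw t)) P"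
  proof (rule ccontr)
    assume "\<nexists>i. \<not> vanishes_at (mderiv i (Fw t)) P"
    then have 0: "meval (mderiv i (Fw t)) x = 0" for i using \<open>x \<in> P\<close> unfolding vanishes_at_def by blast
    have d: "meval (mderiv i (Poly_Mapping.single m c)) x = of_nat (Poly_Mapping.lookup m i) * c *
       (x 0 ^ (Poly_Mapping.lookup m 0 - (if i = 0 then 1 else 0)) * x 1 ^ (Poly_Mapping.lookup m 1 - (if i = 1 then 1 else 0))
        * x 2 ^ (Poly_Mapping.lookup m 2 - (if i = 2 then 1 else 0)))" for i m c
      by (auto simp add: mderiv_single meval_single prod_3 lookup_minus lookup_single)
    have three: "(3 :: 'a) = 1"
    proof -
      have "(3 :: 'a) = 2 + 1" by (simp del: two_char2)
      then show ?thesis by simp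
    qed
    have e: "x 1 * x 2 + x 0 ^ 2 = 0" "x 0 * x 2 = 0" "x 1 ^ 2 + x 0 * x 1 + t * x 0 ^ 2 + x 2 ^ 2 = 0"
      using 0 [of 0] 0 [of 1] 0 [of 2] unfolding Fw_single mderiv_add meval_add d lookup_expo by (simp_all add: three)
    have "x 0 = 0 \<and> x 1 = 0 \<and> x 2 = 0"
    proof (cases "x 2 = 0")
      case False
      then show ?thesis using e by auto
    qed (use e in auto)
    then have "x i = 0" for i using exhaust_3 [of i] by auto
    then show False using x(2) by blast
  qed
qed

text \<open>An affine point is its own negative exactly if \<open>x = 0\<close>, and then
  \<open>y^2 = 1\<close> leaves one \<open>y\<close>.\<close>

lemma ordinary_curve:
  fixes t :: "'a::{field,char2}"
  shows "ordinary 1 t 0 0 (1 :: 'a)"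
proof -
  have "{P \<in> ec_points 1 t 0 0 1. (ec_add 1 t 0 0 1 P ^^ CHAR('a)) None = None} = {None, Some (0, 1)}" (is "?S = _")
  proof
    show "{None, Some (0, 1)} \<subseteq> ?S" by (auto simp: ec_points_def numeral_2_eq_2)
    show "?S \<subseteq> {None, Some (0, 1)}"
    proof
      fix P assume P: "P \<in> ?S"
      show "P \<in> {None, Some (0, 1)}"
      proof (cases P)
        case (Some xy)
        obtain x y where xy: "xy = (x, y)" by (cases xy)
        have "ec_add 1 t 0 0 1 P P = None" using P by (simp add: Some xy numeral_2_eq_2)
        then have "x = 0" by (simp add: Some xy Let_def split: if_splits)
        moreover from this have "y^2 = 1" using P by (simp add: Some xy ec_points_def)
        then have "(y + 1)^2 = 0" by (simp add: square_add)
        then have "y = 1" by (simp add: add_eq_0_char2)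
        ultimately show ?thesis by (simp add: Some xy)
      qed simp
    qed
  qed
  then show ?thesis unfolding ordinary_def by simp
qed

lemma elliptic_curve_F2t: "elliptic_curve perfect_closure_F2t 1 tt 0 0 1"
  unfolding elliptic_curve_def using smooth_Fw tt_mem by simp

text \<open>One representative \<open>G\<close>, chosen at infinity, gives a fixed quotient of pairs
  over \<open>k\<close>. At other points it may be undefined; a local representative computes the
  index there, and proportionality carries its parity over to \<open>G\<close>.\<close>

lemma no_tame_separable_morphism:
  assumes sep: "separable_morphism perfect_closure_F2t (Fw tt) P1 f" and tame: "tame (Fw tt) P1 f"
  shows False
proof -
  let ?k = perfect_closure_F2t
  have mor: "morphism ?k (Fw tt) P1 f" using sep by (simp add: separable_morphism_def)
  have local_rep: "\<exists>G D j. represents ?k (Fw tt) G f \<and> (\<forall>i. form ?k D (G i)) \<and> meval (G j) (p0 p) \<noteq> 0"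
    if p: "upoint tt p l" for p l
  proof -
    obtain G j where G: "represents ?k (Fw tt) G f" "\<not> vanishes_at (G j) (proj_point (p0 p))"
      using mor upoint.P_in_points [OF p] unfolding morphism_def by blast
    then obtain D where D: "\<And>i. form ?k D (G i)" unfolding represents_def by blast
    then show ?thesis using G vanishes_at_proj_point by blast
  qed
  obtain xi yi :: "KK fls" where "infinity_at tt xi yi" using ex_infinity by blast
  then have "branch_at tt xi yi" by (simp add: branch_at_def)
  then obtain pi li where pi: "upoint tt pi li" by (rule branch_upoint)
  obtain G D j where G: "represents ?k (Fw tt) G f" "\<And>i. form ?k D (G i)" "meval (G j) (p0 pi) \<noteq> 0"
    using local_rep [OF pi] by blast
  have Gj: "peval fls_const (fv pi) (G j) \<noteq> 0" using upoint.ev_unit_iff [OF pi] G(3) by blast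
  have "\<forall>i. \<exists>r. kpair ?k r \<and> (\<forall>v. v 2 \<noteq> 0 \<and> on_curve tt (v 0 / v 2) (v 1 / v 2) \<longrightarrow>
    peval fls_const v (G i) = v 2 ^ D * pev (v 0 / v 2) (v 1 / v 2) r)"
    using form_reduce [OF perf.subfield_set_axioms G(2) tt_mem] by blast
  then obtain r where r: "\<And>i. kpair ?k (r i)" and
    red: "\<And>i v. v 2 \<noteq> 0 \<and> on_curve tt (v 0 / v 2) (v 1 / v 2) \<Longrightarrow>
      peval fls_const v (G i) = v 2 ^ D * pev (v 0 / v 2) (v 1 / v 2) (r i)"
    by metis
  have main: "pev x y (r 1) \<noteq> 0 \<and> (\<exists>c0. odd (fls_subdegree (pev x y (r 0) / pev x y (r 1) + fls_const c0)))"
    if branch: "branch_at tt x y" for x y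
  proof -
    obtain p l where p: "upoint tt p l" and xy: "x = fv p 0 / fv p 2" "y = fv p 1 / fv p 2"
      using branch by (rule branch_upoint)
    interpret upoint tt p l by (rule p)
    have v2: "fv p 2 \<noteq> 0" and eG: "ev (G i) = fv p 2 ^ D * pev x y (r i)" for i
      using cv red [of "fv p" i] by (auto simp: cv_def xy)
    obtain G' D' k' where G': "represents ?k (Fw tt) G' f" "\<And>i. form ?k D' (G' i)" "meval (G' k') (p0 p) \<noteq> 0"
      using local_rep [OF p] by blast
    have odd: "odd (ramification_index (Fw tt) P1 f P)"
      using tame P_in_points by (simp add: tame_def)
    \<comment> \<open>All branches have the same vanishing forms, so what is nonzero on the branch
      at infinity is nonzero here.\<close>
    have "ev (G j) \<noteq> 0" using cv_vanish [OF cv upoint.cv [OF pi] form_UNIV [OF G(2)]] Gj by blast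
    then have nonconst: "fls_const c1 * ev (G 0) + fls_const c0 * ev (G 1) \<noteq> 0" if "c0 \<noteq> 0 \<or> c1 \<noteq> 0" for c0 c1
      by (rule separable_imp_nonconstant [OF perf.subfield_set_axioms sep G(1) _ that])
    have "ev (G 1) \<noteq> 0 \<and> (\<exists>c0. odd (fls_subdegree (ev (G 0) / ev (G 1) + fls_const c0)))"
      by (rule tame_odd [OF form_UNIV [OF G'(2)] represents_mono [OF G'(1)] G'(3) odd represents_mono [OF G(1)] nonconst])
    moreover have "ev (G 0) / ev (G 1) = pev x y (r 0) / pev x y (r 1)"
      unfolding eG by (rule mult_divide_mult_cancel_left) (use v2 in simp)
    ultimately show ?thesis by (auto simp: eG)
  qed
  show False
    by (rule no_tame_function [OF r [of 0] r [of 1]]; rule main; unfold branch_at_def; blast)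
qed

theorem theorem1p4:
  "\<exists>a1 a2 a3 a4 a6 :: bit poly fract alg_closure.
     elliptic_curve perfect_closure_F2t a1 a2 a3 a4 a6 \<and>
     ordinary a1 a2 a3 a4 a6 \<and>
     \<not> (\<exists>f. finite_morphism perfect_closure_F2t (weierstrass a1 a2 a3 a4 a6) P1 f \<and>
            separable_morphism perfect_closure_F2t (weierstrass a1 a2 a3 a4 a6) P1 f \<and>
            tame (weierstrass a1 a2 a3 a4 a6) P1 f)"
  using elliptic_curve_F2t ordinary_curve no_tame_separable_morphism by blast

end
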